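(* Suppose the mask distribution $\mathcal{M}$ satisfies the assumption: the set $\{\mu\odot(2M_0-\mathbf 1): M_0\in\mathrm{support}(M)\}$ spans $\mathbb{R}^d$, and $\mathbb{P}[\lambda\,\mathbf 1_{M=M_0}\notin\{0,1\}]>0$ for each $M_0\in\mathrm{support}(M)$, where $(M,\lambda)\sim\mathcal{M}$. Then there exist constants $C>0$ and $\kappa_0>0$, depending only on $d,\mu,\Sigma,\mathcal{M}$, such that for all $\kappa\in[\kappa_0,\infty)$, all $\epsilon,\delta\in(0,1)$ and all integers $n\ge2$ with $$n\ \ge\ \frac{C}{\epsilon^4}\Big(1+\log\frac1\epsilon+\log\frac1\delta\Big),$$ if $S=\{(x_i,y_i)\}_{i=1}^n$ is drawn i.i.d. from $\mathcal{D}_\kappa$, then with probability at least $1-\delta$ (over $S$ and the masks) the loss $\mathcal{L}_S^{\mathrm{mask}}$ has a unique minimizer $\hat w^*_{\mathrm{mask},S}$ over $\mathbb{R}^d$ and $\mathrm{sim}(\hat w^*_{\mathrm{mask},S},w^*_{\mathrm{mask}}(n,\kappa))\ge1-\epsilon$.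
   Context: Fix $d\ge 1$, a nonzero vector $\mu\in\mathbb{R}^d$ and a (symmetric) positive definite matrix $\Sigma\in\mathbb{R}^{d\times d}$ with $\|\mu\|^2=\|\Sigma\|$ ($\ell_2$ norm for vectors, spectral norm for matrices). For $\kappa\in(0,\infty)$, $\mathcal{D}_\kappa$ is the distribution of $(x,y)\in\mathbb{R}^d\times\{0,1\}$ with $y$ uniform on $\{0,1\}$, $x\mid y=1\sim N(\mu,\kappa^{-1}\Sigma)$ and $x\mid y=0\sim N(-\mu,\kappa^{-1}\Sigma)$. Let $l(z)=\log(1+e^{-z})$. Masking-based Mixup: $\mathcal{M}$ is a probability distribution with support contained in $\{0,1\}^d\times[0,1]$; $(M_{i,j},\lambda_{i,j})$ ($1\le i,j\le n$) are i.i.d. from $\mathcal{M}$, independent of $S$; $\odot$ is the entrywise product and $\mathbf 1$ the all-ones vector; $$\tilde x^{\mathrm{mask}}_{i,j}=M_{i,j}\odot x_i+(\mathbf 1-M_{i,j})\odot x_j,\qquad \tilde y^{\mathrm{mask}}_{i,j}=\lambda_{i,j}y_i+(1-\lambda_{i,j})y_j.$$ The masking-based Mixup loss is $$\mathcal{L}_S^{\mathrm{mask}}(w)=\frac1{n^2}\sum_{i,j=1}^n\big[\tilde y^{\mathrm{mask}}_{i,j}\,l(w^\top\tilde x^{\mathrm{mask}}_{i,j})+(1-\tilde y^{\mathrm{mask}}_{i,j})\,l(-w^\top\tilde x^{\mathrm{mask}}_{i,j})\big],\quad w\in\mathbb{R}^d.$$ $\mathbb{E}_\kappa$ is expectation over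 $S$ and the $(M_{i,j},\lambda_{i,j})$, and $w^*_{\mathrm{mask}}(n,\kappa)$ denotes the unique minimizer over $\mathbb{R}^d$ of $w\mapsto\mathbb{E}_\kappa[\mathcal{L}_S^{\mathrm{mask}}(w)]$ (it exists and is unique under the stated assumption). In the assumption, $\mathbf 1_{M=M_0}$ is the $0$-$1$ indicator and $\mathrm{support}(M)$ is the support of the marginal law of $M$. For nonzero $u,v\in\mathbb{R}^d$, $\mathrm{sim}(u,v)=\frac{u^\top v}{\|u\|\|v\|}$ (the assertion about $\mathrm{sim}$ includes that both vectors are nonzero). *)

theory Defs
  imports "HOL-Probability.Probability"
begin

definition logistic_loss :: "real \<Rightarrow> real" where
  "logistic_loss z = ln (1 + exp (- z))"

definition pos_definite :: "real ^ 'd ^ 'd \<Rightarrow> bool" where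
  "pos_definite A \<longleftrightarrow> transpose A = A \<and> (\<forall>x. x \<noteq> 0 \<longrightarrow> x \<bullet> (A *v x) > 0)"

text \<open>The norm of the type \<open>real ^ 'd ^ 'd\<close> is the Frobenius norm, not the spectral norm.\<close>

definition spectral_norm :: "real ^ 'd ^ 'd \<Rightarrow> real" where
  "spectral_norm A = onorm (\<lambda>x. A *v x)"

text \<open>Multivariate normal law, by its Lebesgue density; meaningful for positive definite covariance.\<close>

definition gaussian :: "real ^ 'd \<Rightarrow> real ^ 'd ^ 'd \<Rightarrow> (real ^ 'd) measure" where
  "gaussian m A = density lborel (\<lambda>x. ennreal
     (exp (- ((x - m) \<bullet> (matrix_inv A *v (x - m))) / 2) / sqrt ((2 * pi) ^ CARD('d) * det A)))"

definition data_dist :: "real ^ 'd \<Rightarrow> real ^ 'd ^ 'd \<Rightarrow> real \<Rightarrow> ((real ^ 'd) \<times> real) measure" where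
  "data_dist \<mu> \<Sigma> \<kappa> =
     measure_pmf (pmf_of_set {0, 1 :: real}) \<bind>
       (\<lambda>y. distr (gaussian (if y = 1 then \<mu> else - \<mu>) (inverse \<kappa> *\<^sub>R \<Sigma>)) borel (\<lambda>x. (x, y)))"

text \<open>Topological support of a Borel measure.\<close>

definition measure_support :: "'a::topological_space measure \<Rightarrow> 'a set" where
  "measure_support N = {x. \<forall>U. open U \<and> x \<in> U \<longrightarrow> emeasure N U > 0}"

text \<open>On vectors, \<open>*\<close> is the entrywise product and \<open>1\<close> is the all-ones vector.\<close>

definition mask_dist :: "((real ^ 'd) \<times> real) measure \<Rightarrow> bool" where
  "mask_dist \<M> \<longleftrightarrow> prob_space \<M> \<and> sets \<M> = sets borel \<and>
     measure_support \<M> \<subseteq> {m. \<forall>k. m $ k \<in> {0, 1}} \<times> {0..1}"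

definition mask_assumption :: "real ^ 'd \<Rightarrow> ((real ^ 'd) \<times> real) measure \<Rightarrow> bool" where
  "mask_assumption \<mu> \<M> \<longleftrightarrow>
     (let supp = measure_support (distr \<M> borel fst) in
        span {\<mu> * (2 *\<^sub>R m0 - 1) | m0. m0 \<in> supp} = UNIV \<and>
        (\<forall>m0 \<in> supp. \<P>((m, l) in \<M>. l * indicator {m0} m \<notin> {0, 1}) > 0))"

text \<open>\<open>S i\<close> is the pair $(x_i, y_i)$ and \<open>T (i, j)\<close> is the pair $(M_{i,j}, \lambda_{i,j})$.\<close>

definition mask_x :: "(nat \<Rightarrow> (real ^ 'd) \<times> real) \<Rightarrow> (nat \<times> nat \<Rightarrow> (real ^ 'd) \<times> real) \<Rightarrow> nat \<Rightarrow> nat \<Rightarrow> real ^ 'd" where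
  "mask_x S T i j = fst (T (i, j)) * fst (S i) + (1 - fst (T (i, j))) * fst (S j)"

definition mask_y :: "(nat \<Rightarrow> (real ^ 'd) \<times> real) \<Rightarrow> (nat \<times> nat \<Rightarrow> (real ^ 'd) \<times> real) \<Rightarrow> nat \<Rightarrow> nat \<Rightarrow> real" where
  "mask_y S T i j = snd (T (i, j)) * snd (S i) + (1 - snd (T (i, j))) * snd (S j)"

definition mask_loss ::
  "nat \<Rightarrow> (nat \<Rightarrow> (real ^ 'd) \<times> real) \<Rightarrow> (nat \<times> nat \<Rightarrow> (real ^ 'd) \<times> real) \<Rightarrow> real ^ 'd \<Rightarrow> real" where
  "mask_loss n S T w = 1 / (real n)\<^sup>2 * (\<Sum>i = 1..n. \<Sum>j = 1..n.
     mask_y S T i j * logistic_loss (w \<bullet> mask_x S T i j)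
     + (1 - mask_y S T i j) * logistic_loss (- (w \<bullet> mask_x S T i j)))"

definition sample_dist ::
  "nat \<Rightarrow> ((real ^ 'd) \<times> real) measure \<Rightarrow> ((real ^ 'd) \<times> real) measure \<Rightarrow>
    ((nat \<Rightarrow> (real ^ 'd) \<times> real) \<times> (nat \<times> nat \<Rightarrow> (real ^ 'd) \<times> real)) measure" where
  "sample_dist n \<D> \<M> =
     (\<Pi>\<^sub>M i \<in> {1..n}. \<D>) \<Otimes>\<^sub>M (\<Pi>\<^sub>M p \<in> {1..n} \<times> {1..n}. \<M>)"

definition expected_mask_loss ::
  "nat \<Rightarrow> ((real ^ 'd) \<times> real) measure \<Rightarrow> ((real ^ 'd) \<times> real) measure \<Rightarrow> real ^ 'd \<Rightarrow> real" where
  "expected_mask_loss n \<D> \<M> w = (\<integral>(S, T). mask_loss n S T w \<partial>sample_dist n \<D> \<M>)"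

definition unique_minimizer :: "('a \<Rightarrow> real) \<Rightarrow> 'a \<Rightarrow> bool" where
  "unique_minimizer f w \<longleftrightarrow> (\<forall>v. is_arg_min f (\<lambda>_. True) v \<longleftrightarrow> v = w)"

definition sim :: "real ^ 'd \<Rightarrow> real ^ 'd \<Rightarrow> real" where
  "sim u v = (u \<bullet> v) / (norm u * norm v)"

end

theory Submission
  imports Defs
begin

text \<open>With \<open>l (- z) = l z + z\<close> the loss of a mixed pair is \<open>l (w \<bullet> x) + (1 - y) * (w \<bullet> x)\<close>, which is convex in \<open>w\<close>.
  Pairs of nearly noiseless points from opposite classes that are mixed by a mask \<open>m\<close> sit near \<open>\<mu> * (2 *\<^sub>R m - 1)\<close>.
  Their proportion is bounded below, these vectors span the space and their labels stay away from \<open>0\<close> and \<open>1\<close>, so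
  they make both the expected and, with high probability, the empirical loss locally strongly convex, and they confine
  the expected minimizer \<open>w\<^sub>0\<close> to a fixed ball. The expected gradient at \<open>0\<close> has a uniformly negative component along
  \<open>\<mu>\<close>, so \<open>w\<^sub>0\<close> stays away from \<open>0\<close>. The empirical gradient at \<open>w\<^sub>0\<close> has mean zero and sub-exponential summands; its
  \<open>n\<^sup>2\<close> summands split into \<open>4 * n\<close> groups of independent ones, and a Chernoff bound makes it of size \<open>\<epsilon>\<close>. Strong
  convexity then places the empirical minimizer within distance of order \<open>\<epsilon>\<close> of \<open>w\<^sub>0\<close>.\<close>

section \<open>Logistic loss and convex minimization\<close>

text \<open>The target minimizer itself changes with \<open>\<kappa>\<close> and \<open>n\<close>,
  so every bound on it must be uniform in both. This is why the Gaussian data enter only through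
  \<open>regular_data\<close>: an exponential moment \<open>K\<close> fixed in advance and a mean
  noise level \<open>\<rho>\<close> that large \<open>\<kappa>\<close> makes as small as the mask
  constants demand. The condition \<open>2 \<le> n\<close> enters because a good pair needs two
  different points: off-diagonal pairs then make up at least half of all pairs. No uniform law of
  large numbers over \<open>w\<close> occurs. Only finitely many averages are controlled, the
  gradient components at the single point \<open>w\<^sub>0\<close> and the proportions of good
  pairs; convexity carries this to all other \<open>w\<close>. Gradients act only through pointwise
  inequalities, which survive taking expectations, so nothing is differentiated under an integral.
  The final event asks for a unique minimizer, an uncountable condition, and a non-measurable set
  has probability \<open>0\<close> by convention. A lower bound on its probability therefore needs a
  proof that the event is measurable.\<close>

definition sigmoid :: "real \<Rightarrow> real" where
  "sigmoid z = 1 / (1 + exp (- z))"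

lemma sigmoid_pos: "0 < sigmoid z" and sigmoid_less_1: "sigmoid z < 1"
  by (auto simp: sigmoid_def add_pos_pos divide_simps)

lemma logistic_loss_uminus: "logistic_loss (- z) = logistic_loss z + z"
proof -
  have "1 + exp z = exp z * (1 + exp (- z))" by (simp add: algebra_simps exp_minus)
  then have "ln (1 + exp z) = z + ln (1 + exp (- z))"
    by (simp add: ln_mult_pos add_pos_pos)
  then show ?thesis by (simp add: logistic_loss_def)
qed

lemma logistic_loss_nonneg: "0 \<le> logistic_loss z"
  by (simp add: logistic_loss_def)

lemma logistic_loss_ge_uminus: "- z \<le> logistic_loss z"
  using logistic_loss_nonneg[of "- z"] by (simp add: logistic_loss_uminus)

lemma logistic_loss_deriv:
  "(logistic_loss has_real_derivative sigmoid z - 1) (at z)"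
  unfolding logistic_loss_def[abs_def] sigmoid_def
  using exp_gt_zero[of "- z"]
  by (auto intro!: derivative_eq_intros simp: add_pos_pos divide_simps simp del: exp_gt_zero)

lemma sigmoid_deriv:
  "(sigmoid has_real_derivative sigmoid z * (1 - sigmoid z)) (at z)"
proof -
  have n: "1 + exp (- z) \<noteq> 0" by (metis add_pos_pos exp_gt_zero less_irrefl zero_less_one)
  show ?thesis
    unfolding sigmoid_def[abs_def]
    by (rule derivative_eq_intros refl n)+ (use n in \<open>simp add: field_simps power2_eq_square\<close>)
qed

text \<open>Common source of the three bounds below. They differ only in how the curvature
  \<open>sigmoid t * (1 - sigmoid t)\<close> is estimated: from below by \<open>0\<close>, from
  above by \<open>1\<close>, and from below by \<open>exp (- R) / 4\<close>. Only the last one uses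
  where \<open>t\<close> lies.\<close>

lemma logistic_taylor:
  obtains t where "min a b \<le> t" "t \<le> max a b"
    "logistic_loss b = logistic_loss a + (sigmoid a - 1) * (b - a)
       + sigmoid t * (1 - sigmoid t) / 2 * (b - a)\<^sup>2"
proof (cases "a = b")
  case True
  then show ?thesis using that[of a] by simp
next
  case False
  define diff where "diff k = (if k = 0 then logistic_loss else if k = Suc 0 then (\<lambda>z. sigmoid z - 1)
    else (\<lambda>z. sigmoid z * (1 - sigmoid z)))" for k :: nat
  have "\<exists>t. (if b < a then b < t \<and> t < a else a < t \<and> t < b) \<and>
      logistic_loss b = (\<Sum>m<2. diff m a / fact m * (b - a) ^ m) + diff 2 t / fact 2 * (b - a) ^ 2"
  proof (rule Taylor[where a = "min a b" and b = "max a b"])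
    show "\<forall>m t. m < 2 \<and> min a b \<le> t \<and> t \<le> max a b \<longrightarrow>
        (diff m has_real_derivative diff (Suc m) t) (at t)"
      using logistic_loss_deriv sigmoid_deriv
      by (auto simp: diff_def less_2_cases_iff intro!: derivative_eq_intros)
  qed (use False in \<open>auto simp: diff_def\<close>)
  then obtain t where t: "if b < a then b < t \<and> t < a else a < t \<and> t < b"
    "logistic_loss b = (\<Sum>m<2. diff m a / fact m * (b - a) ^ m) + diff 2 t / fact 2 * (b - a) ^ 2"
    by blast
  show ?thesis
    by (rule that[of t]) (use t in \<open>auto simp: diff_def numeral_2_eq_2 split: if_splits\<close>)
qed

lemma logistic_loss_tangent:
  "logistic_loss a + (sigmoid a - 1) * (b - a) \<le> logistic_loss b"
proof -
  obtain t where t: "logistic_loss b = logistic_loss a + (sigmoid a - 1) * (b - a)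
       + sigmoid t * (1 - sigmoid t) / 2 * (b - a)\<^sup>2"
    using logistic_taylor by blast
  show ?thesis unfolding t using sigmoid_pos[of t] sigmoid_less_1[of t] by simp
qed

lemma logistic_loss_quadratic_upper:
  "logistic_loss b \<le> logistic_loss a + (sigmoid a - 1) * (b - a) + (b - a)\<^sup>2"
proof -
  obtain t where t: "logistic_loss b = logistic_loss a + (sigmoid a - 1) * (b - a)
       + sigmoid t * (1 - sigmoid t) / 2 * (b - a)\<^sup>2"
    using logistic_taylor by blast
  have "sigmoid t * (1 - sigmoid t) \<le> 1 * 1"
    by (rule mult_mono) (use sigmoid_pos[of t] sigmoid_less_1[of t] in auto)
  then have "sigmoid t * (1 - sigmoid t) / 2 * (b - a)\<^sup>2 \<le> 1 * (b - a)\<^sup>2"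
    by (intro mult_right_mono) auto
  then show ?thesis unfolding t by simp
qed

text \<open>The intermediate point of the Taylor formula also lies in \<open>[-R, R]\<close>, where
  the curvature is the reciprocal of \<open>2 + exp t + exp (- t)\<close>, a number of at most
  \<open>4 * exp R\<close>. The factor \<open>1 / 2\<close> of the remainder turns \<open>4\<close>
  into \<open>8\<close>.\<close>

lemma logistic_loss_strongly_convex:
  assumes "\<bar>a\<bar> \<le> R" "\<bar>b\<bar> \<le> R"
  shows "logistic_loss a + (sigmoid a - 1) * (b - a) + exp (- R) / 8 * (b - a)\<^sup>2 \<le> logistic_loss b"
proof -
  obtain t where t: "min a b \<le> t" "t \<le> max a b" "logistic_loss b = logistic_loss a + (sigmoid a - 1) * (b - a)
       + sigmoid t * (1 - sigmoid t) / 2 * (b - a)\<^sup>2"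
    using logistic_taylor by blast
  have tR: "\<bar>t\<bar> \<le> R" using t assms by linarith
  have "(1 + exp (- t)) * (1 + exp t) = 2 + exp (- t) + exp t"
    by (simp add: algebra_simps flip: exp_add)
  also have "\<dots> \<le> 2 * exp R + exp R + exp R"
    using tR by (intro add_mono) auto
  finally have le: "(1 + exp (- t)) * (1 + exp t) \<le> 4 * exp R" by simp
  have "1 - sigmoid t = 1 / (1 + exp t)"
  proof -
    have n: "1 + exp (- t) \<noteq> 0" "1 + exp t \<noteq> 0" by (metis add_pos_pos exp_gt_zero less_irrefl zero_less_one)+
    show ?thesis using n unfolding sigmoid_def
      by (simp add: divide_simps) (simp add: algebra_simps flip: exp_add)
  qed
  then have "sigmoid t * (1 - sigmoid t) = 1 / ((1 + exp (- t)) * (1 + exp t))"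
    by (simp add: sigmoid_def)
  also have "\<dots> \<ge> 1 / (4 * exp R)"
    using le by (intro divide_left_mono mult_pos_pos add_pos_pos) auto
  finally have "exp (- R) / 8 \<le> sigmoid t * (1 - sigmoid t) / 2"
    by (simp add: exp_minus field_simps)
  then have "exp (- R) / 8 * (b - a)\<^sup>2 \<le> sigmoid t * (1 - sigmoid t) / 2 * (b - a)\<^sup>2"
    by (rule mult_right_mono) simp
  then show ?thesis unfolding t(3) by simp
qed

lemma unique_minimizer_iff:
  "unique_minimizer f w \<longleftrightarrow> (\<forall>v. f w \<le> f v) \<and> (\<forall>v. v \<noteq> w \<longrightarrow> \<not> (\<forall>u. f v \<le> f u))"
  unfolding unique_minimizer_def is_arg_min_def by (auto simp: not_less)

text \<open>Convexity turns the boundary inequality on a small ball into a global statement.\<close>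

lemma locally_strongly_convex_unique_minimizer:
  fixes f :: "'a::euclidean_space \<Rightarrow> real"
  assumes conv: "convex_on UNIV f"
    and sc: "\<And>w u. norm w \<le> R \<Longrightarrow> norm u \<le> 1 \<Longrightarrow> f w + G w \<bullet> u + c * (norm u)\<^sup>2 \<le> f (w + u)"
    and c: "c > 0" and r: "0 < r" "r \<le> 1" and w0: "norm w0 + 2 \<le> R"
    and G: "norm (G w0) < c * r"
  shows "\<exists>w. unique_minimizer f w \<and> norm (w - w0) \<le> r"
proof -
  have cont: "continuous_on UNIV f" using convex_on_continuous[OF open_UNIV conv] .
  have "\<exists>w\<in>cball w0 r. \<forall>v\<in>cball w0 r. f w \<le> f v"
    by (rule continuous_attains_inf) (use r cont continuous_on_subset in auto)
  then obtain w where w: "w \<in> cball w0 r" "\<And>v. v \<in> cball w0 r \<Longrightarrow> f w \<le> f v" by blast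
  \<comment> \<open>On the sphere of radius \<open>r\<close> the quadratic gain
    \<open>c * r\<^sup>2\<close> exceeds the possible linear loss
    \<open>norm (G w0) * r\<close>.\<close>
  have bd: "f w0 < f v" if "norm (v - w0) = r" for v
  proof -
    have "f w0 + G w0 \<bullet> (v - w0) + c * (norm (v - w0))\<^sup>2 \<le> f (w0 + (v - w0))"
      by (rule sc) (use w0 that r in auto)
    moreover have "\<bar>G w0 \<bullet> (v - w0)\<bar> \<le> norm (G w0) * norm (v - w0)"
      by (rule Cauchy_Schwarz_ineq2)
    moreover have "norm (G w0) * norm (v - w0) < c * r * r"
      using G that r by simp
    ultimately show ?thesis using that by (simp add: power2_eq_square)
  qed
  have glob: "f w \<le> f v" for v
  proof (cases "v \<in> cball w0 r")
    case False
    then have d: "norm (v - w0) > r" by (simp add: dist_norm norm_minus_commute)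
    \<comment> \<open>\<open>u\<close> is the point where the segment from \<open>w0\<close> to
      \<open>v\<close> crosses the sphere; since \<open>f\<close> has risen there, convexity keeps
      it above \<open>f w0\<close> at \<open>v\<close>.\<close>
    define s where "s = r / norm (v - w0)"
    have s: "0 < s" "s < 1" using d r by (auto simp: s_def divide_simps)
    define u where "u = (1 - s) *\<^sub>R w0 + s *\<^sub>R v"
    have "u - w0 = s *\<^sub>R (v - w0)" by (simp add: u_def algebra_simps)
    moreover have "v \<noteq> w0" using d r by auto
    ultimately have nu: "norm (u - w0) = r" using d r by (simp add: s_def)
    have "f u \<le> (1 - s) * f w0 + s * f v"
      unfolding u_def using conv s by (auto intro!: convex_onD)
    moreover have "f w0 < f u" using bd nu by simp
    ultimately have "f w0 < (1 - s) * f w0 + s * f v" by simp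
    then have "s * f w0 < s * f v" by (simp add: algebra_simps)
    then have "f w0 < f v" using s by simp
    moreover have "f w \<le> f w0" using w r by auto
    ultimately show ?thesis by simp
  qed (use w in auto)
  have nw: "norm w \<le> norm w0 + 1" using w r norm_triangle_sub[of w w0]
    by (auto simp: dist_norm norm_minus_commute)
  have uniq: "v = w" if v: "\<And>u. f v \<le> f u" for v
  proof (rule ccontr)
    assume "v \<noteq> w"
    \<comment> \<open>\<open>d\<close> is half a step from \<open>w\<close> towards
      \<open>v\<close>, shortened to norm at most \<open>1\<close>. Applying strong convexity at
      \<open>w + d\<close> in the directions \<open>d\<close> and \<open>- d\<close> cancels the
      linear terms and puts \<open>f (w + d)\<close> strictly below the minimum. The slack
      \<open>2\<close> in \<open>norm w0 + 2 \<le> R\<close> pays for \<open>w\<close> and for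
      \<open>d\<close>.\<close>
    define s where "s = min 1 (1 / norm (v - w))"
    have s: "0 < s" "s \<le> 1" "s * norm (v - w) \<le> 1" using \<open>v \<noteq> w\<close> by (auto simp: s_def min_def divide_simps)
    define d where "d = (s / 2) *\<^sub>R (v - w)"
    have d: "d \<noteq> 0" "norm d \<le> 1" using s \<open>v \<noteq> w\<close> by (auto simp: d_def)
    have "f (w + 2 *\<^sub>R d) = f ((1 - s) *\<^sub>R w + s *\<^sub>R v)" by (simp add: d_def algebra_simps)
    also have "\<dots> \<le> (1 - s) * f w + s * f v"
      using conv s by (auto intro!: convex_onD)
    also have "\<dots> \<le> f w" using v[of w] s by (simp add: algebra_simps)
    finally have 1: "f (w + 2 *\<^sub>R d) \<le> f w" .
    have nm: "norm (w + d) \<le> R" using norm_triangle_ineq[of w d] nw d w0 by linarith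
    have "f (w + d) + G (w + d) \<bullet> d + c * (norm d)\<^sup>2 \<le> f (w + d + d)"
      by (rule sc) (use nm d in auto)
    moreover have "f (w + d) + G (w + d) \<bullet> (- d) + c * (norm (- d))\<^sup>2 \<le> f (w + d + (- d))"
      by (rule sc) (use nm d in auto)
    moreover have "w + d + d = w + 2 *\<^sub>R d" by (simp add: scaleR_2)
    moreover have "0 < c * (norm d)\<^sup>2" using c d by simp
    ultimately have "f (w + d) < f w" using 1 by simp
    then show False using glob[of "w + d"] by simp
  qed
  have "unique_minimizer f w" unfolding unique_minimizer_iff using glob uniq by blast
  then show ?thesis using w by (auto simp: dist_norm norm_minus_commute)
qed

text \<open>For unit vectors \<open>a\<close> and \<open>b\<close> the similarity is
  \<open>1 - (norm (a - b))\<^sup>2 / 2\<close>, and normalizing both vectors at most doubles their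
  relative distance. Hence the loss of similarity is quadratic in the relative error.\<close>

lemma sim_ge:
  fixes u v :: "real ^ 'd"
  assumes "u \<noteq> 0" "v \<noteq> 0"
  shows "1 - 2 * (norm (u - v) / norm v)\<^sup>2 \<le> sim u v"
proof -
  define a where "a = u /\<^sub>R norm u"
  define b where "b = v /\<^sub>R norm v"
  have na: "norm a = 1" "norm b = 1" using assms by (auto simp: a_def b_def)
  have s: "sim u v = a \<bullet> b" by (simp add: sim_def a_def b_def divide_simps)
  have "(norm (a - b))\<^sup>2 = 2 - 2 * (a \<bullet> b)"
    using na by (simp add: power2_norm_eq_inner inner_diff inner_commute norm_eq_1)
  moreover have "norm (a - b) \<le> 2 * (norm (u - v) / norm v)"
  proof -
    have "norm v *\<^sub>R (a - b) = (norm v - norm u) *\<^sub>R a + (u - v)"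
      using assms by (simp add: a_def b_def algebra_simps)
    then have "norm v * norm (a - b) = norm ((norm v - norm u) *\<^sub>R a + (u - v))"
      by (metis abs_norm_cancel norm_scaleR)
    also have "\<dots> \<le> \<bar>norm v - norm u\<bar> + norm (u - v)"
      using norm_triangle_ineq[of "(norm v - norm u) *\<^sub>R a" "u - v"] na by simp
    also have "\<dots> \<le> 2 * norm (u - v)" using norm_triangle_ineq3[of v u] by (simp add: norm_minus_commute)
    finally show ?thesis using assms by (simp add: field_simps)
  qed
  then have "(norm (a - b))\<^sup>2 \<le> (2 * (norm (u - v) / norm v))\<^sup>2" by (intro power_mono) auto
  ultimately show ?thesis unfolding s by (simp add: power_mult_distrib power_divide)
qed

text \<open>The sum \<open>g u\<close> of all \<open>\<bar>v \<bullet> u\<bar>\<close> vanishes on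
  no unit vector, because only \<open>0\<close> is orthogonal to a spanning set. By compactness it
  has a positive minimum on the sphere, and the largest summand is at least the average. This makes
  the spanning assumption on the masks quantitative.\<close>

lemma span_UNIV_uniform_direction:
  fixes V :: "'a::euclidean_space set"
  assumes "finite V" "span V = UNIV"
  obtains c where "c > 0" "\<And>u. u \<noteq> 0 \<Longrightarrow> \<exists>v\<in>V. c * norm u \<le> \<bar>v \<bullet> u\<bar>"
proof -
  define g where "g u = (\<Sum>v\<in>V. \<bar>v \<bullet> u\<bar>)" for u
  have "\<exists>x\<in>sphere 0 1. \<forall>y\<in>sphere 0 1. g x \<le> g y"
    by (rule continuous_attains_inf) (auto simp: g_def intro!: continuous_intros)
  then obtain x where x: "norm x = 1" "\<And>y. norm y = 1 \<Longrightarrow> g x \<le> g y" by auto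
  have "g x > 0"
  proof (rule ccontr)
    assume "\<not> g x > 0"
    then have "g x = 0" by (simp add: g_def sum_nonneg antisym)
    then have "v \<bullet> x = 0" if "v \<in> V" for v
      using that assms(1) by (simp add: g_def sum_nonneg_eq_0_iff)
    then have "orthogonal x v" if "v \<in> V" for v using that by (simp add: orthogonal_def inner_commute)
    then have "orthogonal x x" using orthogonal_to_span[of x V x] assms(2) by auto
    then show False using x(1) by (simp add: orthogonal_def)
  qed
  have Vne: "V \<noteq> {}" using \<open>g x > 0\<close> by (auto simp: g_def)
  define c where "c = g x / card V"
  show ?thesis
  proof (rule that)
    show "c > 0" using \<open>g x > 0\<close> Vne assms(1) by (simp add: c_def card_gt_0_iff)
    fix u :: 'a assume u: "u \<noteq> 0"
    show "\<exists>v\<in>V. c * norm u \<le> \<bar>v \<bullet> u\<bar>"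
    proof (rule ccontr)
      assume "\<not> ?thesis"
      then have lt: "\<bar>v \<bullet> u\<bar> < c * norm u" if "v \<in> V" for v using that by (auto simp: not_le)
      have "g u < (\<Sum>v\<in>V. c * norm u)" unfolding g_def by (rule sum_strict_mono) (use assms Vne lt in auto)
      also have "\<dots> = g x * norm u" using Vne assms by (simp add: c_def card_gt_0_iff)
      also have "\<dots> \<le> g (u /\<^sub>R norm u) * norm u" using x(2)[of "u /\<^sub>R norm u"] u by simp
      also have "\<dots> = g u" using u
        by (auto simp: g_def sum_distrib_right abs_mult divide_simps intro!: sum.cong)
      finally show False by simp
    qed
  qed
qed

section \<open>Gaussian measures and the data distribution\<close>

lemma nn_integral_lborel_plus_real:
  fixes f :: "real \<Rightarrow> ennreal"
  assumes [measurable]: "f \<in> borel_measurable borel"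
  shows "(\<integral>\<^sup>+x. f (x + a) \<partial>lborel) = (\<integral>\<^sup>+x. f x \<partial>lborel)"
  using nn_integral_real_affine[OF assms, of 1 a] by (simp add: add.commute)

text \<open>Integrating over the \<open>b0\<close> coordinate first, with all others fixed, turns
  the shear into a translation by the constant \<open>c * y b1\<close>; this uses that
  \<open>b1\<close> is not the moving coordinate.\<close>

lemma nn_integral_lborel_shear:
  fixes f :: "'a::euclidean_space \<Rightarrow> ennreal"
  assumes [measurable]: "f \<in> borel_measurable borel"
    and b: "b0 \<in> Basis" "b1 \<in> Basis" "b0 \<noteq> b1"
  shows "(\<integral>\<^sup>+x. f (x + (c * (x \<bullet> b1)) *\<^sub>R b0) \<partial>lborel) = (\<integral>\<^sup>+x. f x \<partial>lborel)"
proof -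
  interpret product_sigma_finite "\<lambda>_::'a. lborel :: real measure" by standard
  let ?B = "Basis - {b0}"
  have B: "insert b0 ?B = Basis" using b by auto
  let ?s = "\<lambda>y::'a \<Rightarrow> real. \<Sum>b\<in>Basis. y b *\<^sub>R b"
  have s_upd: "?s (y(b0 := t)) = (\<Sum>b\<in>?B. y b *\<^sub>R b) + t *\<^sub>R b0" for y t
    using b by (subst B[symmetric], subst sum.insert) (auto intro!: sum.cong)
  have s_in: "?s y \<bullet> b1 = y b1" for y
    using b by (simp add: inner_sum_left inner_Basis if_distrib cong: if_cong)
  have lb: "(\<integral>\<^sup>+x. h x \<partial>lborel) = (\<integral>\<^sup>+y. h (?s y) \<partial>(\<Pi>\<^sub>M b\<in>Basis. lborel))"
    if [measurable]: "h \<in> borel_measurable borel" for h :: "'a \<Rightarrow> ennreal"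
    by (subst lborel_eq) (simp add: nn_integral_distr)
  have ins: "(\<integral>\<^sup>+y. h (?s y) \<partial>(\<Pi>\<^sub>M b\<in>Basis. lborel))
     = (\<integral>\<^sup>+y. \<integral>\<^sup>+t. h (?s (y(b0 := t))) \<partial>lborel \<partial>(\<Pi>\<^sub>M b\<in>?B. lborel))"
    if [measurable]: "h \<in> borel_measurable borel" for h :: "'a \<Rightarrow> ennreal"
    using product_nn_integral_insert[of ?B b0 "\<lambda>y. h (?s y)"] unfolding B by simp
  have "(\<integral>\<^sup>+x. f (x + (c * (x \<bullet> b1)) *\<^sub>R b0) \<partial>lborel)
    = (\<integral>\<^sup>+y. \<integral>\<^sup>+t. f (?s (y(b0 := t)) + (c * (?s (y(b0 := t)) \<bullet> b1)) *\<^sub>R b0) \<partial>lborel \<partial>(\<Pi>\<^sub>M b\<in>?B. lborel))"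
    by (subst lb, simp, subst ins) auto
  also have "\<dots> = (\<integral>\<^sup>+y. \<integral>\<^sup>+t. f ((\<Sum>b\<in>?B. y b *\<^sub>R b) + (t + c * y b1) *\<^sub>R b0) \<partial>lborel \<partial>(\<Pi>\<^sub>M b\<in>?B. lborel))"
    using b by (simp only: s_in) (simp only: s_upd, simp add: algebra_simps)
  also have "\<dots> = (\<integral>\<^sup>+y. \<integral>\<^sup>+t. f ((\<Sum>b\<in>?B. y b *\<^sub>R b) + t *\<^sub>R b0) \<partial>lborel \<partial>(\<Pi>\<^sub>M b\<in>?B. lborel))"
    by (intro nn_integral_cong nn_integral_lborel_plus_real[of "\<lambda>t. f (_ + t *\<^sub>R b0)"]) simp
  also have "\<dots> = (\<integral>\<^sup>+x. f x \<partial>lborel)"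
    by (subst lb, simp, subst ins, simp, simp only: s_upd)
  finally show ?thesis .
qed

lemma matrix_vector_mult_borel_measurable [measurable]:
  "(\<lambda>x. A *v x) \<in> borel_measurable (borel :: (real ^ 'n) measure)" for A :: "real ^ 'n ^ 'm"
  by (intro borel_measurable_continuous_onI linear_continuous_on linear_linear[THEN iffD2] matrix_vector_mul_linear)

text \<open>The library version of this change of variables needs a well-ordered index type.\<close>

lemma nn_integral_lborel_matrix:
  fixes A :: "real ^ 'n ^ 'n"
  assumes "det A \<noteq> 0" and "f \<in> borel_measurable borel"
  shows "ennreal \<bar>det A\<bar> * (\<integral>\<^sup>+x. f (A *v x) \<partial>lborel) = (\<integral>\<^sup>+x. f x \<partial>lborel)"
proof -
  have BB: "(Basis :: (real ^ 'n) set) = range (\<lambda>i. axis i 1)" by (auto simp: Basis_vec_def)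
  have inj: "inj (\<lambda>i::'n. axis i (1::real))" by (auto simp: inj_def axis_eq_axis)
  \<comment> \<open>The claim is vacuous for singular matrices, which settles the zero-row case, and
    ranges over all \<open>f\<close>, so that in the product case it can be applied for
    \<open>B\<close> to \<open>f\<close> composed with \<open>A\<close>.\<close>
  define P where "P A \<longleftrightarrow> (det A \<noteq> 0 \<longrightarrow> (\<forall>f \<in> borel_measurable borel.
     ennreal \<bar>det A\<bar> * (\<integral>\<^sup>+x. f (A *v x) \<partial>lborel) = (\<integral>\<^sup>+x. f x \<partial>lborel)))" for A :: "real ^ 'n ^ 'n"
  have "P A"
  proof (induction A rule: induct_matrix_elementary)
    case (1 A B)
    show ?case unfolding P_def
    proof safe
      fix f :: "real ^ 'n \<Rightarrow> ennreal" assume [measurable]: "f \<in> borel_measurable borel" and "det (A ** B) \<noteq> 0"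
      then have d: "det A \<noteq> 0" "det B \<noteq> 0" by (auto simp: det_mul)
      have "ennreal \<bar>det (A ** B)\<bar> * (\<integral>\<^sup>+x. f ((A ** B) *v x) \<partial>lborel)
        = ennreal \<bar>det A\<bar> * (ennreal \<bar>det B\<bar> * (\<integral>\<^sup>+x. f (A *v (B *v x)) \<partial>lborel))"
        by (simp add: det_mul abs_mult ennreal_mult' mult.assoc matrix_vector_mul_assoc)
      also have "ennreal \<bar>det B\<bar> * (\<integral>\<^sup>+x. f (A *v (B *v x)) \<partial>lborel) = (\<integral>\<^sup>+x. f (A *v x) \<partial>lborel)"
        using 1(2) d unfolding P_def by (auto dest!: bspec[where x="\<lambda>x. f (A *v x)"])
      also have "ennreal \<bar>det A\<bar> * \<dots> = (\<integral>\<^sup>+x. f x \<partial>lborel)"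
        using 1(1) d unfolding P_def by auto
      finally show "ennreal \<bar>det (A ** B)\<bar> * (\<integral>\<^sup>+x. f ((A ** B) *v x) \<partial>lborel) = (\<integral>\<^sup>+x. f x \<partial>lborel)" .
    qed
  next
    case (2 A i)
    then show ?case unfolding P_def using det_zero_row(2)[of i A] by auto
  next
    case (3 A)
    show ?case unfolding P_def
    proof safe
      fix f :: "real ^ 'n \<Rightarrow> ennreal" assume [measurable]: "f \<in> borel_measurable borel" and d: "det A \<noteq> 0"
      have dA: "det A = (\<Prod>i\<in>UNIV. A $ i $ i)" using 3 by (simp add: det_diagonal)
      then have nz: "A $ i $ i \<noteq> 0" for i using d by auto
      define c where "c b = (A *v b) \<bullet> b" for b
      have c: "c (axis i 1) = A $ i $ i" for i
        by (simp add: c_def inner_axis matrix_vector_mult_basis column_def)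
      have Av: "A *v x = 0 + (\<Sum>b\<in>Basis. (c b * (x \<bullet> b)) *\<^sub>R b)" for x
      proof -
        have "(A *v x) $ i = A $ i $ i * x $ i" for i
          unfolding matrix_vector_mult_def using 3
          by (simp, subst sum.remove[of _ i]) (auto intro!: sum.neutral)
        then have "(A *v x) \<bullet> b = c b * (x \<bullet> b)" if "b \<in> Basis" for b
          using that by (auto simp: Basis_vec_def inner_axis c)
        then have "(\<Sum>b\<in>Basis. ((A *v x) \<bullet> b) *\<^sub>R b) = (\<Sum>b\<in>Basis. (c b * (x \<bullet> b)) *\<^sub>R b)"
          by (intro sum.cong) simp_all
        then show ?thesis by (simp only: euclidean_representation add_0)
      qed
      have cB: "c b \<noteq> 0" if "b \<in> Basis" for b using that nz by (auto simp: Basis_vec_def c)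
      have pr: "(\<Prod>b\<in>Basis. \<bar>c b\<bar>) = \<bar>det A\<bar>"
        unfolding BB prod.reindex[OF inj] by (simp add: c dA abs_prod)
      have "(\<integral>\<^sup>+x. f x \<partial>lborel) = (\<integral>\<^sup>+x. f x \<partial>density (distr lborel borel (\<lambda>x. 0 + (\<Sum>j\<in>Basis. (c j * (x \<bullet> j)) *\<^sub>R j))) (\<lambda>_. (\<Prod>j\<in>Basis. \<bar>c j\<bar>)))"
        using lborel_affine_euclidean[of c 0] cB by simp
      also have "\<dots> = ennreal \<bar>det A\<bar> * (\<integral>\<^sup>+x. f (A *v x) \<partial>lborel)"
        by (subst nn_integral_density) (auto simp: pr nn_integral_cmult nn_integral_distr Av[symmetric] simp del: add_0)
      finally show "ennreal \<bar>det A\<bar> * (\<integral>\<^sup>+x. f (A *v x) \<partial>lborel) = (\<integral>\<^sup>+x. f x \<partial>lborel)" ..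
    qed
  next
    case (4 m n)
    define p where "p = Transposition.transpose m n"
    define S :: "real ^ 'n ^ 'n" where "S = (\<chi> i j. mat 1 $ i $ p j)"
    have pp: "p permutes UNIV" unfolding p_def by (simp add: permutes_swap_id)
    have pinv: "p (p i) = i" for i by (simp add: p_def)
    have "det S = of_int (sign p) * det (mat 1 :: real ^ 'n ^ 'n)"
      unfolding S_def by (rule det_permute_columns[OF pp])
    then have dS: "\<bar>det S\<bar> = 1" by (simp add: sign_def)
    have Sv: "(S *v x) $ i = x $ p i" for x i
    proof -
      have eq: "i = p j \<longleftrightarrow> p i = j" for j using pinv by metis
      have "(S *v x) $ i = (\<Sum>j\<in>UNIV. if p i = j then x $ j else 0)"
        by (simp add: S_def matrix_vector_mult_def mat_def eq del: sum.delta sum.delta', rule sum.cong, auto)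
      then show ?thesis by simp
    qed
    \<comment> \<open>Lebesgue measure is determined by its values on boxes, and permuting
      coordinates maps boxes to boxes with the same side lengths.\<close>
    have eqS: "lborel = distr lborel borel (\<lambda>x. S *v x)"
    proof (rule lborel_eqI)
      fix l u :: "real ^ 'n" assume le: "\<And>b. b \<in> Basis \<Longrightarrow> l \<bullet> b \<le> u \<bullet> b"
      have le': "l $ i \<le> u $ i" for i using le[of "axis i 1"] by (auto simp: inner_axis Basis_vec_def)
      have "(\<lambda>x. S *v x) -` box l u = box (\<chi> i. l $ p i) (\<chi> i. u $ p i)"
        by (rule set_eqI) (simp add: mem_box_cart Sv, metis pinv)
      then have "emeasure (distr lborel borel (\<lambda>x. S *v x)) (box l u) = emeasure lborel (box (\<chi> i. l $ p i) (\<chi> i. u $ p i))"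
        by (simp add: emeasure_distr)
      also have "\<dots> = (\<Prod>i\<in>UNIV. u $ p i - l $ p i)"
      proof (subst emeasure_lborel_box)
        show "(\<chi> i. l $ p i) \<bullet> b \<le> (\<chi> i. u $ p i) \<bullet> b" if "b \<in> Basis" for b
          using that le' by (auto simp: BB inner_axis)
        show "ennreal (prod ((\<bullet>) ((\<chi> i. u $ p i) - (\<chi> i. l $ p i))) Basis) = ennreal (\<Prod>i\<in>UNIV. u $ p i - l $ p i)"
          unfolding BB prod.reindex[OF inj] by (simp add: inner_axis o_def)
      qed
      also have "(\<Prod>i\<in>UNIV. u $ p i - l $ p i) = (\<Prod>i\<in>UNIV. u $ i - l $ i)"
        using prod.permute[OF pp, of "\<lambda>i. u $ i - l $ i"] by (simp add: o_def)
      also have "(\<Prod>i\<in>UNIV. u $ i - l $ i) = (\<Prod>b\<in>Basis. (u - l) \<bullet> b)"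
        unfolding BB prod.reindex[OF inj] by (simp add: inner_axis)
      finally show "emeasure (distr lborel borel (\<lambda>x. S *v x)) (box l u) = (\<Prod>b\<in>Basis. (u - l) \<bullet> b)" .
    qed simp
    have "(\<integral>\<^sup>+x. f x \<partial>lborel) = (\<integral>\<^sup>+x. f (S *v x) \<partial>lborel)" if "f \<in> borel_measurable borel" for f :: "real ^ 'n \<Rightarrow> ennreal"
      using arg_cong[OF eqS, of "\<lambda>M. integral\<^sup>N M f"] that by (simp add: nn_integral_distr)
    then have "P S" unfolding P_def dS ennreal_1 mult_1 by metis
    then show ?case by (simp only: S_def p_def)
  next
    case (5 m n c)
    define S :: "real ^ 'n ^ 'n" where "S = (\<chi> i j. if i = m \<and> j = n then c else of_bool (i = j))"
    have "S = (\<chi> k. if k = m then row m (mat 1) + c *s row n (mat 1) else row k (mat 1))"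
      unfolding S_def vec_eq_iff row_def mat_def using 5 by (simp add: of_bool_def)
    then have dS: "det S = 1" using det_row_operation[OF 5, of "mat 1 :: real ^ 'n ^ 'n" c] by simp
    have Sv: "S *v x = x + (c * (x \<bullet> axis n 1)) *\<^sub>R axis m 1" for x
    proof (intro vec_eq_iff[THEN iffD2] allI)
      fix i
      have "(S *v x) $ i = (\<Sum>j\<in>UNIV. (if j = n then (if i = m then c * x $ n else 0) else 0) + (if j = i then x $ i else 0))"
        unfolding S_def matrix_vector_mult_def vec_lambda_beta
      proof (rule sum.cong)
        fix j :: 'n
        show "(if i = m \<and> j = n then c else of_bool (i = j)) * x $ j =
          (if j = n then (if i = m then c * x $ n else 0) else 0) + (if j = i then x $ i else 0)"
          using 5 by (cases "j = n"; cases "i = m"; cases "j = i") simp_all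
      qed simp
      also have "\<dots> = (if i = m then c * x $ n else 0) + x $ i"
        by (simp only: sum.distrib sum.delta finite UNIV_I if_True)
      finally show "(S *v x) $ i = (x + (c * (x \<bullet> axis n 1)) *\<^sub>R axis m 1) $ i"
        by (simp add: inner_axis) (simp add: axis_def)
    qed
    show ?case unfolding P_def S_def[symmetric] Sv dS
      using 5 by (auto intro!: nn_integral_lborel_shear simp: axis_eq_axis Basis_vec_def)
  qed
  then show ?thesis using assms unfolding P_def by blast
qed

section \<open>Factorization of positive definite matrices\<close>

lemma pos_definite_invertible:
  assumes "pos_definite A"
  shows "invertible A"
proof -
  have "x = 0" if "A *v x = 0" for x
    using assms that unfolding pos_definite_def by (metis inner_zero_right less_irrefl)
  then show ?thesis unfolding invertible_left_inverse matrix_left_invertible_ker by blast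
qed

lemma matrix_inv_mult:
  assumes "invertible A"
  shows "A ** matrix_inv A = mat 1" "matrix_inv A ** A = mat 1"
proof -
  have "A ** matrix_inv A = mat 1 \<and> matrix_inv A ** A = mat 1"
    unfolding matrix_inv_def using assms unfolding invertible_def by (rule someI_ex)
  then show "A ** matrix_inv A = mat 1" "matrix_inv A ** A = mat 1" by auto
qed

lemma pos_definite_matrix_inv:
  fixes A :: "real ^ 'n ^ 'n"
  assumes "pos_definite A"
  shows "pos_definite (matrix_inv A)"
proof -
  let ?P = "matrix_inv A"
  note inv = matrix_inv_mult[OF pos_definite_invertible[OF assms]]
  have "transpose ?P ** A = mat 1"
    using inv(1) assms unfolding pos_definite_def by (metis matrix_transpose_mul transpose_mat)
  then have sym: "transpose ?P = ?P"
    by (metis inv(1) matrix_mul_assoc matrix_mul_lid matrix_mul_rid)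
  have "0 < x \<bullet> (?P *v x)" if "x \<noteq> 0" for x
  proof -
    define y where "y = ?P *v x"
    have x: "A *v y = x" by (simp add: y_def matrix_vector_mul_assoc inv)
    then have "y \<noteq> 0" using that by auto
    then have "0 < y \<bullet> (A *v y)" using assms unfolding pos_definite_def by blast
    then show ?thesis unfolding x by (simp add: y_def inner_commute)
  qed
  then show ?thesis unfolding pos_definite_def using sym by blast
qed

text \<open>Gram-Schmidt for the inner product given by \<open>P\<close>: while \<open>k\<close> is
  below the dimension, the images of \<open>C\<close> under \<open>P\<close> do not span, so a
  nonzero vector is orthogonal to all of them and can be normalized.\<close>

lemma pos_definite_orthonormal_family:
  fixes P :: "real ^ 'n ^ 'n"
  assumes "pos_definite P" and "k \<le> CARD('n)"
  shows "\<exists>C. finite C \<and> card C = k \<and> (\<forall>x\<in>C. \<forall>y\<in>C. x \<bullet> (P *v y) = (if x = y then 1 else 0))"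
  using assms(2)
proof (induction k)
  case 0
  show ?case by (rule exI[of _ "{}"]) auto
next
  case (Suc k)
  then obtain C where C: "finite C" "card C = k" "\<And>x y. x \<in> C \<Longrightarrow> y \<in> C \<Longrightarrow> x \<bullet> (P *v y) = (if x = y then 1 else 0)"
    by auto
  have sym: "x \<bullet> (P *v y) = y \<bullet> (P *v x)" for x y
    using assms(1) unfolding pos_definite_def
    by (metis dot_lmul_matrix inner_commute vector_transpose_matrix)
  have "dim ((*v) P ` C) \<le> card ((*v) P ` C)" using C(1) by (intro dim_le_card') simp
  also have "\<dots> \<le> k" using C card_image_le by blast
  finally have "dim ((*v) P ` C) < DIM(real ^ 'n)" using Suc.prems by simp
  then obtain x where x: "x \<noteq> 0" "\<And>y. y \<in> span ((*v) P ` C) \<Longrightarrow> orthogonal x y"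
    using orthogonal_to_subspace_exists by blast
  have pos: "x \<bullet> (P *v x) > 0" using assms(1) x(1) unfolding pos_definite_def by blast
  define x' where "x' = x /\<^sub>R sqrt (x \<bullet> (P *v x))"
  have 1: "x' \<bullet> (P *v x') = 1"
    using pos by (simp add: x'_def matrix_vector_mult_scaleR field_simps)
  have 2: "x' \<bullet> (P *v c) = 0" if "c \<in> C" for c
    using x(2)[of "P *v c"] that by (simp add: x'_def orthogonal_def span_base)
  have "x' \<notin> C" using 1 2 by force
  then show ?case
    by (intro exI[of _ "insert x' C"]) (use C 1 2 sym in auto)
qed

text \<open>The columns of \<open>B\<close> are an orthonormal basis for the inner product given by
  the inverse of \<open>A\<close>. This says that \<open>transpose B ** matrix_inv A ** B\<close> is
  the identity, which rearranges to the factorization.\<close>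

lemma pos_definite_factorization:
  fixes A :: "real ^ 'n ^ 'n"
  assumes "pos_definite A"
  obtains B :: "real ^ 'n ^ 'n" where "invertible B" "B ** transpose B = A"
proof -
  let ?P = "matrix_inv A"
  note inv = matrix_inv_mult[OF pos_definite_invertible[OF assms]]
  obtain C where C: "finite C" "card C = CARD('n)"
    "\<And>x y. x \<in> C \<Longrightarrow> y \<in> C \<Longrightarrow> x \<bullet> (?P *v y) = (if x = y then 1 else 0)"
    using pos_definite_orthonormal_family[OF pos_definite_matrix_inv[OF assms] order_refl] by metis
  obtain h where h: "bij_betw h (UNIV :: 'n set) C"
    using C finite_same_card_bij[of "UNIV :: 'n set" C] by auto
  then have hC: "h i \<in> C" and hinj: "h i = h j \<longleftrightarrow> i = j" for i j
    by (auto simp: bij_betw_def inj_eq)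
  define B :: "real ^ 'n ^ 'n" where "B = (\<chi> i j. h j $ i)"
  have "transpose B ** (?P ** B) = mat 1"
  proof -
    have "(?P ** B) $ k $ j = (?P *v h j) $ k" for k j
      by (simp add: matrix_matrix_mult_def matrix_vector_mult_def B_def)
    moreover have "transpose B $ i $ k = h i $ k" for i k by (simp add: transpose_def B_def)
    moreover have "(X ** Y) $ i $ j = (\<Sum>k\<in>UNIV. X $ i $ k * Y $ k $ j)" for X Y :: "real ^ 'n ^ 'n" and i j
      by (simp add: matrix_matrix_mult_def)
    ultimately have "(transpose B ** (?P ** B)) $ i $ j = h i \<bullet> (?P *v h j)" for i j
      by (simp only: inner_vec_def inner_real_def)
    then show ?thesis using C(3)[OF hC hC] hinj by (simp add: vec_eq_iff mat_def)
  qed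
  then have l: "(transpose B ** ?P) ** B = mat 1" by (simp add: matrix_mul_assoc)
  then have "B ** (transpose B ** ?P) = mat 1" using matrix_left_right_inverse by blast
  then have "(B ** transpose B) ** ?P = mat 1" by (simp add: matrix_mul_assoc)
  then have "((B ** transpose B) ** ?P) ** A = A" by simp
  then have "B ** transpose B = A" by (simp add: matrix_mul_assoc[symmetric] inv)
  moreover have "invertible B" using l invertible_left_inverse by blast
  ultimately show ?thesis using that by blast
qed

section \<open>Gaussian laws as affine images of the standard Gaussian\<close>

definition std_gaussian :: "(real ^ 'n) measure" where
  "std_gaussian = density lborel (\<lambda>z. ennreal (\<Prod>b\<in>Basis. std_normal_density (z \<bullet> b)))"

lemma sets_std_gaussian [measurable_cong, simp]: "sets std_gaussian = sets borel"
  and space_std_gaussian [simp]: "space std_gaussian = UNIV"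
  by (auto simp: std_gaussian_def)

lemma std_gaussian_density_eq:
  "(\<Prod>b\<in>Basis. std_normal_density ((z :: real ^ 'n) \<bullet> b)) = exp (- (z \<bullet> z) / 2) / sqrt ((2 * pi) ^ CARD('n))"
proof -
  have "(\<Prod>b\<in>Basis. std_normal_density (z \<bullet> b)) =
      (\<Prod>b\<in>(Basis :: (real ^ 'n) set). 1 / sqrt (2 * pi)) * (\<Prod>b\<in>Basis. exp (- (z \<bullet> b)\<^sup>2 / 2))"
    unfolding std_normal_density_def by (rule prod.distrib)
  also have "(\<Prod>b\<in>Basis. exp (- (z \<bullet> b)\<^sup>2 / 2)) = exp (- (z \<bullet> z) / 2)"
    by (simp add: exp_sum[symmetric] euclidean_inner[of z z] sum_negf sum_divide_distrib power2_eq_square)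
  also have "(\<Prod>b\<in>(Basis :: (real ^ 'n) set). 1 / sqrt (2 * pi)) = 1 / sqrt ((2 * pi) ^ CARD('n))"
  proof -
    have "(\<Prod>b\<in>(Basis :: (real ^ 'n) set). 1 / sqrt (2 * pi)) = (1 / sqrt (2 * pi)) ^ CARD('n)" by simp
    then show ?thesis by (simp only: power_one_over real_sqrt_power)
  qed
  finally show ?thesis by simp
qed

lemma nn_integral_std_gaussian_prod:
  assumes [measurable]: "\<And>b. b \<in> Basis \<Longrightarrow> f b \<in> borel_measurable borel"
  shows "(\<integral>\<^sup>+z. (\<Prod>b\<in>Basis. f b (z \<bullet> b)) \<partial>(std_gaussian :: (real ^ 'n) measure))
    = (\<Prod>b\<in>Basis. \<integral>\<^sup>+t. ennreal (std_normal_density t) * f b t \<partial>lborel)"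
proof -
  have "(\<integral>\<^sup>+z. (\<Prod>b\<in>Basis. f b (z \<bullet> b)) \<partial>(std_gaussian :: (real ^ 'n) measure))
    = (\<integral>\<^sup>+z. (\<Prod>b\<in>Basis. ennreal (std_normal_density (z \<bullet> b)) * f b (z \<bullet> b)) \<partial>lborel)"
    unfolding std_gaussian_def
    by (subst nn_integral_density) (auto simp: prod_ennreal prod.distrib intro!: nn_integral_cong)
  also have "\<dots> = (\<Prod>b\<in>Basis. \<integral>\<^sup>+t. ennreal (std_normal_density t) * f b t \<partial>lborel)"
    by (rule nn_integral_lborel_prod) auto
  finally show ?thesis .
qed

lemma nn_integral_normal_density: "0 < \<sigma> \<Longrightarrow> (\<integral>\<^sup>+t. ennreal (normal_density \<mu> \<sigma> t) \<partial>lborel) = 1"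
  by (subst nn_integral_eq_integral) auto

lemma prob_space_std_gaussian: "prob_space (std_gaussian :: (real ^ 'n) measure)"
proof (rule prob_spaceI)
  have "emeasure (std_gaussian :: (real ^ 'n) measure) UNIV = (\<integral>\<^sup>+z. (\<Prod>b\<in>(Basis :: (real ^ 'n) set). 1) \<partial>(std_gaussian :: (real ^ 'n) measure))"
    by simp
  also have "\<dots> = 1" by (subst nn_integral_std_gaussian_prod) (auto simp: nn_integral_normal_density)
  finally show "emeasure (std_gaussian :: (real ^ 'n) measure) (space (std_gaussian :: (real ^ 'n) measure)) = 1" by simp
qed

text \<open>Bounding the norm by the sum of absolute coordinates reduces the claim to one dimension.
  There, completing the square turns \<open>exp (a * t)\<close> times the standard density into
  \<open>exp (a\<^sup>2 / 2)\<close> times the normal density with mean \<open>a\<close>.\<close>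

lemma std_gaussian_exp_moment:
  "(\<integral>\<^sup>+z. ennreal (exp (a * norm z)) \<partial>(std_gaussian :: (real ^ 'n) measure)) < \<infinity>" if "0 \<le> a"
proof -
  have fin: "(\<integral>\<^sup>+t. ennreal (std_normal_density t) * ennreal (exp (a * \<bar>t\<bar>)) \<partial>lborel) < \<infinity>"
  proof -
    have "(\<integral>\<^sup>+t. ennreal (std_normal_density t) * ennreal (exp (a * \<bar>t\<bar>)) \<partial>lborel)
      \<le> (\<integral>\<^sup>+t. ennreal (exp (a\<^sup>2 / 2)) * (ennreal (normal_density a 1 t) + ennreal (normal_density (- a) 1 t)) \<partial>lborel)"
    proof (rule nn_integral_mono)
      fix t :: real
      have e: "std_normal_density t * exp (a * t) = exp (a\<^sup>2 / 2) * normal_density a 1 t"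
        "std_normal_density t * exp (- a * t) = exp (a\<^sup>2 / 2) * normal_density (- a) 1 t"
        by (simp_all add: normal_density_def field_simps power2_eq_square flip: exp_add)
      have "exp (a * \<bar>t\<bar>) \<le> exp (a * t) + exp (- a * t)" by (cases "t \<ge> 0") auto
      then have "std_normal_density t * exp (a * \<bar>t\<bar>) \<le> std_normal_density t * (exp (a * t) + exp (- a * t))"
        by (intro mult_left_mono) auto
      then show "ennreal (std_normal_density t) * ennreal (exp (a * \<bar>t\<bar>))
        \<le> ennreal (exp (a\<^sup>2 / 2)) * (ennreal (normal_density a 1 t) + ennreal (normal_density (- a) 1 t))"
        unfolding distrib_left e by (simp add: ennreal_mult[symmetric] ennreal_plus[symmetric] distrib_left del: ennreal_plus)
    qed
    also have "\<dots> = ennreal (exp (a\<^sup>2 / 2)) * 2"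
      by (simp add: nn_integral_cmult nn_integral_add nn_integral_normal_density)
    also have "\<dots> < \<infinity>" by (simp add: ennreal_mult_less_top)
    finally show ?thesis .
  qed
  have "(\<integral>\<^sup>+z. ennreal (exp (a * norm z)) \<partial>(std_gaussian :: (real ^ 'n) measure))
    \<le> (\<integral>\<^sup>+z. (\<Prod>b\<in>Basis. ennreal (exp (a * \<bar>z \<bullet> b\<bar>))) \<partial>(std_gaussian :: (real ^ 'n) measure))"
  proof (rule nn_integral_mono)
    fix z :: "real ^ 'n"
    have "a * norm z \<le> (\<Sum>b\<in>Basis. a * \<bar>z \<bullet> b\<bar>)"
      using norm_le_l1[of z] that by (simp add: sum_distrib_left[symmetric] mult_left_mono)
    then show "ennreal (exp (a * norm z)) \<le> (\<Prod>b\<in>Basis. ennreal (exp (a * \<bar>z \<bullet> b\<bar>)))"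
      by (simp add: prod_ennreal exp_sum[symmetric])
  qed
  also have "\<dots> = (\<Prod>b\<in>(Basis :: (real ^ 'n) set). \<integral>\<^sup>+t. ennreal (std_normal_density t) * ennreal (exp (a * \<bar>t\<bar>)) \<partial>lborel)"
    by (rule nn_integral_std_gaussian_prod) simp
  also have "\<dots> < \<infinity>" using fin by (simp add: power_less_top_ennreal)
  finally show ?thesis .
qed

text \<open>Substituting \<open>x = m + B *v z\<close> reduces the quadratic form to
  \<open>z \<bullet> z\<close>, and the Jacobian \<open>\<bar>det B\<bar>\<close> cancels the square
  root of \<open>det A\<close> in the normalization.\<close>

lemma gaussian_eq_distr:
  fixes A B :: "real ^ 'n ^ 'n"
  assumes "invertible B" and A: "B ** transpose B = A"
  shows "gaussian m A = distr std_gaussian borel (\<lambda>z. m + B *v z)"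
proof (rule measure_eqI)
  show "sets (gaussian m A) = sets (distr std_gaussian borel (\<lambda>z. m + B *v z))" by (simp add: gaussian_def)
next
  fix S assume "S \<in> sets (gaussian m A)"
  then have S [measurable]: "S \<in> sets borel" by (simp add: gaussian_def)
  let ?P = "matrix_inv A"
  have "invertible A" unfolding A[symmetric] by (intro invertible_mult assms transpose_invertible)
  note inv = matrix_inv_mult[OF this]
  have "B ** (transpose B ** ?P) = mat 1" using inv(1) by (simp add: A[symmetric] matrix_mul_assoc)
  then have BPB: "transpose B ** (?P ** B) = mat 1"
    using matrix_left_right_inverse by (metis matrix_mul_assoc)
  have dB: "det B \<noteq> 0" using assms(1) invertible_det_nz by blast
  have dA: "det A = (det B)\<^sup>2" by (simp add: A[symmetric] det_mul power2_eq_square)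
  define g where "g x = exp (- ((x - m) \<bullet> (?P *v (x - m))) / 2) / sqrt ((2 * pi) ^ CARD('n) * det A)" for x
  have [measurable]: "g \<in> borel_measurable borel" unfolding g_def[abs_def] by measurable
  have gB: "\<bar>det B\<bar> * g (m + B *v z) = (\<Prod>b\<in>Basis. std_normal_density (z \<bullet> b))" for z
  proof -
    have "(B *v z) \<bullet> (?P *v (B *v z)) = z \<bullet> (transpose B *v (?P *v (B *v z)))"
      by (metis dot_lmul_matrix inner_commute vector_transpose_matrix)
    also have "\<dots> = z \<bullet> z" using BPB by (simp add: matrix_vector_mul_assoc)
    finally have "g (m + B *v z) = exp (- (z \<bullet> z) / 2) / (sqrt ((2 * pi) ^ CARD('n)) * \<bar>det B\<bar>)"
      unfolding g_def by (simp add: dA real_sqrt_mult)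
    then show ?thesis unfolding std_gaussian_density_eq using dB by simp
  qed
  have "emeasure (gaussian m A) S = (\<integral>\<^sup>+x. ennreal (g x) * indicator S x \<partial>lborel)"
    unfolding gaussian_def g_def by (subst emeasure_density) auto
  also have "\<dots> = (\<integral>\<^sup>+x. ennreal (g (m + x)) * indicator S (m + x) \<partial>lborel)"
    by (subst lborel_distr_plus[of m, symmetric]) (simp add: nn_integral_distr)
  also have "\<dots> = ennreal \<bar>det B\<bar> * (\<integral>\<^sup>+z. ennreal (g (m + B *v z)) * indicator S (m + B *v z) \<partial>lborel)"
    by (rule nn_integral_lborel_matrix[symmetric, OF dB]) measurable
  also have "\<dots> = (\<integral>\<^sup>+z. ennreal (\<Prod>b\<in>Basis. std_normal_density (z \<bullet> b)) * indicator S (m + B *v z) \<partial>lborel)"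
    by (subst nn_integral_cmult[symmetric], measurable) (simp add: gB[symmetric] ennreal_mult' mult.assoc)
  also have "\<dots> = emeasure (distr std_gaussian borel (\<lambda>z. m + B *v z)) S"
    unfolding std_gaussian_def
    by (subst emeasure_distr) (auto simp: emeasure_density indicator_def vimage_def intro!: nn_integral_cong)
  finally show "emeasure (gaussian m A) S = emeasure (distr std_gaussian borel (\<lambda>z. m + B *v z)) S" .
qed

lemma gaussian_scaled:
  fixes A B :: "real ^ 'n ^ 'n"
  assumes "invertible B" "B ** transpose B = A" "\<kappa> > 0"
  shows "gaussian m (inverse \<kappa> *\<^sub>R A) = distr std_gaussian borel (\<lambda>z. m + (1 / sqrt \<kappa>) *\<^sub>R (B *v z))"
proof -
  let ?c = "1 / sqrt \<kappa>"
  obtain C where "C ** B = mat 1" using assms(1) invertible_left_inverse by blast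
  then have "(sqrt \<kappa> *\<^sub>R C) ** (?c *\<^sub>R B) = mat 1"
    using assms(3) by (simp add: scalar_matrix_assoc[symmetric] matrix_scalar_ac)
  then have "invertible (?c *\<^sub>R B)" using invertible_left_inverse by blast
  moreover have "(?c *\<^sub>R B) ** transpose (?c *\<^sub>R B) = inverse \<kappa> *\<^sub>R A"
    using assms by (simp add: transpose_scalar scalar_matrix_assoc[symmetric] matrix_scalar_ac field_simps)
  ultimately show ?thesis by (subst gaussian_eq_distr) (auto simp: scaleR_matrix_vector_assoc)
qed

section \<open>The labelled data distribution for large concentration\<close>

lemma data_dist_gaussian_kernel:
  fixes \<mu> :: "real ^ 'd"
  assumes "pos_definite \<Sigma>" "\<kappa> > 0"
  shows "(\<lambda>y. distr (gaussian (if y = 1 then \<mu> else - \<mu>) (inverse \<kappa> *\<^sub>R \<Sigma>)) borel (\<lambda>x. (x, y)))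
    \<in> measure_pmf (pmf_of_set {0, 1 :: real}) \<rightarrow>\<^sub>M subprob_algebra (borel :: ((real ^ 'd) \<times> real) measure)"
proof -
  obtain B :: "real ^ 'd ^ 'd" where B: "invertible B" "B ** transpose B = \<Sigma>"
    using pos_definite_factorization[OF assms(1)] .
  interpret prob_space "std_gaussian :: (real ^ 'd) measure" by (rule prob_space_std_gaussian)
  have "subprob_space (distr (gaussian m (inverse \<kappa> *\<^sub>R \<Sigma>)) borel (\<lambda>x. (x, y)))" for m and y :: real
    unfolding gaussian_scaled[OF B assms(2)]
    by (intro prob_space_imp_subprob_space prob_space.prob_space_distr prob_space_distr) measurable
  then show ?thesis by (auto simp: space_subprob_algebra)
qed

lemma sets_data_dist:
  fixes \<mu> :: "real ^ 'd"
  assumes "pos_definite \<Sigma>" "\<kappa> > 0"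
  shows "sets (data_dist \<mu> \<Sigma> \<kappa>) = sets borel"
  unfolding data_dist_def by (rule sets_bind_measurable[OF data_dist_gaussian_kernel[OF assms]]) simp

lemma nn_integral_data_dist:
  fixes \<mu> :: "real ^ 'd" and B :: "real ^ 'd ^ 'd"
  assumes "pos_definite \<Sigma>" "\<kappa> > 0" and B: "invertible B" "B ** transpose B = \<Sigma>"
    and [measurable]: "f \<in> borel_measurable borel"
  shows "(\<integral>\<^sup>+p. f p \<partial>data_dist \<mu> \<Sigma> \<kappa>) =
    ((\<integral>\<^sup>+z. f (\<mu> + (1 / sqrt \<kappa>) *\<^sub>R (B *v z), 1) \<partial>std_gaussian)
     + (\<integral>\<^sup>+z. f (- \<mu> + (1 / sqrt \<kappa>) *\<^sub>R (B *v z), 0) \<partial>std_gaussian)) / 2"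
proof -
  have 1: "(\<integral>\<^sup>+p. f p \<partial>distr (gaussian m (inverse \<kappa> *\<^sub>R \<Sigma>)) borel (\<lambda>x. (x, y)))
    = (\<integral>\<^sup>+z. f (m + (1 / sqrt \<kappa>) *\<^sub>R (B *v z), y) \<partial>std_gaussian)" for m y
    unfolding gaussian_scaled[OF B assms(2)] by (simp add: nn_integral_distr)
  show ?thesis
    unfolding data_dist_def
    by (subst nn_integral_bind[OF assms(5) data_dist_gaussian_kernel[OF assms(1,2)]])
       (simp add: nn_integral_pmf_of_set 1 add.commute)
qed

lemma fst_borel_measurable [measurable]:
    "fst \<in> borel_measurable (borel :: ('a::second_countable_topology \<times> 'b::second_countable_topology) measure)"
  and snd_borel_measurable [measurable]:
    "snd \<in> borel_measurable (borel :: ('a::second_countable_topology \<times> 'b::second_countable_topology) measure)"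
  by (simp_all add: borel_prod[symmetric])

text \<open>Collects what the later argument uses about the data. The exponential moment dominates
  both the exponential of a sum of two norms and the squared norm of a mixed point; the last
  integral is the mean distance to the class center, since \<open>2 * snd p - 1\<close> is the class
  sign.\<close>

definition regular_data :: "real ^ 'd \<Rightarrow> real \<Rightarrow> real \<Rightarrow> ((real ^ 'd) \<times> real) measure \<Rightarrow> bool" where
  "regular_data \<mu> K \<rho> D \<longleftrightarrow> prob_space D \<and> sets D = sets borel \<and> (AE p in D. snd p \<in> {0, 1})
    \<and> emeasure D {p. snd p = 1} = 1 / 2 \<and> (\<integral>\<^sup>+p. ennreal (exp (4 * norm (fst p))) \<partial>D) \<le> ennreal K
    \<and> (\<integral>\<^sup>+p. ennreal (norm (fst p - (2 * snd p - 1) *\<^sub>R \<mu>)) \<partial>D) \<le> ennreal \<rho>"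

text \<open>A point is its class center plus \<open>B *v z\<close> divided by
  \<open>sqrt \<kappa>\<close>. For \<open>\<kappa> \<ge> 1\<close> the exponential moment has a
  bound free of \<open>\<kappa>\<close>, so \<open>K\<close> can be chosen before
  \<open>\<rho>\<close>. The mean noise is at most \<open>e / sqrt \<kappa>\<close> with
  \<open>e\<close> an exponential moment of \<open>z\<close>, whence \<open>\<kappa>\<^sub>0\<close>
  is the larger of \<open>1\<close> and \<open>(e / \<rho>)\<^sup>2\<close>.\<close>

lemma data_dist_regular:
  fixes \<mu> :: "real ^ 'd"
  assumes "pos_definite \<Sigma>"
  obtains K where "0 < K" "\<And>\<rho>. 0 < \<rho> \<Longrightarrow> \<exists>\<kappa>\<^sub>0 > 0. \<forall>\<kappa> \<ge> \<kappa>\<^sub>0. regular_data \<mu> K \<rho> (data_dist \<mu> \<Sigma> \<kappa>)"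
proof -
  obtain B :: "real ^ 'd ^ 'd" where B: "invertible B" "B ** transpose B = \<Sigma>"
    using pos_definite_factorization[OF assms(1)] .
  interpret G: prob_space "std_gaussian :: (real ^ 'd) measure" by (rule prob_space_std_gaussian)
  note em = G.emeasure_space_1[simplified]
  obtain \<beta> where \<beta>: "0 < \<beta>" "\<And>z. norm (B *v z) \<le> norm z * \<beta>"
    using bounded_linear.pos_bounded[of "(*v) B"] matrix_vector_mul_bounded_linear by blast
  define E where "E = (\<integral>\<^sup>+z. ennreal (exp (4 * \<beta> * norm z)) \<partial>(std_gaussian :: (real ^ 'd) measure))"
  have E: "E < \<infinity>" unfolding E_def using std_gaussian_exp_moment[of "4 * \<beta>"] \<beta> by simp
  define K where "K = exp (4 * norm \<mu>) * enn2real E + 1"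
  have le_exp: "t \<le> exp t" for t :: real using exp_ge_add_one_self[of t] by linarith
  show ?thesis
  proof (rule that)
    show "0 < K" by (simp add: K_def add_nonneg_pos)
    fix \<rho> :: real assume "0 < \<rho>"
    define e where "e = enn2real E"
    have Ee: "E = ennreal e" "0 \<le> e" using E by (auto simp: e_def)
    define \<kappa>\<^sub>0 where "\<kappa>\<^sub>0 = max 1 ((e / \<rho>)\<^sup>2)"
    show "\<exists>\<kappa>\<^sub>0 > 0. \<forall>\<kappa> \<ge> \<kappa>\<^sub>0. regular_data \<mu> K \<rho> (data_dist \<mu> \<Sigma> \<kappa>)"
    unfolding regular_data_def
    proof (intro exI[of _ \<kappa>\<^sub>0] conjI allI impI)
      show "0 < \<kappa>\<^sub>0" by (simp add: \<kappa>\<^sub>0_def)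
      fix \<kappa> :: real assume \<kappa>: "\<kappa>\<^sub>0 \<le> \<kappa>"
      then have \<kappa>1: "1 \<le> \<kappa>" "0 < \<kappa>" and \<kappa>2: "(e / \<rho>)\<^sup>2 \<le> \<kappa>" by (auto simp: \<kappa>\<^sub>0_def)
      let ?D = "data_dist \<mu> \<Sigma> \<kappa>"
      let ?c = "1 / sqrt \<kappa>"
      have c: "0 < ?c" "?c \<le> 1" using \<kappa>1 by auto
      show sets [measurable_cong]: "sets ?D = sets borel" by (rule sets_data_dist[OF assms \<kappa>1(2)])
      have sp: "space ?D = UNIV" using sets_eq_imp_space_eq[OF sets] by simp
      note nn = nn_integral_data_dist[OF assms \<kappa>1(2) B]
      have ind: "emeasure ?D A = (\<integral>\<^sup>+p. indicator A p \<partial>?D)" if "A \<in> sets borel" for A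
        using that sets by simp
      show "prob_space ?D"
      proof (rule prob_spaceI)
        have "emeasure ?D (space ?D) = (1 + 1) / 2"
          using nn[of "\<lambda>_. 1" \<mu>] by (simp add: em)
        then show "emeasure ?D (space ?D) = 1" by simp
      qed
      have m: "{p. Q (snd p)} \<in> sets (borel :: ((real ^ 'd) \<times> real) measure)" if "Measurable.pred borel Q" for Q
      proof -
        have "{p \<in> space (borel :: ((real ^ 'd) \<times> real) measure). Q (snd p)} \<in> sets borel"
          using that by measurable
        then show ?thesis by simp
      qed
      have m0: "{p. snd p \<notin> {0, 1}} \<in> sets (borel :: ((real ^ 'd) \<times> real) measure)"
        by (rule m) simp
      have m1: "{p. snd p = 1} \<in> sets (borel :: ((real ^ 'd) \<times> real) measure)"
        by (rule m) simp
      have "emeasure ?D {p. snd p \<notin> {0, 1}} = 0"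
        using m0 unfolding ind[OF m0] by (subst nn) (auto simp: indicator_def)
      then show "AE p in ?D. snd p \<in> {0, 1}"
        by (subst AE_iff_measurable[OF _ refl]) (auto simp: sp)
      show "emeasure ?D {p. snd p = 1} = 1 / 2"
        using m1 unfolding ind[OF m1] by (subst nn) (auto simp: em indicator_def)
      have K1: "(\<integral>\<^sup>+z. ennreal (exp (4 * norm (m + ?c *\<^sub>R (B *v z)))) \<partial>std_gaussian) \<le> ennreal K"
        if "norm m = norm \<mu>" for m
      proof -
        have "(\<integral>\<^sup>+z. ennreal (exp (4 * norm (m + ?c *\<^sub>R (B *v z)))) \<partial>std_gaussian)
          \<le> (\<integral>\<^sup>+z. ennreal (exp (4 * norm \<mu>)) * ennreal (exp (4 * \<beta> * norm z)) \<partial>(std_gaussian :: (real ^ 'd) measure))"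
        proof (rule nn_integral_mono)
          fix z :: "real ^ 'd"
          have "norm (m + ?c *\<^sub>R (B *v z)) \<le> norm \<mu> + ?c * norm (B *v z)"
            using norm_triangle_ineq[of m "?c *\<^sub>R (B *v z)"] that c by simp
          also have "\<dots> \<le> norm \<mu> + 1 * (norm z * \<beta>)"
            using c \<beta> by (intro add_left_mono mult_mono) auto
          finally show "ennreal (exp (4 * norm (m + ?c *\<^sub>R (B *v z)))) \<le> ennreal (exp (4 * norm \<mu>)) * ennreal (exp (4 * \<beta> * norm z))"
            by (simp add: ennreal_mult[symmetric] exp_add[symmetric] mult_ac)
        qed
        also have "\<dots> = ennreal (exp (4 * norm \<mu>)) * E"
          unfolding E_def by (rule nn_integral_cmult) simp
        also have "\<dots> = ennreal (exp (4 * norm \<mu>) * e)" using Ee by (simp add: ennreal_mult)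
        also have "\<dots> \<le> ennreal K" by (rule ennreal_leI) (simp add: K_def e_def)
        finally show ?thesis .
      qed
      have "(\<integral>\<^sup>+p. ennreal (exp (4 * norm (fst p))) \<partial>?D) \<le> (ennreal K + ennreal K) / 2"
        using K1[of \<mu>] K1[of "- \<mu>"]
        by (subst nn) (measurable, auto intro!: divide_right_mono_ennreal add_mono simp del: ennreal_plus add_uminus_conv_diff uminus_add_conv_diff)
      also have "\<dots> = ennreal K"
        using \<open>0 < K\<close> by (simp add: ennreal_plus[symmetric] ennreal_divide_numeral del: ennreal_plus)
      finally show "(\<integral>\<^sup>+p. ennreal (exp (4 * norm (fst p))) \<partial>?D) \<le> ennreal K" .
      have R1: "(\<integral>\<^sup>+z. ennreal (norm (?c *\<^sub>R (B *v z))) \<partial>std_gaussian) \<le> ennreal \<rho>"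
      proof -
        have "(\<integral>\<^sup>+z. ennreal (norm (?c *\<^sub>R (B *v z))) \<partial>std_gaussian)
          \<le> (\<integral>\<^sup>+z. ennreal ?c * ennreal (exp (4 * \<beta> * norm z)) \<partial>(std_gaussian :: (real ^ 'd) measure))"
        proof (rule nn_integral_mono)
          fix z :: "real ^ 'd"
          have "norm (?c *\<^sub>R (B *v z)) = ?c * norm (B *v z)" using c by simp
          also have "\<dots> \<le> ?c * exp (4 * \<beta> * norm z)"
          proof (rule mult_left_mono)
            have "norm (B *v z) \<le> \<beta> * norm z" using \<beta>(2)[of z] by (simp add: mult.commute)
            also have "\<dots> \<le> 4 * \<beta> * norm z" using \<beta>(1) by (intro mult_right_mono) auto
            also have "\<dots> \<le> exp (4 * \<beta> * norm z)" by (rule le_exp)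
            finally show "norm (B *v z) \<le> exp (4 * \<beta> * norm z)" .
          qed (use c in auto)
          finally show "ennreal (norm (?c *\<^sub>R (B *v z))) \<le> ennreal ?c * ennreal (exp (4 * \<beta> * norm z))"
            using c by (simp only: ennreal_mult[symmetric] less_imp_le exp_ge_zero ennreal_leI)
        qed
        also have "\<dots> = ennreal ?c * E"
          unfolding E_def by (rule nn_integral_cmult) simp
        also have "\<dots> = ennreal (?c * e)" using Ee c by (simp add: ennreal_mult[symmetric])
        also have "\<dots> \<le> ennreal \<rho>"
        proof (rule ennreal_leI)
          have "e / \<rho> \<le> sqrt \<kappa>" using \<kappa>2 by (rule real_le_rsqrt)
          then show "?c * e \<le> \<rho>" using \<open>0 < \<rho>\<close> \<kappa>1 by (simp add: field_simps)
        qed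
        finally show ?thesis .
      qed
      have "(\<integral>\<^sup>+p. ennreal (norm (fst p - (2 * snd p - 1) *\<^sub>R \<mu>)) \<partial>?D) \<le> (ennreal \<rho> + ennreal \<rho>) / 2"
        by (subst nn) (use R1 in \<open>auto intro!: divide_right_mono_ennreal add_mono simp del: ennreal_plus\<close>)
      also have "\<dots> = ennreal \<rho>"
        using \<open>0 < \<rho>\<close> by (simp add: ennreal_plus[symmetric] ennreal_divide_numeral del: ennreal_plus)
      finally show "(\<integral>\<^sup>+p. ennreal (norm (fst p - (2 * snd p - 1) *\<^sub>R \<mu>)) \<partial>?D) \<le> ennreal \<rho>" .
    qed
  qed
qed

section \<open>Measurability of minimizer events\<close>

lemma countable_dense_subset:
  fixes K :: "'a::euclidean_space set"
  obtains D where "countable D" "D \<subseteq> K" "\<And>x e. x \<in> K \<Longrightarrow> 0 < e \<Longrightarrow> \<exists>d\<in>D. dist d x < e"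
  using separable[of K] by (metis closure_approachable subsetD)

text \<open>Replaces quantifiers over uncountable sets by countable ones. An exact minimizer is
  approximated by continuity; conversely, near-minimizers with vanishing tolerance have a limit
  point in the compact \<open>K\<close>, which is a minimizer.\<close>

lemma attained_on_compact_iff:
  fixes f :: "'a::euclidean_space \<Rightarrow> real"
  assumes f: "continuous_on UNIV f" and K: "compact K"
    and DK: "D \<subseteq> K" "\<And>x e. x \<in> K \<Longrightarrow> 0 < e \<Longrightarrow> \<exists>d\<in>D. dist d x < e"
    and DU: "\<And>x e. 0 < e \<Longrightarrow> \<exists>d\<in>DU. dist d x < e"
  shows "(\<exists>w\<in>K. \<forall>v. f w \<le> f v) \<longleftrightarrow> (\<forall>m. \<exists>w\<in>D. \<forall>v\<in>DU. f w \<le> f v + 1 / real (Suc m))"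
proof
  assume "\<exists>w\<in>K. \<forall>v. f w \<le> f v"
  then obtain w where w: "w \<in> K" "\<And>v. f w \<le> f v" by blast
  show "\<forall>m. \<exists>w\<in>D. \<forall>v\<in>DU. f w \<le> f v + 1 / real (Suc m)"
  proof
    fix m
    obtain e where e: "0 < e" "\<And>x. dist x w < e \<Longrightarrow> dist (f x) (f w) < 1 / real (Suc m)"
      using f[unfolded continuous_on_iff] by (metis UNIV_I of_nat_0_less_iff zero_less_Suc zero_less_divide_1_iff)
    obtain d where d: "d \<in> D" "dist d w < e" using DK(2)[OF w(1) e(1)] by blast
    have "f d \<le> f w + 1 / real (Suc m)" using e(2)[OF d(2)] by (simp add: dist_real_def)
    then show "\<exists>w\<in>D. \<forall>v\<in>DU. f w \<le> f v + 1 / real (Suc m)" using d(1) w(2) by (meson add_right_mono order_trans)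
  qed
next
  assume "\<forall>m. \<exists>w\<in>D. \<forall>v\<in>DU. f w \<le> f v + 1 / real (Suc m)"
  then obtain W where W: "\<And>m. W m \<in> D" "\<And>m v. v \<in> DU \<Longrightarrow> f (W m) \<le> f v + 1 / real (Suc m)" by metis
  then have "\<forall>m. W m \<in> K" using DK(1) by blast
  then obtain w r where w: "w \<in> K" "strict_mono r" "(W \<circ> r) \<longlonglongrightarrow> w"
    using K unfolding compact_def by metis
  have fw: "(\<lambda>m. f (W (r m))) \<longlonglongrightarrow> f w"
    using continuous_on_tendsto_compose[OF f w(3)] by (simp add: o_def)
  have r0: "(\<lambda>m. 1 / real (Suc (r m))) \<longlonglongrightarrow> 0"
    using LIMSEQ_subseq_LIMSEQ[OF LIMSEQ_inverse_real_of_nat w(2)] by (simp add: o_def inverse_eq_divide)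
  have le: "f w \<le> f v" if "v \<in> DU" for v
  proof (rule LIMSEQ_le[OF fw])
    show "(\<lambda>m. f v + 1 / real (Suc (r m))) \<longlonglongrightarrow> f v" using tendsto_add[OF tendsto_const r0] by simp
  qed (use W(2)[OF that] in auto)
  have "f w \<le> f v" for v
  proof (rule field_le_epsilon)
    fix e :: real assume "0 < e"
    obtain s where s: "0 < s" "\<And>x. dist x v < s \<Longrightarrow> dist (f x) (f v) < e"
      using f[unfolded continuous_on_iff] \<open>0 < e\<close> by (metis UNIV_I)
    obtain d where d: "d \<in> DU" "dist d v < s" using DU[OF s(1)] by blast
    show "f w \<le> f v + e" using le[OF d(1)] s(2)[OF d(2)] by (simp add: dist_real_def)
  qed
  then show "\<exists>w\<in>K. \<forall>v. f w \<le> f v" using w(1) by blast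
qed

lemma measurable_attained_on_compact:
  fixes f :: "'b \<Rightarrow> 'a::euclidean_space \<Rightarrow> real"
  assumes [measurable]: "\<And>w. (\<lambda>\<omega>. f \<omega> w) \<in> borel_measurable M"
    and f: "\<And>\<omega>. \<omega> \<in> space M \<Longrightarrow> continuous_on UNIV (f \<omega>)" and K: "compact K"
  shows "{\<omega> \<in> space M. \<exists>w\<in>K. \<forall>v. f \<omega> w \<le> f \<omega> v} \<in> sets M"
proof -
  obtain D where D: "countable D" "D \<subseteq> K" "\<And>x e. x \<in> K \<Longrightarrow> 0 < e \<Longrightarrow> \<exists>d\<in>D. dist d x < e"
    using countable_dense_subset[of K] by blast
  obtain DU where DU: "countable DU" "\<And>(x :: 'a) e. 0 < e \<Longrightarrow> \<exists>d\<in>DU. dist d x < e"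
    using countable_dense_subset[of "UNIV :: 'a set"] by (metis UNIV_I)
  have "{\<omega> \<in> space M. \<exists>w\<in>K. \<forall>v. f \<omega> w \<le> f \<omega> v}
    = {\<omega> \<in> space M. \<forall>m. \<exists>w\<in>D. \<forall>v\<in>DU. f \<omega> w \<le> f \<omega> v + 1 / real (Suc m)}"
    using attained_on_compact_iff[OF f K D(2,3) DU(2)] by auto
  also have "\<dots> \<in> sets M" using D(1) DU(1) by measurable
  finally show ?thesis .
qed

text \<open>A minimizer is unique iff no two disjoint members of a countable family of small closed balls both contain
  minimizers, which expresses the event by countably many attainment events.\<close>

lemma measurable_unique_minimizer:
  fixes f :: "'b \<Rightarrow> 'a::euclidean_space \<Rightarrow> real"
  assumes m: "\<And>w. (\<lambda>\<omega>. f \<omega> w) \<in> borel_measurable M"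
    and f: "\<And>\<omega>. \<omega> \<in> space M \<Longrightarrow> continuous_on UNIV (f \<omega>)"
    and KA: "countable \<K>" "\<And>K. K \<in> \<K> \<Longrightarrow> compact K" "A = \<Union>\<K>"
  shows "{\<omega> \<in> space M. \<exists>w. unique_minimizer (f \<omega>) w \<and> w \<in> A} \<in> sets M"
proof -
  define H where "H K \<omega> \<longleftrightarrow> (\<exists>w\<in>K. \<forall>v. f \<omega> w \<le> f \<omega> v)" for K \<omega>
  have H [measurable]: "Measurable.pred M (H K)" if "compact K" for K
    using measurable_attained_on_compact[OF m f that] unfolding H_def pred_def by blast
  obtain DU where DU: "countable DU" "\<And>(x :: 'a) e. 0 < e \<Longrightarrow> \<exists>d\<in>DU. dist d x < e"
    using countable_dense_subset[of "UNIV :: 'a set"] by (metis UNIV_I)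
  define \<B> where "\<B> = (\<lambda>(d, k). cball d (1 / real (Suc k))) ` (DU \<times> (UNIV :: nat set))"
  have B: "countable \<B>" "\<And>K. K \<in> \<B> \<Longrightarrow> compact K" using DU(1) by (auto simp: \<B>_def)
  have sep: "\<exists>K\<in>\<B>. \<exists>L\<in>\<B>. K \<inter> L = {} \<and> w \<in> K \<and> v \<in> L" if wv: "w \<noteq> v" for w v
  proof -
    \<comment> \<open>Two radii and two distances from the centers, each at most
      \<open>1 / real (Suc k)\<close>, together cannot bridge \<open>dist w v\<close>; hence the
      quarter.\<close>
    obtain k where k: "1 / real (Suc k) < dist w v / 4"
      using wv nat_approx_posE[of "dist w v / 4"] by (metis dist_pos_lt divide_pos_pos zero_less_numeral)
    obtain c d where cd: "c \<in> DU" "dist c w < 1 / real (Suc k)" "d \<in> DU" "dist d v < 1 / real (Suc k)"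
      using DU(2)[of "1 / real (Suc k)"] by (metis of_nat_0_less_iff zero_less_Suc zero_less_divide_1_iff)
    have "cball c (1 / real (Suc k)) \<inter> cball d (1 / real (Suc k)) = {}"
    proof (rule ccontr)
      assume "\<not> ?thesis"
      then obtain x where "dist c x \<le> 1 / real (Suc k)" "dist d x \<le> 1 / real (Suc k)" by auto
      moreover have "dist w v \<le> dist c w + dist c x + dist d x + dist d v"
        using dist_triangle[of w v c] dist_triangle[of c v x] dist_triangle[of x v d]
        by (simp add: dist_commute)
      ultimately show False using cd k by linarith
    qed
    then show ?thesis using cd unfolding \<B>_def
      by (intro bexI[of _ "cball c (1 / real (Suc k))"] bexI[of _ "cball d (1 / real (Suc k))"]) (auto intro: less_imp_le)
  qed
  have "(\<exists>w. unique_minimizer (f \<omega>) w \<and> w \<in> A) \<longleftrightarrow>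
    (\<exists>K\<in>\<K>. H K \<omega>) \<and> (\<forall>K\<in>\<B>. \<forall>L\<in>\<B>. K \<inter> L = {} \<longrightarrow> \<not> (H K \<omega> \<and> H L \<omega>))" for \<omega>
  proof (intro iffI conjI)
    assume "\<exists>w. unique_minimizer (f \<omega>) w \<and> w \<in> A"
    then obtain w where w: "w \<in> A" "\<And>v. f \<omega> w \<le> f \<omega> v" "\<And>v. (\<And>u. f \<omega> v \<le> f \<omega> u) \<Longrightarrow> v = w"
      unfolding unique_minimizer_iff by blast
    then show "\<exists>K\<in>\<K>. H K \<omega>" using KA(3) unfolding H_def by auto
    show "\<forall>K\<in>\<B>. \<forall>L\<in>\<B>. K \<inter> L = {} \<longrightarrow> \<not> (H K \<omega> \<and> H L \<omega>)"
      unfolding H_def using w(3) by blast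
  next
    assume *: "(\<exists>K\<in>\<K>. H K \<omega>) \<and> (\<forall>K\<in>\<B>. \<forall>L\<in>\<B>. K \<inter> L = {} \<longrightarrow> \<not> (H K \<omega> \<and> H L \<omega>))"
    then obtain w where w: "w \<in> A" "\<And>v. f \<omega> w \<le> f \<omega> v" using KA(3) unfolding H_def by auto
    have "v = w" if "\<And>u. f \<omega> v \<le> f \<omega> u" for v
      using * sep[of w v] w(2) that unfolding H_def by metis
    then show "\<exists>w. unique_minimizer (f \<omega>) w \<and> w \<in> A"
      unfolding unique_minimizer_iff using w by blast
  qed
  moreover have "{\<omega> \<in> space M. (\<exists>K\<in>\<K>. H K \<omega>) \<and> (\<forall>K\<in>\<B>. \<forall>L\<in>\<B>. K \<inter> L = {} \<longrightarrow> \<not> (H K \<omega> \<and> H L \<omega>))} \<in> sets M"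
    by (intro sets.sets_Collect_conj sets.sets_Collect_countable_Ex' sets.sets_Collect_countable_All'
        sets.sets_Collect_imp sets.sets_Collect_neg sets.sets_Collect_const B(1) KA(1))
      (use H[OF B(2)] H[OF KA(2)] in \<open>simp_all add: pred_def\<close>)
  ultimately show ?thesis by simp
qed

text \<open>The set of directions in question is closed away from the origin, hence a countable union of compact sets.\<close>

lemma measurable_unique_minimizer_sim:
  fixes f :: "'b \<Rightarrow> real ^ 'd \<Rightarrow> real"
  assumes m: "\<And>w. (\<lambda>\<omega>. f \<omega> w) \<in> borel_measurable M"
    and f: "\<And>\<omega>. \<omega> \<in> space M \<Longrightarrow> continuous_on UNIV (f \<omega>)"
  shows "{\<omega> \<in> space M. \<exists>w. unique_minimizer (f \<omega>) w \<and> w \<noteq> 0 \<and> s \<le> sim w w\<^sub>0} \<in> sets M"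
proof -
  define K where "K k = cball 0 (real k) \<inter> {w. 1 / real (Suc k) \<le> norm w} \<inter> {w. s * (norm w * norm w\<^sub>0) \<le> w \<bullet> w\<^sub>0}"
    for k
  \<comment> \<open>For \<open>w\<^sub>0 = 0\<close> the division in \<open>sim\<close> yields
    \<open>0\<close>, so the condition \<open>s \<le> sim w w\<^sub>0\<close> becomes
    \<open>s \<le> 0\<close>. The multiplied-out inequality in \<open>K\<close> does not see this,
    hence the case distinction.\<close>
  define K' where "K' k = (if w\<^sub>0 = 0 \<and> \<not> s \<le> 0 then {} else K k)" for k
  have "compact (K k)" for k
    unfolding K_def by (intro compact_Int_closed compact_cball closed_Collect_le continuous_intros)
  then have c: "compact (K' k)" for k by (simp add: K'_def)
  have A: "{w. w \<noteq> 0 \<and> s \<le> sim w w\<^sub>0} = (\<Union>k. K' k)"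
  proof (intro set_eqI iffI)
    fix w assume w: "w \<in> {w. w \<noteq> 0 \<and> s \<le> sim w w\<^sub>0}"
    obtain k1 where k1: "norm w \<le> real k1" using real_arch_simple by blast
    obtain k2 where k2: "1 / real (Suc k2) < norm w" using w nat_approx_posE[of "norm w"] by auto
    define k where "k = max k1 k2"
    have "real k1 \<le> real k" by (simp add: k_def)
    moreover have "1 / real (Suc k) \<le> 1 / real (Suc k2)" by (intro divide_left_mono) (auto simp: k_def)
    ultimately have "w \<in> cball 0 (real k) \<inter> {w. 1 / real (Suc k) \<le> norm w}" using k1 k2 by auto
    moreover have "s * (norm w * norm w\<^sub>0) \<le> w \<bullet> w\<^sub>0"
      using w by (cases "w\<^sub>0 = 0") (auto simp: sim_def field_simps)
    moreover have "\<not> (w\<^sub>0 = 0 \<and> \<not> s \<le> 0)" using w by (auto simp: sim_def)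
    ultimately have "w \<in> K' k" by (auto simp: K'_def K_def)
    then show "w \<in> (\<Union>k. K' k)" by blast
  next
    fix w assume "w \<in> (\<Union>k. K' k)"
    then obtain k where k: "w \<in> K' k" by blast
    then have "w \<in> K k" and ns: "w\<^sub>0 = 0 \<Longrightarrow> s \<le> 0" by (auto simp: K'_def split: if_splits)
    then have w: "1 / real (Suc k) \<le> norm w" "s * (norm w * norm w\<^sub>0) \<le> w \<bullet> w\<^sub>0" by (auto simp: K_def)
    have "0 < 1 / real (Suc k)" by simp
    then have "w \<noteq> 0" using w(1) by (metis leD norm_zero)
    then show "w \<in> {w. w \<noteq> 0 \<and> s \<le> sim w w\<^sub>0}"
      using w(2) ns by (cases "w\<^sub>0 = 0") (auto simp: sim_def field_simps)
  qed
  have "{\<omega> \<in> space M. \<exists>w. unique_minimizer (f \<omega>) w \<and> w \<in> {w. w \<noteq> 0 \<and> s \<le> sim w w\<^sub>0}} \<in> sets M"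
    by (rule measurable_unique_minimizer[OF m f _ _ A]) (use c in auto)
  then show ?thesis by simp
qed

section \<open>Exponential concentration over pairs\<close>

lemma exp_le_quadratic: "exp u \<le> 1 + u + u\<^sup>2 * exp \<bar>u\<bar>" for u :: real
proof (cases "u = 0")
  case False
  obtain t where t: "\<bar>t\<bar> \<le> \<bar>u\<bar>" "exp u = (\<Sum>m<2. u ^ m / fact m) + exp t / fact 2 * u ^ 2"
    using Maclaurin_exp_le[of u 2] by blast
  have "exp t / 2 * u\<^sup>2 \<le> exp \<bar>u\<bar> * u\<^sup>2"
  proof (rule mult_right_mono)
    have "exp t \<le> exp \<bar>u\<bar>" using t(1) by simp
    then show "exp t / 2 \<le> exp \<bar>u\<bar>" using exp_gt_zero[of t] by linarith
  qed simp
  then show ?thesis unfolding t(2) by (simp add: numeral_2_eq_2 mult.commute)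
qed simp

lemma square_le_exp: "x\<^sup>2 \<le> 8 * exp (\<bar>x\<bar> / 2)" for x :: real
  using exp_lower_Taylor_quadratic[of "\<bar>x\<bar> / 2"] by (simp add: power_divide)

section \<open>Chernoff bounds for sub-exponential variables\<close>

context prob_space
begin

text \<open>In the second-order bound on \<open>exp\<close> the linear term has mean zero.
  Restricting \<open>\<theta>\<close> to at most \<open>1 / 2\<close> spends only half of the
  exponent \<open>\<bar>Z\<bar>\<close>; the other half absorbs the factor \<open>Z\<^sup>2\<close>
  at the price of the constant \<open>8\<close>.\<close>

lemma subexponential_mgf:
  fixes \<theta> :: real
  assumes [measurable]: "Z \<in> borel_measurable M" and int: "integrable M (\<lambda>\<omega>. exp \<bar>Z \<omega>\<bar>)"
    and K: "expectation (\<lambda>\<omega>. exp \<bar>Z \<omega>\<bar>) \<le> K" and Z0: "expectation Z = 0" and \<theta>: "\<bar>\<theta>\<bar> \<le> 1 / 2"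
  shows "integrable M (\<lambda>\<omega>. exp (\<theta> * Z \<omega>))"
    and "expectation (\<lambda>\<omega>. exp (\<theta> * Z \<omega>)) \<le> exp (8 * K * \<theta>\<^sup>2)"
proof -
  have a: "\<bar>\<theta> * z\<bar> \<le> \<bar>z\<bar> / 2" for z :: real
    using \<theta> mult_right_mono[of "\<bar>\<theta>\<bar>" "1 / 2" "\<bar>z\<bar>"] by (simp add: abs_mult)
  show I: "integrable M (\<lambda>\<omega>. exp (\<theta> * Z \<omega>))"
  proof (rule Bochner_Integration.integrable_bound[OF int])
    show "AE \<omega> in M. norm (exp (\<theta> * Z \<omega>)) \<le> norm (exp \<bar>Z \<omega>\<bar>)"
    proof (rule AE_I2)
      fix \<omega>
      have "\<theta> * Z \<omega> \<le> \<bar>Z \<omega>\<bar>" using a[of "Z \<omega>"] by linarith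
      then show "norm (exp (\<theta> * Z \<omega>)) \<le> norm (exp \<bar>Z \<omega>\<bar>)" by simp
    qed
  qed simp
  have IZ: "integrable M Z"
  proof (rule Bochner_Integration.integrable_bound[OF int])
    show "AE \<omega> in M. norm (Z \<omega>) \<le> norm (exp \<bar>Z \<omega>\<bar>)"
    proof (rule AE_I2)
      fix \<omega> show "norm (Z \<omega>) \<le> norm (exp \<bar>Z \<omega>\<bar>)" using exp_ge_add_one_self[of "\<bar>Z \<omega>\<bar>"] by (simp only: real_norm_def abs_exp_cancel)
    qed
  qed simp
  have le: "exp (\<theta> * z) \<le> 1 + \<theta> * z + 8 * \<theta>\<^sup>2 * exp \<bar>z\<bar>" for z
  proof -
    have "(\<theta> * z)\<^sup>2 * exp \<bar>\<theta> * z\<bar> \<le> \<theta>\<^sup>2 * (8 * exp (\<bar>z\<bar> / 2)) * exp (\<bar>z\<bar> / 2)"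
      unfolding power_mult_distrib using a[of z] square_le_exp[of z]
      by (intro mult_mono mult_left_mono) auto
    also have "\<dots> = 8 * \<theta>\<^sup>2 * exp \<bar>z\<bar>" by (simp add: exp_add[symmetric])
    finally show ?thesis using exp_le_quadratic[of "\<theta> * z"] by linarith
  qed
  have "expectation (\<lambda>\<omega>. exp (\<theta> * Z \<omega>)) \<le> expectation (\<lambda>\<omega>. 1 + \<theta> * Z \<omega> + 8 * \<theta>\<^sup>2 * exp \<bar>Z \<omega>\<bar>)"
    by (rule integral_mono[OF I _ le]) (use int IZ in auto)
  also have "\<dots> = 1 + 8 * \<theta>\<^sup>2 * expectation (\<lambda>\<omega>. exp \<bar>Z \<omega>\<bar>)"
    using int IZ Z0 by (simp add: prob_space)
  also have "\<dots> \<le> 1 + 8 * \<theta>\<^sup>2 * K" using K by (intro add_left_mono mult_left_mono) auto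
  also have "\<dots> \<le> exp (8 * K * \<theta>\<^sup>2)" using exp_ge_add_one_self[of "8 * K * \<theta>\<^sup>2"] by (simp add: mult_ac)
  finally show "expectation (\<lambda>\<omega>. exp (\<theta> * Z \<omega>)) \<le> exp (8 * K * \<theta>\<^sup>2)" .
qed

text \<open>Only an upper bound \<open>N\<close> on the number of summands enters, so groups of
  different sizes share one threshold \<open>N * t\<close>.\<close>

lemma subexponential_tail_upper:
  assumes "finite L" and "real (card L) \<le> N" and ind: "indep_vars (\<lambda>_. borel) Z L"
    and int: "\<And>l. l \<in> L \<Longrightarrow> integrable M (\<lambda>\<omega>. exp \<bar>Z l \<omega>\<bar>)"
    and K: "\<And>l. l \<in> L \<Longrightarrow> expectation (\<lambda>\<omega>. exp \<bar>Z l \<omega>\<bar>) \<le> K"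
    and Z0: "\<And>l. l \<in> L \<Longrightarrow> expectation (Z l) = 0"
    and t: "0 < t" "t \<le> 8 * K"
  shows "prob {\<omega> \<in> space M. N * t \<le> (\<Sum>l\<in>L. Z l \<omega>)} \<le> exp (- (N * t\<^sup>2 / (32 * K)))"
proof -
  have K0: "0 < K" using t by linarith
  \<comment> \<open>Minimizer of the exponent
    \<open>8 * K * \<theta>\<^sup>2 - \<theta> * t\<close>; the condition
    \<open>t \<le> 8 * K\<close> keeps it at most \<open>1 / 2\<close>.\<close>
  define \<theta> where "\<theta> = t / (16 * K)"
  have \<theta>: "0 < \<theta>" "\<bar>\<theta>\<bar> \<le> 1 / 2" using t K0 by (auto simp: \<theta>_def field_simps)
  have Zm [measurable]: "Z l \<in> borel_measurable M" if "l \<in> L" for l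
    using ind that by (auto simp: indep_vars_def2)
  note mgf = subexponential_mgf[OF Zm int K Z0 \<theta>(2)]
  have ind': "indep_vars (\<lambda>_. borel) (\<lambda>l \<omega>. exp (\<theta> * Z l \<omega>)) L"
    using indep_vars_compose2[OF ind, of "\<lambda>_ z. exp (\<theta> * z)" "\<lambda>_. borel"] by simp
  note e = indep_vars_lebesgue_integral[OF assms(1) ind' mgf(1)] indep_vars_integrable[OF assms(1) ind' mgf(1)]
  have ex: "exp (\<theta> * (\<Sum>l\<in>L. Z l \<omega>)) = (\<Prod>l\<in>L. exp (\<theta> * Z l \<omega>))" for \<omega>
    using assms(1) by (simp add: sum_distrib_left exp_sum)
  have "prob {\<omega> \<in> space M. N * t \<le> (\<Sum>l\<in>L. Z l \<omega>)}
    = prob {\<omega> \<in> space M. exp (\<theta> * (N * t)) \<le> exp (\<theta> * (\<Sum>l\<in>L. Z l \<omega>))}"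
    using \<theta>(1) by simp
  also have "\<dots> \<le> expectation (\<lambda>\<omega>. exp (\<theta> * (\<Sum>l\<in>L. Z l \<omega>))) / exp (\<theta> * (N * t))"
    by (rule integral_Markov_inequality_measure[where A = "{}"]) (use e(2) ex in \<open>auto intro!: AE_I2 prod_nonneg\<close>)
  also have "expectation (\<lambda>\<omega>. exp (\<theta> * (\<Sum>l\<in>L. Z l \<omega>))) = (\<Prod>l\<in>L. expectation (\<lambda>\<omega>. exp (\<theta> * Z l \<omega>)))"
    unfolding ex using e(1) .
  also have "\<dots> \<le> (\<Prod>l\<in>L. exp (8 * K * \<theta>\<^sup>2))"
    by (intro prod_mono conjI mgf(2)) auto
  also have "\<dots> = exp (real (card L) * (8 * K * \<theta>\<^sup>2))" by (simp add: exp_of_nat_mult[symmetric])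
  also have "\<dots> \<le> exp (N * (8 * K * \<theta>\<^sup>2))" using assms(2) K0 by (simp add: mult_right_mono)
  also have "exp (N * (8 * K * \<theta>\<^sup>2)) / exp (\<theta> * (N * t)) = exp (- (N * t\<^sup>2 / (32 * K)))"
    unfolding exp_diff[symmetric] using K0 by (simp add: \<theta>_def field_simps power2_eq_square)
  finally show ?thesis by (simp add: divide_right_mono)
qed

lemma subexponential_tail:
  assumes "finite L" and "real (card L) \<le> N" and ind: "indep_vars (\<lambda>_. borel) Z L"
    and int: "\<And>l. l \<in> L \<Longrightarrow> integrable M (\<lambda>\<omega>. exp \<bar>Z l \<omega>\<bar>)"
    and K: "\<And>l. l \<in> L \<Longrightarrow> expectation (\<lambda>\<omega>. exp \<bar>Z l \<omega>\<bar>) \<le> K"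
    and Z0: "\<And>l. l \<in> L \<Longrightarrow> expectation (Z l) = 0"
    and t: "0 < t" "t \<le> 8 * K"
  shows "prob {\<omega> \<in> space M. N * t \<le> \<bar>\<Sum>l\<in>L. Z l \<omega>\<bar>} \<le> 2 * exp (- (N * t\<^sup>2 / (32 * K)))"
proof -
  have Zm [measurable]: "Z l \<in> borel_measurable M" if "l \<in> L" for l
    using ind that by (auto simp: indep_vars_def2)
  have ind': "indep_vars (\<lambda>_. borel) (\<lambda>l \<omega>. - Z l \<omega>) L"
    using indep_vars_compose2[OF ind, of "\<lambda>_ z. - z" "\<lambda>_. borel"] by simp
  have 1: "prob {\<omega> \<in> space M. N * t \<le> (\<Sum>l\<in>L. Z l \<omega>)} \<le> exp (- (N * t\<^sup>2 / (32 * K)))"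
    by (rule subexponential_tail_upper) (use assms in auto)
  have 2: "prob {\<omega> \<in> space M. N * t \<le> (\<Sum>l\<in>L. - Z l \<omega>)} \<le> exp (- (N * t\<^sup>2 / (32 * K)))"
    by (rule subexponential_tail_upper) (use assms ind' in auto)
  have "{\<omega> \<in> space M. N * t \<le> \<bar>\<Sum>l\<in>L. Z l \<omega>\<bar>}
    = {\<omega> \<in> space M. N * t \<le> (\<Sum>l\<in>L. Z l \<omega>)} \<union> {\<omega> \<in> space M. N * t \<le> (\<Sum>l\<in>L. - Z l \<omega>)}"
    by (auto simp: sum_negf abs_if split: if_splits)
  also have "prob \<dots> \<le> prob {\<omega> \<in> space M. N * t \<le> (\<Sum>l\<in>L. Z l \<omega>)} + prob {\<omega> \<in> space M. N * t \<le> (\<Sum>l\<in>L. - Z l \<omega>)}"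
    by (rule measure_Un_le) measurable
  finally show ?thesis using 1 2 by simp
qed

end

lemma mod_interval_unique:
  fixes n :: nat
  assumes "(i + j) mod n = (i + j') mod n" "j \<in> {1..n}" "j' \<in> {1..n}"
  shows "j = j'"
proof -
  have *: "a = b" if "(i + a) mod n = (i + b) mod n" "a \<in> {1..n}" "b \<in> {1..n}" "a \<le> b" for a b
  proof -
    have "n dvd b - a" using that(1,4) mod_eq_dvd_iff_nat[of "i + a" "i + b" n] by simp
    moreover have "b - a < n" using that by auto
    ultimately show ?thesis using that(4) by (meson diff_is_0_eq dvd_imp_le le_antisym not_le not_less_zero zero_less_iff_neq_zero)
  qed
  show ?thesis using *[of j j'] *[of j' j] assms by (cases "j \<le> j'") auto
qed

section \<open>The sample as one independent family\<close>

type_synonym 'd labelled = "(real ^ 'd) \<times> real"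
type_synonym 'd sample = "(nat \<Rightarrow> 'd labelled) \<times> (nat \<times> nat \<Rightarrow> 'd labelled)"
type_synonym 'd triple = "'d labelled \<times> 'd labelled \<times> 'd labelled"

locale iid_sample =
  fixes D M :: "('d::finite) labelled measure" and n :: nat
  assumes prob_D: "prob_space D" and prob_M: "prob_space M"
    and sets_D [measurable_cong]: "sets D = sets borel" and sets_M [measurable_cong]: "sets M = sets borel"
begin

abbreviation \<Omega> where "\<Omega> \<equiv> sample_dist n D M"

text \<open>Data points and masks are indexed by one sum type, so that the joint independence of all
  of them is a single \<open>indep_vars\<close> statement.\<close>

definition X :: "nat + nat \<times> nat \<Rightarrow> 'd sample \<Rightarrow> 'd labelled" where
  "X k \<omega> = (case k of Inl i \<Rightarrow> fst \<omega> i | Inr p \<Rightarrow> snd \<omega> p)"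

definition law :: "nat + nat \<times> nat \<Rightarrow> 'd labelled measure" where
  "law k = (case k of Inl i \<Rightarrow> D | Inr p \<Rightarrow> M)"

definition idx :: "(nat + nat \<times> nat) set" where
  "idx = Inl ` {1..n} \<union> Inr ` ({1..n} \<times> {1..n})"

sublocale D: prob_space D by (rule prob_D)
sublocale M: prob_space M by (rule prob_M)
sublocale PD: finite_product_prob_space "\<lambda>_. D" "{1..n}" by standard auto
sublocale PM: finite_product_prob_space "\<lambda>_. M" "{1..n} \<times> {1..n}" by standard auto
sublocale P: pair_prob_space "\<Pi>\<^sub>M i\<in>{1..n}. D" "\<Pi>\<^sub>M p\<in>{1..n} \<times> {1..n}. M" ..

sublocale prob_space \<Omega>
  unfolding sample_dist_def by (rule P.prob_space_axioms)

lemma finite_idx: "finite idx" by (simp add: idx_def)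

lemma sets_law [measurable_cong, simp]: "sets (law k) = sets borel"
  by (auto simp: law_def sets_D sets_M split: sum.split)

lemma prob_law: "prob_space (law k)"
  by (auto simp: law_def prob_D prob_M split: sum.split)

lemma space_D: "space D = UNIV" and space_M: "space M = UNIV"
  using sets_eq_imp_space_eq[OF sets_D] sets_eq_imp_space_eq[OF sets_M] by auto

lemma X_measurable: "k \<in> idx \<Longrightarrow> X k \<in> borel_measurable \<Omega>"
  unfolding idx_def sample_dist_def X_def[abs_def] by (auto split: sum.split)

lemma prob_rectangle:
  assumes A: "\<And>k. A k \<in> sets borel"
  shows "prob {\<omega> \<in> space \<Omega>. \<forall>k\<in>idx. X k \<omega> \<in> A k} = (\<Prod>k\<in>idx. measure (law k) (A k))"
proof -
  have "{\<omega> \<in> space \<Omega>. \<forall>k\<in>idx. X k \<omega> \<in> A k}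
    = (\<Pi>\<^sub>E i\<in>{1..n}. A (Inl i)) \<times> (\<Pi>\<^sub>E p\<in>{1..n} \<times> {1..n}. A (Inr p))"
    unfolding idx_def ball_Un ball_simps X_def
    by (auto simp: sample_dist_def space_pair_measure space_PiM space_D space_M PiE_iff)
  also have "prob \<dots> = measure (\<Pi>\<^sub>M i\<in>{1..n}. D) (\<Pi>\<^sub>E i\<in>{1..n}. A (Inl i))
      * measure (\<Pi>\<^sub>M p\<in>{1..n} \<times> {1..n}. M) (\<Pi>\<^sub>E p\<in>{1..n} \<times> {1..n}. A (Inr p))"
    unfolding sample_dist_def
    unfolding measure_def
    by (subst PM.emeasure_pair_measure_Times) (auto intro!: sets_PiM_I_finite simp: sets_D sets_M A enn2real_mult)
  also have "\<dots> = (\<Prod>i\<in>{1..n}. measure D (A (Inl i))) * (\<Prod>p\<in>{1..n} \<times> {1..n}. measure M (A (Inr p)))"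
    by (subst PD.prob_times, simp add: sets_D A, subst PM.prob_times) (auto simp: sets_M A)
  also have "\<dots> = (\<Prod>k\<in>idx. measure (law k) (A k))"
    unfolding idx_def by (subst prod.union_disjoint) (auto simp: prod.reindex law_def inj_on_def)
  finally show ?thesis .
qed

text \<open>Coordinates outside \<open>J\<close> are constrained to the whole space, which has
  measure \<open>1\<close>. One-element \<open>J\<close> gives the law of each \<open>X k\<close>,
  general \<open>J\<close> gives independence.\<close>

lemma prob_rectangle_subset:
  assumes A: "\<And>k. k \<in> J \<Longrightarrow> A k \<in> sets borel" and J: "J \<subseteq> idx"
  shows "prob {\<omega> \<in> space \<Omega>. \<forall>k\<in>J. X k \<omega> \<in> A k} = (\<Prod>k\<in>J. measure (law k) (A k))"
proof -
  define A' where "A' k = (if k \<in> J then A k else UNIV)" for k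
  have law1: "measure (law k) UNIV = 1" for k
    using prob_space.prob_space[OF prob_law[of k]] sets_eq_imp_space_eq[OF sets_law[of k]] by simp
  have "{\<omega> \<in> space \<Omega>. \<forall>k\<in>J. X k \<omega> \<in> A k} = {\<omega> \<in> space \<Omega>. \<forall>k\<in>idx. X k \<omega> \<in> A' k}"
    using J by (auto simp: A'_def)
  also have "prob \<dots> = (\<Prod>k\<in>idx. measure (law k) (A' k))"
    by (rule prob_rectangle) (auto simp: A'_def A)
  also have "\<dots> = (\<Prod>k\<in>J. measure (law k) (A' k))"
    by (rule prod.mono_neutral_right[OF finite_idx J]) (auto simp: A'_def law1)
  finally show ?thesis by (simp add: A'_def)
qed

lemma distr_X:
  assumes "k \<in> idx"
  shows "distr \<Omega> borel (X k) = law k"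
proof (rule measure_eqI)
  fix A assume "A \<in> sets (distr \<Omega> borel (X k))"
  then have A: "A \<in> sets borel" by simp
  interpret L: prob_space "law k" by (rule prob_law)
  have "emeasure (distr \<Omega> borel (X k)) A = emeasure \<Omega> {\<omega> \<in> space \<Omega>. \<forall>l\<in>{k}. X l \<omega> \<in> A}"
    using X_measurable[OF assms] A by (auto simp: emeasure_distr intro!: arg_cong[where f = "emeasure \<Omega>"])
  also have "\<dots> = ennreal (prob {\<omega> \<in> space \<Omega>. \<forall>l\<in>{k}. X l \<omega> \<in> A})" by (rule emeasure_eq_measure)
  also have "\<dots> = emeasure (law k) A"
    by (subst prob_rectangle_subset) (use A assms in \<open>auto simp: L.emeasure_eq_measure\<close>)
  finally show "emeasure (distr \<Omega> borel (X k)) A = emeasure (law k) A" .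
qed simp

lemma indep_X: "indep_vars (\<lambda>_. borel) X idx"
  unfolding indep_vars_def2
proof (intro conjI ballI X_measurable indep_setsI)
  fix i assume "i \<in> idx"
  then show "{X i -` A \<inter> space \<Omega> |A. A \<in> sets borel} \<subseteq> events"
    using measurable_sets[OF X_measurable] by auto
next
  fix A J assume J: "J \<noteq> {}" "J \<subseteq> idx" "finite J" "\<forall>j\<in>J. A j \<in> {X j -` A \<inter> space \<Omega> |A. A \<in> sets borel}"
  then obtain B where B: "\<And>j. j \<in> J \<Longrightarrow> B j \<in> sets borel" "\<And>j. j \<in> J \<Longrightarrow> A j = X j -` B j \<inter> space \<Omega>"
    by (simp add: Bex_def) metis
  have "(\<Inter>j\<in>J. A j) = {\<omega> \<in> space \<Omega>. \<forall>k\<in>J. X k \<omega> \<in> B k}" using J(1) B(2) by auto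
  then have "prob (\<Inter>j\<in>J. A j) = (\<Prod>j\<in>J. measure (law j) (B j))"
    using prob_rectangle_subset[of J B] B(1) J(2) by simp
  also have "\<dots> = (\<Prod>j\<in>J. prob (A j))"
  proof (rule prod.cong)
    fix j assume j: "j \<in> J"
    have "A j = {\<omega> \<in> space \<Omega>. \<forall>k\<in>{j}. X k \<omega> \<in> B k}" using B(2)[OF j] by auto
    moreover have "prob {\<omega> \<in> space \<Omega>. \<forall>k\<in>{j}. X k \<omega> \<in> B k} = (\<Prod>k\<in>{j}. measure (law k) (B k))"
      by (rule prob_rectangle_subset) (use B(1) J(2) j in auto)
    ultimately show "measure (law j) (B j) = prob (A j)" by simp
  qed simp
  finally show "prob (\<Inter>j\<in>J. A j) = (\<Prod>j\<in>J. prob (A j))" .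
qed

end

text \<open>The pairs \<open>(i, j)\<close> are grouped by the sign of \<open>i - j\<close> and by \<open>i + j\<close> modulo \<open>n\<close>. Distinct pairs
  of one group share no index, so the corresponding summands are independent.\<close>

definition pair_class :: "nat \<Rightarrow> nat \<times> nat \<Rightarrow> bool \<times> bool \<times> nat" where
  "pair_class n p = (fst p < snd p, snd p < fst p, (fst p + snd p) mod n)"

text \<open>Modulo \<open>n\<close>, the sum and one index determine the other index, so two pairs
  with a common index in the same position are equal. A common index in opposite positions makes one
  pair the swap of the other; equal order flags then force both onto the diagonal, where they
  coincide.\<close>

lemma pair_class_disjoint:
  assumes "pair_class n (i, j) = pair_class n (i', j')" and ne: "(i, j) \<noteq> (i', j')"
    and "i \<in> {1..n}" "j \<in> {1..n}" "i' \<in> {1..n}" "j' \<in> {1..n}"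
  shows "i \<noteq> i'" "j \<noteq> j'" "i \<noteq> j'" "j \<noteq> i'"
proof -
  have m: "(i + j) mod n = (i' + j') mod n" and c: "i < j \<longleftrightarrow> i' < j'" "j < i \<longleftrightarrow> j' < i'"
    using assms(1) by (auto simp: pair_class_def)
  have u: "a = b" if "(k + a) mod n = (k + b) mod n" "a \<in> {1..n}" "b \<in> {1..n}" for a b k
    using mod_interval_unique that by blast
  show "i \<noteq> i'" using u[of i j j'] m ne assms by auto
  show "j \<noteq> j'" using u[of j i i'] m ne assms by (auto simp: add.commute)
  show "i \<noteq> j'"
  proof
    assume "i = j'"
    moreover from this have "j = i'" using u[of i j i'] m assms by (auto simp: add.commute)
    ultimately show False using c ne by auto
  qed
  show "j \<noteq> i'"
  proof
    assume "j = i'"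
    moreover from this have "i = j'" using u[of j i j'] m assms by (auto simp: add.commute)
    ultimately show False using c ne by auto
  qed
qed

context iid_sample
begin

abbreviation XS :: "nat \<Rightarrow> 'd sample \<Rightarrow> 'd labelled"
  where "XS i \<omega> \<equiv> fst \<omega> i"

abbreviation XT :: "nat \<times> nat \<Rightarrow> 'd sample \<Rightarrow> 'd labelled"
  where "XT p \<omega> \<equiv> snd \<omega> p"

section \<open>Deviation of averages over all pairs\<close>

definition at_pair ::
  "('d triple \<Rightarrow> 'b) \<Rightarrow> nat \<times> nat \<Rightarrow>
    'd sample \<Rightarrow> 'b" where
  "at_pair h p \<omega> = h (fst \<omega> (fst p), fst \<omega> (snd p), snd \<omega> p)"

abbreviation pairs :: "(nat \<times> nat) set" where "pairs \<equiv> {1..n} \<times> {1..n}"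

lemma X_Inl: "i \<in> {1..n} \<Longrightarrow> XS i \<in> borel_measurable \<Omega>" "i \<in> {1..n} \<Longrightarrow> distr \<Omega> borel (XS i) = D"
  and X_Inr: "p \<in> pairs \<Longrightarrow> XT p \<in> borel_measurable \<Omega>" "p \<in> pairs \<Longrightarrow> distr \<Omega> borel (XT p) = M"
proof -
  have e: "X (Inl i) = XS i" "X (Inr p) = XT p" "law (Inl i) = D" "law (Inr p) = M" for i p
    by (auto simp: X_def law_def)
  show "i \<in> {1..n} \<Longrightarrow> XS i \<in> borel_measurable \<Omega>" "i \<in> {1..n} \<Longrightarrow> distr \<Omega> borel (XS i) = D"
    using X_measurable[of "Inl i"] distr_X[of "Inl i"] unfolding e by (auto simp: idx_def)
  show "p \<in> pairs \<Longrightarrow> XT p \<in> borel_measurable \<Omega>" "p \<in> pairs \<Longrightarrow> distr \<Omega> borel (XT p) = M"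
    using X_measurable[of "Inr p"] distr_X[of "Inr p"] unfolding e by (auto simp: idx_def)
qed

lemma borel_triple:
  "(borel :: ('d triple) measure)
    = borel \<Otimes>\<^sub>M borel \<Otimes>\<^sub>M borel"
  by (simp add: borel_prod)

lemma at_pair_measurable:
  assumes h: "h \<in> borel \<rightarrow>\<^sub>M N" and p: "p \<in> pairs"
  shows "at_pair h p \<in> \<Omega> \<rightarrow>\<^sub>M N"
proof -
  have [measurable]: "XS (fst p) \<in> borel_measurable \<Omega>" "XS (snd p) \<in> borel_measurable \<Omega>" "XT p \<in> borel_measurable \<Omega>"
    using p X_Inl X_Inr by auto
  have "(\<lambda>\<omega>. (XS (fst p) \<omega>, XS (snd p) \<omega>, XT p \<omega>)) \<in> \<Omega> \<rightarrow>\<^sub>M borel"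
    unfolding borel_triple by measurable
  from measurable_compose[OF this h] show ?thesis by (simp add: at_pair_def[abs_def])
qed

lemma integral_XS:
  fixes f :: "'d labelled \<Rightarrow> real"
  assumes "f \<in> borel_measurable borel" "i \<in> {1..n}"
  shows "expectation (\<lambda>\<omega>. f (XS i \<omega>)) = (\<integral>x. f x \<partial>D)" "integrable \<Omega> (\<lambda>\<omega>. f (XS i \<omega>)) \<longleftrightarrow> integrable D f"
  using integral_distr[OF X_Inl(1) assms(1), OF assms(2)] integrable_distr_eq[OF X_Inl(1) assms(1), OF assms(2)]
    X_Inl(2)[OF assms(2)] by auto

lemma integral_XT:
  fixes f :: "'d labelled \<Rightarrow> real"
  assumes "f \<in> borel_measurable borel" "p \<in> pairs"
  shows "expectation (\<lambda>\<omega>. f (XT p \<omega>)) = (\<integral>x. f x \<partial>M)" "integrable \<Omega> (\<lambda>\<omega>. f (XT p \<omega>)) \<longleftrightarrow> integrable M f"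
  using integral_distr[OF X_Inr(1) assms(1), OF assms(2)] integrable_distr_eq[OF X_Inr(1) assms(1), OF assms(2)]
    X_Inr(2)[OF assms(2)] by auto

lemma AE_XS:
  assumes "AE x in D. P x" "i \<in> {1..n}"
  shows "AE \<omega> in \<Omega>. P (XS i \<omega>)"
  by (rule AE_distrD[OF X_Inl(1)[OF assms(2)], unfolded X_Inl(2)[OF assms(2)], OF assms(1)])

lemma AE_XT:
  assumes "AE x in M. P x" "p \<in> pairs"
  shows "AE \<omega> in \<Omega>. P (XT p \<omega>)"
  by (rule AE_distrD[OF X_Inr(1)[OF assms(2)], unfolded X_Inr(2)[OF assms(2)], OF assms(1)])

text \<open>The value at \<open>p\<close> reads only the coordinates in \<open>B p\<close>. Within
  one class these blocks are disjoint, and functions of disjoint blocks of an independent family are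
  independent.\<close>

lemma indep_block:
  assumes h: "h \<in> borel_measurable borel"
    and L: "L \<subseteq> pairs" "\<And>p q. p \<in> L \<Longrightarrow> q \<in> L \<Longrightarrow> pair_class n p = pair_class n q"
  shows "indep_vars (\<lambda>_. borel) (at_pair h) L"
proof -
  define B where "B p = {Inl (fst p), Inl (snd p), Inr p}" for p :: "nat \<times> nat"
  have dis: "disjoint_family_on B L"
    unfolding disjoint_family_on_def
  proof (intro ballI impI)
    fix p q assume pq: "p \<in> L" "q \<in> L" "p \<noteq> q"
    obtain i j i' j' where e: "p = (i, j)" "q = (i', j')" by (metis surj_pair)
    have "(i, j) \<in> pairs" "(i', j') \<in> pairs" "pair_class n (i, j) = pair_class n (i', j')" "(i, j) \<noteq> (i', j')"
      using pq L(1) L(2)[OF pq(1,2)] unfolding e by (blast, blast, simp_all)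
    then have "i \<noteq> i'" "j \<noteq> j'" "i \<noteq> j'" "j \<noteq> i'"
      using pair_class_disjoint by blast+
    then show "B p \<inter> B q = {}" using pq(3) by (auto simp: B_def e)
  qed
  have sub: "B p \<subseteq> idx" if "p \<in> L" for p using that L(1) by (auto simp: B_def idx_def)
  define Y where "Y p x = h (x (Inl (fst p)), x (Inl (snd p)), x (Inr p))" for p :: "nat \<times> nat" and x
  have "Y p \<in> borel_measurable (PiM (B p) (\<lambda>_. borel))" for p
  proof -
    have "(\<lambda>x :: nat + nat \<times> nat \<Rightarrow> 'd labelled. (x (Inl (fst p)), x (Inl (snd p)), x (Inr p))) \<in> PiM (B p) (\<lambda>_. borel) \<rightarrow>\<^sub>M borel"
      unfolding borel_triple by (intro measurable_Pair measurable_component_singleton) (auto simp: B_def)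
    from measurable_compose[OF this h] show ?thesis by (simp add: Y_def[abs_def])
  qed
  then have "indep_vars (\<lambda>_. borel) (\<lambda>p \<omega>. Y p (restrict (\<lambda>k. X k \<omega>) (B p))) L"
    by (intro indep_vars_compose2[OF indep_vars_restrict[OF indep_X sub dis]]) auto
  moreover have "(\<lambda>p \<omega>. Y p (restrict (\<lambda>k. X k \<omega>) (B p))) = at_pair h"
    by (auto simp: fun_eq_iff Y_def B_def at_pair_def X_def)
  ultimately show ?thesis by simp
qed

abbreviation fluct :: "('d triple \<Rightarrow> real) \<Rightarrow> 'd sample \<Rightarrow> real" where
  "fluct h \<omega> \<equiv> \<Sum>p\<in>pairs. at_pair h p \<omega> - expectation (at_pair h p)"

text \<open>If the total exceeds \<open>4 * n\<^sup>2 * t\<close>, one of the \<open>4 * n\<close>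
  classes exceeds \<open>n * t\<close>; a class has at most \<open>n\<close> pairs because the first
  index determines the pair. The constant \<open>exp (2 * K + 2) * K\<close> bounds the exponential
  moment of a centered summand: \<open>exp (2 * K + 1)\<close> comes from the centering and
  \<open>exp 1 * K\<close> from the majorant \<open>?u\<close>.\<close>

lemma deviation_bound:
  assumes h: "h \<in> borel_measurable borel"
    and bd: "\<And>p. p \<in> pairs \<Longrightarrow> AE \<omega> in \<Omega>. \<bar>at_pair h p \<omega>\<bar> \<le> norm (fst (XS (fst p) \<omega>)) + norm (fst (XS (snd p) \<omega>)) + 1"
    and int: "integrable D (\<lambda>x. exp (4 * norm (fst x)))" and K: "(\<integral>x. exp (4 * norm (fst x)) \<partial>D) \<le> K"
    and t: "0 < t" "t \<le> 8 * (exp (2 * K + 2) * K)" and n: "n \<noteq> 0"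
  shows "prob {\<omega> \<in> space \<Omega>. 4 * (real n)\<^sup>2 * t \<le> \<bar>fluct h \<omega>\<bar>}
    \<le> 8 * real n * exp (- (real n * t\<^sup>2 / (32 * (exp (2 * K + 2) * K))))"
proof -
  let ?K = "exp (2 * K + 2) * K"
  let ?u = "\<lambda>p \<omega>. norm (fst (XS (fst p) \<omega>)) + norm (fst (XS (snd p) \<omega>)) + 1"
  define Z where "Z p \<omega> = at_pair h p \<omega> - expectation (at_pair h p)" for p \<omega>
  have hm [measurable]: "at_pair h p \<in> borel_measurable \<Omega>" if "p \<in> pairs" for p
    by (rule at_pair_measurable[OF h that])
  have Sm [measurable]: "XS i \<in> borel_measurable \<Omega>" if "i \<in> {1..n}" for i by (rule X_Inl(1)[OF that])
  have fm [measurable]: "(\<lambda>x. norm (fst x)) \<in> borel_measurable (borel :: 'd labelled measure)" by measurable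
  have e4: "integrable \<Omega> (\<lambda>\<omega>. exp (4 * norm (fst (XS i \<omega>))))"
    "expectation (\<lambda>\<omega>. exp (4 * norm (fst (XS i \<omega>)))) \<le> K" if "i \<in> {1..n}" for i
    using integral_XS[of "\<lambda>x. exp (4 * norm (fst x))", OF _ that] int K by auto
  have le_exp: "y \<le> exp (4 * y)" if "0 \<le> y" for y :: real
    using exp_ge_add_one_self[of "4 * y"] that by linarith
  have n1: "integrable \<Omega> (\<lambda>\<omega>. norm (fst (XS i \<omega>)))" "expectation (\<lambda>\<omega>. norm (fst (XS i \<omega>))) \<le> K" if "i \<in> {1..n}" for i
  proof -
    show I: "integrable \<Omega> (\<lambda>\<omega>. norm (fst (XS i \<omega>)))"
      by (rule Bochner_Integration.integrable_bound[OF e4(1)[OF that]]) (use that le_exp in auto)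
    show "expectation (\<lambda>\<omega>. norm (fst (XS i \<omega>))) \<le> K"
      using integral_mono[OF I e4(1)[OF that]] le_exp e4(2)[OF that] by fastforce
  qed
  have u: "integrable \<Omega> (?u p)" "expectation (?u p) \<le> 2 * K + 1" if "p \<in> pairs" for p
    using that n1[of "fst p"] n1[of "snd p"] by (auto simp: prob_space)
  have eu: "integrable \<Omega> (\<lambda>\<omega>. exp (?u p \<omega>))" "expectation (\<lambda>\<omega>. exp (?u p \<omega>)) \<le> exp 1 * K" if p: "p \<in> pairs" for p
  proof -
    let ?v = "\<lambda>\<omega>. exp 1 * ((exp (4 * norm (fst (XS (fst p) \<omega>))) + exp (4 * norm (fst (XS (snd p) \<omega>)))) / 2)"
    have pp: "fst p \<in> {1..n}" "snd p \<in> {1..n}" using p by auto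
    \<comment> \<open>The arithmetic-geometric mean inequality separates the two points. It also
      covers \<open>fst p = snd p\<close>, where they are not independent.\<close>
    have le: "exp (a + b + 1) \<le> exp 1 * ((exp (4 * a) + exp (4 * b)) / 2)" if "0 \<le> a" "0 \<le> b" for a b :: real
    proof -
      have "exp a * exp b \<le> (exp (2 * a) + exp (2 * b)) / 2"
        using sum_squares_bound[of "exp a" "exp b"] by (simp add: exp_double[symmetric] mult.assoc)
      also have "\<dots> \<le> (exp (4 * a) + exp (4 * b)) / 2" using that by (intro divide_right_mono add_mono) auto
      finally show ?thesis by (simp add: exp_add mult.commute[of _ "exp 1"])
    qed
    have Iv: "integrable \<Omega> ?v" using e4(1)[OF pp(1)] e4(1)[OF pp(2)] by simp
    show I: "integrable \<Omega> (\<lambda>\<omega>. exp (?u p \<omega>))"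
    proof (rule Bochner_Integration.integrable_bound[OF Iv])
      show "(\<lambda>\<omega>. exp (?u p \<omega>)) \<in> borel_measurable \<Omega>"
        using borel_measurable_integrable[OF u(1)[OF p]] by measurable
      show "AE \<omega> in \<Omega>. norm (exp (?u p \<omega>)) \<le> norm (?v \<omega>)"
      proof (rule AE_I2)
        fix \<omega>
        have "exp (?u p \<omega>) \<le> ?v \<omega>" by (rule le) auto
        also have "\<dots> \<le> \<bar>?v \<omega>\<bar>" by (rule abs_ge_self)
        finally show "norm (exp (?u p \<omega>)) \<le> norm (?v \<omega>)" by (simp only: real_norm_def abs_exp_cancel)
      qed
    qed
    have "expectation (\<lambda>\<omega>. exp (?u p \<omega>)) \<le> expectation ?v"
    proof (rule integral_mono[OF I Iv])
      show "exp (?u p \<omega>) \<le> ?v \<omega>" for \<omega> by (rule le) auto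
    qed
    also have "\<dots> = exp 1 * ((expectation (\<lambda>\<omega>. exp (4 * norm (fst (XS (fst p) \<omega>)))) + expectation (\<lambda>\<omega>. exp (4 * norm (fst (XS (snd p) \<omega>))))) / 2)"
      using e4(1)[OF pp(1)] e4(1)[OF pp(2)] by simp
    also have "\<dots> \<le> exp 1 * K" using e4(2)[OF pp(1)] e4(2)[OF pp(2)] by (intro mult_left_mono) auto
    finally show "expectation (\<lambda>\<omega>. exp (?u p \<omega>)) \<le> exp 1 * K" .
  qed
  have Ih: "integrable \<Omega> (at_pair h p)" if "p \<in> pairs" for p
    by (rule Bochner_Integration.integrable_bound[OF u(1)[OF that] hm[OF that]]) (use bd[OF that] in auto)
  have Eh: "\<bar>expectation (at_pair h p)\<bar> \<le> 2 * K + 1" if "p \<in> pairs" for p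
  proof -
    have "\<bar>expectation (at_pair h p)\<bar> \<le> expectation (\<lambda>\<omega>. \<bar>at_pair h p \<omega>\<bar>)" by (rule integral_abs_bound)
    also have "\<dots> \<le> expectation (?u p)"
      by (rule integral_mono_AE) (use Ih[OF that] u(1)[OF that] bd[OF that] in auto)
    finally show ?thesis using u(2)[OF that] by linarith
  qed
  have Zm [measurable]: "Z p \<in> borel_measurable \<Omega>" if "p \<in> pairs" for p using hm[OF that] unfolding Z_def by measurable
  have bZ: "AE \<omega> in \<Omega>. exp \<bar>Z p \<omega>\<bar> \<le> exp (2 * K + 1) * exp (?u p \<omega>)" if "p \<in> pairs" for p
    using bd[OF that]
  proof eventually_elim
    case (elim \<omega>)
    then have "\<bar>Z p \<omega>\<bar> \<le> (2 * K + 1) + ?u p \<omega>" using Eh[OF that] unfolding Z_def by linarith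
    then show ?case unfolding exp_add[symmetric] by simp
  qed
  have IeZ: "integrable \<Omega> (\<lambda>\<omega>. exp \<bar>Z p \<omega>\<bar>)" if "p \<in> pairs" for p
    by (rule Bochner_Integration.integrable_bound[OF integrable_mult_right[OF eu(1)[OF that], of "exp (2 * K + 1)"]])
       (use bZ[OF that] Zm[OF that] in auto)
  have EeZ: "expectation (\<lambda>\<omega>. exp \<bar>Z p \<omega>\<bar>) \<le> ?K" if "p \<in> pairs" for p
  proof -
    have "expectation (\<lambda>\<omega>. exp \<bar>Z p \<omega>\<bar>) \<le> expectation (\<lambda>\<omega>. exp (2 * K + 1) * exp (?u p \<omega>))"
      by (rule integral_mono_AE) (use bZ[OF that] IeZ[OF that] eu(1)[OF that] in auto)
    also have "\<dots> \<le> exp (2 * K + 1) * (exp 1 * K)" using eu(2)[OF that] by simp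
    also have "\<dots> = ?K" by (simp add: exp_add[symmetric] mult.assoc[symmetric])
    finally show ?thesis .
  qed
  have Z0: "expectation (Z p) = 0" if "p \<in> pairs" for p
    using Ih[OF that] unfolding Z_def by (simp add: prob_space)
  \<comment> \<open>Two order flags and a residue. Classes with both flags true are empty but are
    counted all the same.\<close>
  let ?C = "UNIV \<times> UNIV \<times> {..<n} :: (bool \<times> bool \<times> nat) set"
  define L where "L c = {p \<in> pairs. pair_class n p = c}" for c
  have finL: "finite (L c)" for c by (simp add: L_def)
  have cardL: "card (L c) \<le> n" for c
  proof -
    have "inj_on fst (L c)"
    proof (rule inj_onI)
      fix p q assume pq: "p \<in> L c" "q \<in> L c" "fst p = fst q"
      obtain i j i' j' where e: "p = (i, j)" "q = (i', j')" by (metis surj_pair)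
      show "p = q"
      proof (rule ccontr)
        assume "p \<noteq> q"
        then have "i \<noteq> i'" by (intro pair_class_disjoint(1)[of n i j i' j']) (use pq e in \<open>auto simp: L_def\<close>)
        then show False using pq(3) e by simp
      qed
    qed
    then have "card (L c) = card (fst ` L c)" by (simp add: card_image)
    also have "\<dots> \<le> card {1..n}" by (rule card_mono) (auto simp: L_def)
    finally show ?thesis by simp
  qed
  have tail: "prob {\<omega> \<in> space \<Omega>. real n * t \<le> \<bar>\<Sum>p\<in>L c. Z p \<omega>\<bar>} \<le> 2 * exp (- (real n * t\<^sup>2 / (32 * ?K)))" for c
  proof (rule subexponential_tail[OF finL _ _ _ _ _ t])
    have "indep_vars (\<lambda>_. borel) (at_pair h) (L c)" by (rule indep_block[OF h]) (auto simp: L_def)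
    from indep_vars_compose2[OF this, of "\<lambda>p z. z - expectation (at_pair h p)" "\<lambda>_. borel"]
    show "indep_vars (\<lambda>_. borel) Z (L c)" by (simp add: Z_def[abs_def])
  qed (use cardL IeZ EeZ Z0 in \<open>auto simp: L_def\<close>)
  have split: "(\<Sum>p\<in>pairs. Z p \<omega>) = (\<Sum>c\<in>?C. \<Sum>p\<in>L c. Z p \<omega>)" for \<omega>
    unfolding L_def by (rule sum.group[symmetric]) (auto simp: pair_class_def)
  have cC: "card ?C = 4 * n" by (simp add: card_cartesian_product)
  have "{\<omega> \<in> space \<Omega>. 4 * (real n)\<^sup>2 * t \<le> \<bar>\<Sum>p\<in>pairs. Z p \<omega>\<bar>}
    \<subseteq> (\<Union>c\<in>?C. {\<omega> \<in> space \<Omega>. real n * t \<le> \<bar>\<Sum>p\<in>L c. Z p \<omega>\<bar>})"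
  proof safe
      fix \<omega> assume w: "\<omega> \<in> space \<Omega>" "4 * (real n)\<^sup>2 * t \<le> \<bar>\<Sum>p\<in>pairs. Z p \<omega>\<bar>"
      show "\<omega> \<in> (\<Union>c\<in>?C. {\<omega> \<in> space \<Omega>. real n * t \<le> \<bar>\<Sum>p\<in>L c. Z p \<omega>\<bar>})"
      proof (rule ccontr)
        assume "\<not> ?thesis"
        then have lt: "\<bar>\<Sum>p\<in>L c. Z p \<omega>\<bar> < real n * t" if "c \<in> ?C" for c using that w(1) by (auto simp: not_le)
        have "\<bar>\<Sum>p\<in>pairs. Z p \<omega>\<bar> \<le> (\<Sum>c\<in>?C. \<bar>\<Sum>p\<in>L c. Z p \<omega>\<bar>)" unfolding split by (rule sum_abs)
        also have "\<dots> < (\<Sum>c\<in>?C. real n * t)" by (rule sum_strict_mono) (use lt n in auto)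
        also have "\<dots> = 4 * (real n)\<^sup>2 * t" unfolding sum_constant cC by (simp add: power2_eq_square)
        finally show False using w(2) by simp
      qed
  qed
  then have "prob {\<omega> \<in> space \<Omega>. 4 * (real n)\<^sup>2 * t \<le> \<bar>\<Sum>p\<in>pairs. Z p \<omega>\<bar>}
    \<le> prob (\<Union>c\<in>?C. {\<omega> \<in> space \<Omega>. real n * t \<le> \<bar>\<Sum>p\<in>L c. Z p \<omega>\<bar>})"
    by (rule finite_measure_mono) (auto intro!: sets.finite_UN measurable_sets simp: L_def Zm)
  also have "\<dots> \<le> (\<Sum>c\<in>?C. prob {\<omega> \<in> space \<Omega>. real n * t \<le> \<bar>\<Sum>p\<in>L c. Z p \<omega>\<bar>})"
    by (rule finite_measure_subadditive_finite) (auto simp: L_def Zm)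
  also have "\<dots> \<le> (\<Sum>c\<in>?C. 2 * exp (- (real n * t\<^sup>2 / (32 * ?K))))" by (rule sum_mono[OF tail])
  also have "\<dots> = 8 * real n * exp (- (real n * t\<^sup>2 / (32 * ?K)))" unfolding sum_constant cC by simp
  finally show ?thesis unfolding Z_def .
qed

end

section \<open>The loss of a single mixed pair\<close>

definition mix_x :: "'d triple \<Rightarrow> real ^ 'd" where
  "mix_x z = (case z of (p, q, t) \<Rightarrow> fst t * fst p + (1 - fst t) * fst q)"

definition mix_y :: "'d triple \<Rightarrow> real" where
  "mix_y z = (case z of (p, q, t) \<Rightarrow> snd t * snd p + (1 - snd t) * snd q)"

definition pair_loss :: "real ^ 'd \<Rightarrow> 'd triple \<Rightarrow> real" where
  "pair_loss w z = logistic_loss (w \<bullet> mix_x z) + (1 - mix_y z) * (w \<bullet> mix_x z)"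

text \<open>The gradient of \<open>pair_loss\<close> in \<open>w\<close>. It acts only through the
  one-sided bounds that follow, which carry over to averages and expectations.\<close>

definition pair_grad :: "real ^ 'd \<Rightarrow> 'd triple \<Rightarrow> real ^ 'd" where
  "pair_grad w z = (sigmoid (w \<bullet> mix_x z) - mix_y z) *\<^sub>R mix_x z"

lemma pair_loss_eq:
  "pair_loss w z = mix_y z * logistic_loss (w \<bullet> mix_x z) + (1 - mix_y z) * logistic_loss (- (w \<bullet> mix_x z))"
  by (simp add: pair_loss_def logistic_loss_uminus algebra_simps)

lemma continuous_on_logistic_loss: "continuous_on S logistic_loss"
  by (intro DERIV_continuous_on) (use logistic_loss_deriv has_field_derivative_at_within in blast)

lemma continuous_on_sigmoid: "continuous_on S sigmoid"
  by (intro DERIV_continuous_on) (use sigmoid_deriv has_field_derivative_at_within in blast)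

lemma continuous_on_mix_x: "continuous_on UNIV mix_x"
proof -
  have eq: "mix_x = (\<lambda>z. \<chi> k. fst (snd (snd z)) $ k * fst (fst z) $ k + (1 - fst (snd (snd z)) $ k) * fst (fst (snd z)) $ k)"
    by (auto simp: fun_eq_iff vec_eq_iff mix_x_def)
  show ?thesis by (subst eq) (intro continuous_intros)
qed

lemma continuous_on_mix_y: "continuous_on UNIV mix_y"
  unfolding mix_y_def case_prod_unfold by (intro continuous_intros)

lemma mix_x_measurable [measurable]: "mix_x \<in> borel_measurable borel"
  and mix_y_measurable [measurable]: "mix_y \<in> borel_measurable borel"
  and logistic_loss_measurable [measurable]: "logistic_loss \<in> borel_measurable borel"
  and sigmoid_measurable [measurable]: "sigmoid \<in> borel_measurable borel"
  by (intro borel_measurable_continuous_onI continuous_on_mix_x continuous_on_mix_y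
      continuous_on_logistic_loss continuous_on_sigmoid)+

lemma pair_loss_measurable [measurable]: "pair_loss w \<in> borel_measurable borel"
  and pair_grad_measurable [measurable]: "pair_grad w \<in> borel_measurable borel"
  unfolding pair_loss_def[abs_def] pair_grad_def[abs_def] by measurable

lemma pair_loss_subgradient: "pair_loss w z + pair_grad w z \<bullet> u \<le> pair_loss (w + u) z"
  using logistic_loss_tangent[of "w \<bullet> mix_x z" "(w + u) \<bullet> mix_x z"]
  by (simp add: pair_loss_def pair_grad_def inner_add_left inner_commute[of "mix_x z"] algebra_simps)

lemma pair_loss_quadratic_upper:
  "pair_loss (w + u) z \<le> pair_loss w z + pair_grad w z \<bullet> u + (norm (mix_x z))\<^sup>2 * (norm u)\<^sup>2"
proof -
  have "(u \<bullet> mix_x z)\<^sup>2 \<le> (norm u)\<^sup>2 * (norm (mix_x z))\<^sup>2"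
    using Cauchy_Schwarz_ineq[of u "mix_x z"] by (simp add: power2_norm_eq_inner)
  then show ?thesis
    using logistic_loss_quadratic_upper[of "(w + u) \<bullet> mix_x z" "w \<bullet> mix_x z"]
    by (simp add: pair_loss_def pair_grad_def inner_add_left inner_commute[of "mix_x z"] algebra_simps)
qed

text \<open>The scalar bound applies because all inner products that occur stay within
  \<open>R * B\<close>; the lower bound \<open>a\<close> on the component along \<open>u\<close>
  turns scalar curvature into curvature in direction \<open>u\<close>.\<close>

lemma pair_loss_strongly_convex:
  assumes "norm w \<le> R" "norm (w + u) \<le> R" "norm (mix_x z) \<le> B" "a * norm u \<le> \<bar>mix_x z \<bullet> u\<bar>" "0 \<le> a"
  shows "pair_loss w z + pair_grad w z \<bullet> u + exp (- (R * B)) / 8 * a\<^sup>2 * (norm u)\<^sup>2 \<le> pair_loss (w + u) z"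
proof -
  have R: "\<bar>v \<bullet> mix_x z\<bar> \<le> R * B" if "norm v \<le> R" for v
    using Cauchy_Schwarz_ineq2[of v "mix_x z"] mult_mono[OF that assms(3) order_trans[OF norm_ge_zero that] norm_ge_zero]
    by linarith
  have "(a * norm u)\<^sup>2 \<le> \<bar>mix_x z \<bullet> u\<bar>\<^sup>2"
    by (rule power_mono) (use assms in auto)
  then have "exp (- (R * B)) / 8 * a\<^sup>2 * (norm u)\<^sup>2 \<le> exp (- (R * B)) / 8 * ((w + u) \<bullet> mix_x z - w \<bullet> mix_x z)\<^sup>2"
    unfolding mult.assoc by (intro mult_left_mono) (auto simp: power_mult_distrib inner_add_left inner_commute[of u])
  moreover have "(sigmoid (w \<bullet> mix_x z) - 1) * ((w + u) \<bullet> mix_x z - w \<bullet> mix_x z) + (1 - mix_y z) * (u \<bullet> mix_x z)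
      = pair_grad w z \<bullet> u"
    by (simp add: pair_grad_def inner_add_left inner_commute[of "mix_x z"] algebra_simps)
  ultimately show ?thesis
    using logistic_loss_strongly_convex[OF R[OF assms(1)] R[OF assms(2)]]
    unfolding pair_loss_def inner_add_left[of w u] distrib_left[of "1 - mix_y z"] by linarith
qed

lemma pair_loss_nonneg:
  assumes "mix_y z \<in> {0..1}"
  shows "0 \<le> pair_loss w z"
  unfolding pair_loss_eq using assms logistic_loss_nonneg by auto

text \<open>Both labels carry weight at least \<open>\<tau>\<close>, and the logistic losses of a
  number and of its negative sum to at least its absolute value.\<close>

lemma pair_loss_coercive:
  assumes "mix_y z \<in> {\<tau>..1 - \<tau>}" "0 \<le> \<tau>"
  shows "\<tau> * \<bar>w \<bullet> mix_x z\<bar> \<le> pair_loss w z"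
proof -
  let ?a = "w \<bullet> mix_x z"
  have nn: "0 \<le> logistic_loss ?a" "0 \<le> logistic_loss (- ?a)" using logistic_loss_nonneg by auto
  have "\<tau> * \<bar>?a\<bar> \<le> \<tau> * (logistic_loss ?a + logistic_loss (- ?a))"
    using logistic_loss_ge_uminus[of ?a] logistic_loss_ge_uminus[of "- ?a"] nn assms(2)
    by (intro mult_left_mono) auto
  also have "\<dots> \<le> mix_y z * logistic_loss ?a + (1 - mix_y z) * logistic_loss (- ?a)"
    unfolding distrib_left using assms nn by (intro add_mono mult_right_mono) auto
  finally show ?thesis unfolding pair_loss_eq .
qed

lemma norm_mask_mult_le:
  fixes m x :: "real ^ 'd"
  assumes "\<And>k. m $ k \<in> {0, 1}"
  shows "norm (m * x) \<le> norm x" "norm ((1 - m) * x) \<le> norm x" "norm (x * (2 *\<^sub>R m - 1)) \<le> norm x"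
proof -
  have m: "m $ k = 0 \<or> m $ k = 1" for k using assms[of k] by simp
  show "norm (m * x) \<le> norm x"
    by (rule norm_le_componentwise_cart, cut_tac k = i in m) auto
  show "norm ((1 - m) * x) \<le> norm x"
    by (rule norm_le_componentwise_cart, cut_tac k = i in m) auto
  show "norm (x * (2 *\<^sub>R m - 1)) \<le> norm x"
    by (rule norm_le_componentwise_cart, cut_tac k = i in m) auto
qed

lemma mix_x_norm_le:
  assumes "\<And>k. fst t $ k \<in> {0, 1}"
  shows "norm (mix_x (p, q, t)) \<le> norm (fst p) + norm (fst q)"
  unfolding mix_x_def prod.case
  by (rule order_trans[OF norm_triangle_ineq add_mono[OF norm_mask_mult_le(1,2)]]) (use assms in auto)

lemma mix_y_range:
  assumes "snd p \<in> {0, 1}" "snd q \<in> {0, 1}" "snd t \<in> {0..1}"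
  shows "mix_y (p, q, t) \<in> {0..1}"
  using assms by (auto simp: mix_y_def)

lemma norm_pair_grad_le:
  assumes "mix_y z \<in> {0..1}"
  shows "norm (pair_grad w z) \<le> norm (mix_x z)"
proof -
  have "\<bar>sigmoid (w \<bullet> mix_x z) - mix_y z\<bar> \<le> 1"
    using assms sigmoid_pos[of "w \<bullet> mix_x z"] sigmoid_less_1[of "w \<bullet> mix_x z"] by auto
  then show ?thesis by (simp add: pair_grad_def mult_left_le_one_le)
qed

text \<open>Good pairs carry all the curvature and coercivity of the loss: their mixed point is close to the noiseless
  direction \<open>\<mu> * (2 *\<^sub>R m - 1)\<close>.\<close>

definition good :: "real ^ 'd \<Rightarrow> real \<Rightarrow> real \<Rightarrow> real ^ 'd \<Rightarrow> 'd triple \<Rightarrow> bool" where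
  "good \<mu> c \<tau> m z = (case z of (p, q, t) \<Rightarrow>
     (snd p = 1 \<and> norm (fst p - \<mu>) \<le> c / 4) \<and> (snd q = 0 \<and> norm (fst q + \<mu>) \<le> c / 4) \<and>
     (fst t = m \<and> snd t \<in> {\<tau>..1 - \<tau>}))"

text \<open>A good pair has labels \<open>1\<close> and \<open>0\<close>, so its mixed label is the
  mixing weight. Each of the two points contributes an error of at most \<open>c / 4\<close>; the
  total \<open>c / 2\<close> uses up half of the directional bound \<open>c\<close> and leaves the
  other half.\<close>

lemma good_mix:
  assumes "good \<mu> c \<tau> m z" and m: "\<And>k. m $ k \<in> {0, 1}" and "0 < c" and u: "c * norm u \<le> \<bar>(\<mu> * (2 *\<^sub>R m - 1)) \<bullet> u\<bar>"
  shows "mix_y z \<in> {\<tau>..1 - \<tau>}" "norm (mix_x z) \<le> norm \<mu> + c" "c / 2 * norm u \<le> \<bar>mix_x z \<bullet> u\<bar>"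
proof -
  obtain p q t where z: "z = (p, q, t)" by (cases z)
  have g: "snd p = 1" "norm (fst p - \<mu>) \<le> c / 4" "snd q = 0" "norm (fst q + \<mu>) \<le> c / 4" "fst t = m" "snd t \<in> {\<tau>..1 - \<tau>}"
    using assms(1) by (auto simp: good_def z)
  show "mix_y z \<in> {\<tau>..1 - \<tau>}" using g by (simp add: mix_y_def z)
  let ?v = "\<mu> * (2 *\<^sub>R m - 1)"
  have "mix_x z - ?v = m * (fst p - \<mu>) + (1 - m) * (fst q + \<mu>)"
    using g(5) by (simp add: mix_x_def z vec_eq_iff algebra_simps)
  also have "norm \<dots> \<le> norm (fst p - \<mu>) + norm (fst q + \<mu>)"
    by (rule order_trans[OF norm_triangle_ineq add_mono]) (use norm_mask_mult_le[OF m] in auto)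
  finally have d: "norm (mix_x z - ?v) \<le> c / 2" using g(2,4) by linarith
  then show "norm (mix_x z) \<le> norm \<mu> + c"
    using norm_mask_mult_le(3)[OF m, of \<mu>] norm_triangle_sub[of "mix_x z" ?v] \<open>0 < c\<close> by linarith
  have "\<bar>(mix_x z - ?v) \<bullet> u\<bar> \<le> c / 2 * norm u"
    using Cauchy_Schwarz_ineq2[of "mix_x z - ?v" u] mult_right_mono[OF d norm_ge_zero[of u]] by linarith
  then show "c / 2 * norm u \<le> \<bar>mix_x z \<bullet> u\<bar>"
    using u unfolding inner_diff_left by (simp add: abs_if split: if_splits)
qed

text \<open>With class signs \<open>s\<close> and \<open>s'\<close>, two points of one class
  contribute \<open>(norm \<mu>)\<^sup>2\<close> whatever the mask, and opposite classes at least
  \<open>- a * (norm \<mu>)\<^sup>2\<close>. The bracket interpolates both values linearly in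
  \<open>s * s'\<close>, a product with mean zero for independent points; the part
  \<open>(1 - a) / 2\<close> then remains.\<close>

lemma mean_alignment:
  fixes \<mu> :: "real ^ 'd"
  assumes "snd p \<in> {0, 1}" "snd q \<in> {0, 1}" "snd t \<in> {0..1}" and m: "\<And>k. fst t $ k \<in> {0, 1}"
  defines "a \<equiv> \<bar>2 * snd t - 1\<bar>"
  shows "(norm \<mu>)\<^sup>2 * ((1 - a) / 2 + (2 * snd p - 1) * (2 * snd q - 1) * (1 + a) / 2)
    - norm \<mu> * (norm (fst p - (2 * snd p - 1) *\<^sub>R \<mu>) + norm (fst q - (2 * snd q - 1) *\<^sub>R \<mu>))
    \<le> (2 * mix_y (p, q, t) - 1) * (mix_x (p, q, t) \<bullet> \<mu>)"
proof -
  define s s' where "s = 2 * snd p - 1" and "s' = 2 * snd q - 1"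
  define \<xi> \<xi>' where "\<xi> = fst p - s *\<^sub>R \<mu>" and "\<xi>' = fst q - s' *\<^sub>R \<mu>"
  have ss: "s = 1 \<or> s = - 1" "s' = 1 \<or> s' = - 1" using assms(1,2) by (auto simp: s_def s'_def)
  define b where "b = snd t * s + (1 - snd t) * s'"
  have y: "2 * mix_y (p, q, t) - 1 = b" by (simp add: mix_y_def b_def s_def s'_def algebra_simps)
  have b1: "\<bar>b\<bar> \<le> 1" using ss assms(3) by (auto simp: b_def)
  define e where "e = fst t * \<xi> + (1 - fst t) * \<xi>'"
  define v where "v = fst t * (s *\<^sub>R \<mu>) + (1 - fst t) * (s' *\<^sub>R \<mu>)"
  have x: "mix_x (p, q, t) = v + e"
    by (simp add: mix_x_def v_def e_def \<xi>_def \<xi>'_def vec_eq_iff algebra_simps)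
  have "norm e \<le> norm \<xi> + norm \<xi>'" unfolding e_def
    by (rule order_trans[OF norm_triangle_ineq add_mono]) (use norm_mask_mult_le[OF m] in auto)
  then have "\<bar>e \<bullet> \<mu>\<bar> \<le> (norm \<xi> + norm \<xi>') * norm \<mu>"
    using Cauchy_Schwarz_ineq2[of e \<mu>] mult_right_mono[of "norm e" _ "norm \<mu>"] by fastforce
  moreover have "\<bar>b * (e \<bullet> \<mu>)\<bar> \<le> \<bar>e \<bullet> \<mu>\<bar>" using b1 by (simp add: abs_mult mult_left_le_one_le)
  ultimately have E: "- (norm \<mu> * (norm \<xi> + norm \<xi>')) \<le> b * (e \<bullet> \<mu>)" by (simp add: mult.commute)
  have V: "(norm \<mu>)\<^sup>2 * ((1 - a) / 2 + s * s' * (1 + a) / 2) \<le> b * (v \<bullet> \<mu>)"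
  proof (cases "s = s'")
    case True
    have "v = s *\<^sub>R \<mu>" using True by (simp add: v_def vec_eq_iff algebra_simps)
    moreover have "b = s" using True by (simp add: b_def algebra_simps)
    moreover have "s * s = 1" using ss by auto
    ultimately show ?thesis using True by (simp add: power2_norm_eq_inner add_divide_distrib[symmetric] mult.assoc[symmetric])
  next
    case False
    then have s': "s' = - s" using ss by auto
    have sq: "s * s = 1" using ss by auto
    have vv: "v = s *\<^sub>R (\<mu> * (2 *\<^sub>R fst t - 1))" by (simp add: v_def s' vec_eq_iff algebra_simps)
    have bb: "b = s * (2 * snd t - 1)" by (simp add: b_def s' algebra_simps)
    have "\<bar>(\<mu> * (2 *\<^sub>R fst t - 1)) \<bullet> \<mu>\<bar> \<le> norm \<mu> * norm \<mu>"
      using Cauchy_Schwarz_ineq2[of "\<mu> * (2 *\<^sub>R fst t - 1)" \<mu>] norm_mask_mult_le(3)[OF m, of \<mu>]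
      by (meson mult_right_mono norm_ge_zero order_trans)
    then have "\<bar>(2 * snd t - 1) * ((\<mu> * (2 *\<^sub>R fst t - 1)) \<bullet> \<mu>)\<bar> \<le> a * (norm \<mu>)\<^sup>2"
      by (simp add: abs_mult a_def mult_left_mono power2_eq_square)
    moreover have "b * (v \<bullet> \<mu>) = (s * s) * ((2 * snd t - 1) * ((\<mu> * (2 *\<^sub>R fst t - 1)) \<bullet> \<mu>))"
      by (simp add: vv bb)
    moreover have "(norm \<mu>)\<^sup>2 * ((1 - a) / 2 + s * s' * (1 + a) / 2) = - (a * (norm \<mu>)\<^sup>2)"
      using sq by (simp add: s' field_simps)
    ultimately show ?thesis using sq by simp
  qed
  show ?thesis
    using E V unfolding y x inner_add_left distrib_left[of b] \<xi>_def \<xi>'_def s_def s'_def by linarith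
qed

lemma convex_on_subgradient:
  fixes f :: "'a::real_inner \<Rightarrow> real"
  assumes "\<And>w u. f w + G w \<bullet> u \<le> f (w + u)"
  shows "convex_on UNIV f"
proof (rule convex_onI)
  fix t :: real and x y :: 'a assume t: "0 < t" "t < 1"
  define w where "w = (1 - t) *\<^sub>R x + t *\<^sub>R y"
  have 1: "f w + G w \<bullet> (x - w) \<le> f x" "f w + G w \<bullet> (y - w) \<le> f y"
    using assms[of w "x - w"] assms[of w "y - w"] by simp_all
  have "(1 - t) * (f w + G w \<bullet> (x - w)) + t * (f w + G w \<bullet> (y - w)) \<le> (1 - t) * f x + t * f y"
    using t 1 by (intro add_mono mult_left_mono) auto
  moreover have "(1 - t) * (f w + G w \<bullet> (x - w)) + t * (f w + G w \<bullet> (y - w))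
    = f w + G w \<bullet> ((1 - t) *\<^sub>R (x - w) + t *\<^sub>R (y - w))"
    by (simp add: inner_add_right algebra_simps)
  moreover have "(1 - t) *\<^sub>R (x - w) + t *\<^sub>R (y - w) = 0" by (simp add: w_def algebra_simps)
  ultimately show "f ((1 - t) *\<^sub>R x + t *\<^sub>R y) \<le> (1 - t) * f x + t * f y" by (simp add: w_def)
qed simp

section \<open>Empirical and expected loss\<close>

lemma square_le_exp4: "2 * s\<^sup>2 \<le> exp (4 * s)" "s \<le> exp (4 * s)" if "0 \<le> s" for s :: real
proof -
  have "1 + 4 * s + (4 * s)\<^sup>2 / 2 \<le> exp (4 * s)" using exp_lower_Taylor_quadratic[of "4 * s"] that by simp
  then have "1 + 4 * s + 8 * s\<^sup>2 \<le> exp (4 * s)" by (simp add: power_mult_distrib)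
  moreover have "0 \<le> s\<^sup>2" by simp
  ultimately show "2 * s\<^sup>2 \<le> exp (4 * s)" "s \<le> exp (4 * s)" using that by linarith+
qed

text \<open>Gathers the constants on which the result may depend. In the noise bound,
  \<open>c / 16\<close> makes points near their class center frequent, and
  \<open>norm \<mu> * \<tau> * q / 4\<close> keeps noise from spoiling the drift along
  \<open>\<mu>\<close> at the origin.\<close>

locale mixup = iid_sample D M n
  for D M :: "('d::finite) labelled measure" and n :: nat +
  fixes \<mu> :: "real ^ 'd" and V :: "(real ^ 'd) set" and \<tau> q c K :: real
  assumes n2: "2 \<le> n" and mu: "\<mu> \<noteq> 0"
    and y01: "AE p in D. snd p \<in> {0, 1}"
    and y_half: "measure D {p. snd p = 1} = 1 / 2"
    and exp_int: "integrable D (\<lambda>p. exp (4 * norm (fst p)))"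
    and exp_le: "(\<integral>p. exp (4 * norm (fst p)) \<partial>D) \<le> K"
    and noise: "(\<integral>p. norm (fst p - (2 * snd p - 1) *\<^sub>R \<mu>) \<partial>D) \<le> min (c / 16) (norm \<mu> * \<tau> * q / 4)"
    and mask01: "AE t in M. (\<forall>k. fst t $ k \<in> {0, 1}) \<and> snd t \<in> {0..1}"
    and V: "finite V" "V \<noteq> {}" "\<And>m k. m \<in> V \<Longrightarrow> m $ k \<in> {0, 1}"
    and \<tau>: "0 < \<tau>" and q: "0 < q" and c: "0 < c"
    and VM: "\<And>m. m \<in> V \<Longrightarrow> q \<le> measure M {t. fst t = m \<and> snd t \<in> {\<tau>..1 - \<tau>}}"
    and Vc: "\<And>u. u \<noteq> 0 \<Longrightarrow> \<exists>m\<in>V. c * norm u \<le> \<bar>(\<mu> * (2 *\<^sub>R m - 1)) \<bullet> u\<bar>"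
begin

abbreviation npairs :: real where "npairs \<equiv> (real n)\<^sup>2"

lemma npairs_pos: "0 < npairs" using n2 by simp

lemma card_pairs: "real (card pairs) = npairs"
  by (simp add: card_cartesian_product power2_eq_square)

text \<open>Integrable majorant of both the norm of the mixed point and its square, with mean at
  most \<open>2 * K\<close>.\<close>

definition maj :: "nat \<times> nat \<Rightarrow> 'd sample \<Rightarrow> real" where
  "maj p \<omega> = exp (4 * norm (fst (XS (fst p) \<omega>))) + exp (4 * norm (fst (XS (snd p) \<omega>)))"

lemma maj_integrable: "p \<in> pairs \<Longrightarrow> integrable \<Omega> (maj p)"
  and maj_expectation: "p \<in> pairs \<Longrightarrow> expectation (maj p) \<le> 2 * K"
proof -
  have e: "integrable \<Omega> (\<lambda>\<omega>. exp (4 * norm (fst (XS i \<omega>))))"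
    "expectation (\<lambda>\<omega>. exp (4 * norm (fst (XS i \<omega>)))) \<le> K" if "i \<in> {1..n}" for i
    using integral_XS[of "\<lambda>x. exp (4 * norm (fst x))", OF _ that] exp_int exp_le by auto
  show "integrable \<Omega> (maj p)" if "p \<in> pairs" for p
    using that e(1)[of "fst p"] e(1)[of "snd p"] unfolding maj_def[abs_def] by auto
  show "expectation (maj p) \<le> 2 * K" if "p \<in> pairs" for p
    using that e(1)[of "fst p"] e(1)[of "snd p"] e(2)[of "fst p"] e(2)[of "snd p"] unfolding maj_def[abs_def] by auto
qed

lemma K_pos: "0 < K"
proof -
  have "(\<integral>p. 1 \<partial>D) \<le> (\<integral>p. exp (4 * norm (fst p)) \<partial>D)"
    by (rule integral_mono[OF _ exp_int]) auto
  then have "0 < (\<integral>p. exp (4 * norm (fst p)) \<partial>D)" by (simp add: D.prob_space)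
  then show ?thesis using exp_le by simp
qed

text \<open>The ranges of labels, masks and weights hold only almost surely; pointwise bounds are
  proved under this predicate and transferred by \<open>AE_typical\<close>.\<close>

definition typical :: "'d triple \<Rightarrow> bool" where
  "typical z = (case z of (p, p', t) \<Rightarrow> snd p \<in> {0, 1} \<and> snd p' \<in> {0, 1} \<and> (\<forall>k. fst t $ k \<in> {0, 1}) \<and> snd t \<in> {0..1})"

lemma AE_typical:
  assumes "p \<in> pairs"
  shows "AE \<omega> in \<Omega>. at_pair typical p \<omega>"
proof -
  have "AE \<omega> in \<Omega>. snd (XS (fst p) \<omega>) \<in> {0, 1}" "AE \<omega> in \<Omega>. snd (XS (snd p) \<omega>) \<in> {0, 1}"
    using AE_XS[OF y01, of "fst p"] AE_XS[OF y01, of "snd p"] assms by auto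
  moreover have "AE \<omega> in \<Omega>. (\<forall>k. fst (XT p \<omega>) $ k \<in> {0, 1}) \<and> snd (XT p \<omega>) \<in> {0..1}"
    using AE_XT[OF mask01 assms] .
  ultimately show ?thesis
    by eventually_elim (simp add: at_pair_def typical_def)
qed

lemma typical_bounds:
  assumes "at_pair typical p \<omega>"
  shows "norm (at_pair mix_x p \<omega>) \<le> norm (fst (XS (fst p) \<omega>)) + norm (fst (XS (snd p) \<omega>))"
    "at_pair mix_y p \<omega> \<in> {0..1}" "norm (at_pair mix_x p \<omega>) \<le> maj p \<omega>" "(norm (at_pair mix_x p \<omega>))\<^sup>2 \<le> maj p \<omega>"
proof -
  have t: "snd (XS (fst p) \<omega>) \<in> {0, 1}" "snd (XS (snd p) \<omega>) \<in> {0, 1}" "\<And>k. fst (XT p \<omega>) $ k \<in> {0, 1}" "snd (XT p \<omega>) \<in> {0..1}"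
    using assms by (auto simp: at_pair_def typical_def)
  show le: "norm (at_pair mix_x p \<omega>) \<le> norm (fst (XS (fst p) \<omega>)) + norm (fst (XS (snd p) \<omega>))"
    unfolding at_pair_def by (rule mix_x_norm_le[OF t(3)])
  show "at_pair mix_y p \<omega> \<in> {0..1}" unfolding at_pair_def by (rule mix_y_range[OF t(1,2,4)])
  let ?a = "norm (fst (XS (fst p) \<omega>))" and ?b = "norm (fst (XS (snd p) \<omega>))"
  show "norm (at_pair mix_x p \<omega>) \<le> maj p \<omega>"
    using le square_le_exp4(2)[of ?a] square_le_exp4(2)[of ?b] unfolding maj_def by simp
  have "(norm (at_pair mix_x p \<omega>))\<^sup>2 \<le> (?a + ?b)\<^sup>2" by (rule power_mono[OF le]) simp
  also have "\<dots> \<le> 2 * ?a\<^sup>2 + 2 * ?b\<^sup>2" using sum_squares_bound[of ?a ?b] by (simp add: power2_sum)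
  also have "\<dots> \<le> maj p \<omega>" unfolding maj_def
    by (intro add_mono square_le_exp4(1)) auto
  finally show "(norm (at_pair mix_x p \<omega>))\<^sup>2 \<le> maj p \<omega>" .
qed

lemma integrable_at_pair:
  fixes h :: "'d triple \<Rightarrow> 'b::{banach, second_countable_topology}"
  assumes h: "h \<in> borel_measurable borel" and p: "p \<in> pairs"
    and bd: "\<And>\<omega>. at_pair typical p \<omega> \<Longrightarrow> norm (at_pair h p \<omega>) \<le> A * maj p \<omega> + B"
  shows "integrable \<Omega> (at_pair h p)"
proof (rule Bochner_Integration.integrable_bound)
  show "integrable \<Omega> (\<lambda>\<omega>. A * maj p \<omega> + B)" using maj_integrable[OF p] by simp
  show "at_pair h p \<in> borel_measurable \<Omega>" by (rule at_pair_measurable[OF h p])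
  show "AE \<omega> in \<Omega>. norm (at_pair h p \<omega>) \<le> norm (A * maj p \<omega> + B)"
    using AE_typical[OF p] by eventually_elim (use bd in fastforce)
qed

definition L ::
  "'d sample \<Rightarrow> real ^ 'd \<Rightarrow> real"
  where "L \<omega> w = mask_loss n (fst \<omega>) (snd \<omega>) w"
definition Gr where "Gr w \<omega> = (\<Sum>p\<in>pairs. at_pair (pair_grad w) p \<omega>) /\<^sub>R npairs"
abbreviation hit :: "real ^ 'd \<Rightarrow> 'd triple \<Rightarrow> real" where
  "hit m \<equiv> (\<lambda>z. of_bool (good \<mu> c \<tau> m z))"

text \<open>The proportion of pairs that supply curvature for the mask \<open>m\<close>;
  \<open>Q\<close>, in turn, is a random smoothness constant of the empirical loss.\<close>

definition N where "N m \<omega> = (\<Sum>p\<in>pairs. at_pair (hit m) p \<omega>) / npairs"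
definition Q where "Q \<omega> = (\<Sum>p\<in>pairs. at_pair (\<lambda>z. (norm (mix_x z))\<^sup>2) p \<omega>) / npairs"

lemma L_eq: "L \<omega> w = (\<Sum>p\<in>pairs. at_pair (pair_loss w) p \<omega>) / npairs"
proof -
  have "mask_y (fst \<omega>) (snd \<omega>) i j * logistic_loss (w \<bullet> mask_x (fst \<omega>) (snd \<omega>) i j)
     + (1 - mask_y (fst \<omega>) (snd \<omega>) i j) * logistic_loss (- (w \<bullet> mask_x (fst \<omega>) (snd \<omega>) i j))
    = at_pair (pair_loss w) (i, j) \<omega>" for i j
    by (simp add: at_pair_def pair_loss_eq mask_x_def mask_y_def mix_x_def mix_y_def)
  then show ?thesis unfolding L_def mask_loss_def by (simp add: sum.cartesian_product)
qed

lemma good_measurable [measurable]: "(\<lambda>z. of_bool (good \<mu> c \<tau> m z) :: real) \<in> borel_measurable borel"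
proof -
  have "closed {z :: 'd triple. good \<mu> c \<tau> m z}"
    unfolding good_def case_prod_unfold atLeastAtMost_iff
    by (intro closed_Collect_conj closed_Collect_eq closed_Collect_le continuous_intros)
  then have "(indicator {z. good \<mu> c \<tau> m z} :: 'd triple \<Rightarrow> real) \<in> borel_measurable borel"
    by (intro borel_measurable_indicator borel_closed)
  moreover have "indicator {z. good \<mu> c \<tau> m z} = (\<lambda>z. of_bool (good \<mu> c \<tau> m z) :: real)"
    by (auto simp: indicator_def fun_eq_iff)
  ultimately show ?thesis by simp
qed

lemma at_pair_apply: "at_pair (\<lambda>z. f (h z)) p \<omega> = f (at_pair h p \<omega>)"
  by (simp add: at_pair_def)

lemma grad_bound: "norm (at_pair (pair_grad w) p \<omega>) \<le> norm (at_pair mix_x p \<omega>)" if "at_pair typical p \<omega>"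
  using norm_pair_grad_le[of "(fst \<omega> (fst p), fst \<omega> (snd p), snd \<omega> p)" w] typical_bounds(2)[OF that]
  by (simp add: at_pair_def)

lemma logistic_0: "logistic_loss 0 = ln 2" by (simp add: logistic_loss_def)

lemma pair_integrable:
  assumes p: "p \<in> pairs"
  shows "integrable \<Omega> (at_pair (pair_loss w) p)" "integrable \<Omega> (at_pair (pair_grad w) p)"
    "integrable \<Omega> (at_pair (\<lambda>z. (norm (mix_x z))\<^sup>2) p)" "integrable \<Omega> (at_pair (hit m) p)"
proof -
  show "integrable \<Omega> (at_pair (pair_grad w) p)"
    by (rule integrable_at_pair[OF _ p, of _ 1 0]) (use order_trans[OF grad_bound typical_bounds(3)] in auto)
  show "integrable \<Omega> (at_pair (\<lambda>z. (norm (mix_x z))\<^sup>2) p)"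
    by (rule integrable_at_pair[OF _ p, of _ 1 0]) (use typical_bounds(4) in \<open>auto simp: at_pair_apply[of "\<lambda>x. (norm x)\<^sup>2"]\<close>)
  show "integrable \<Omega> (at_pair (hit m) p)"
    by (rule integrable_at_pair[OF _ p, of _ 0 1]) (auto simp: at_pair_def)
  show "integrable \<Omega> (at_pair (pair_loss w) p)"
  proof (rule integrable_at_pair[OF _ p, of _ "norm w + (norm w)\<^sup>2" "ln 2"])
    fix \<omega> assume t: "at_pair typical p \<omega>"
    define z where "z = (fst \<omega> (fst p), fst \<omega> (snd p), snd \<omega> p)"
    have z: "at_pair h p \<omega> = h z" for h :: "'d triple \<Rightarrow> 'z" by (simp add: at_pair_def z_def)
    have "0 \<le> pair_loss w z" using pair_loss_nonneg typical_bounds(2)[OF t] unfolding at_pair_def z_def by blast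
    moreover have "pair_loss w z \<le> pair_loss 0 z + pair_grad 0 z \<bullet> w + (norm (mix_x z))\<^sup>2 * (norm w)\<^sup>2"
      using pair_loss_quadratic_upper[of 0 w z] by simp
    moreover have "pair_loss 0 z = ln 2" by (simp add: pair_loss_def logistic_0)
    moreover have "pair_grad 0 z \<bullet> w \<le> maj p \<omega> * norm w"
    proof -
      have "pair_grad 0 z \<bullet> w \<le> norm (pair_grad 0 z) * norm w" by (rule norm_cauchy_schwarz)
      also have "\<dots> \<le> maj p \<omega> * norm w"
        by (rule mult_right_mono) (use grad_bound[OF t, of 0] typical_bounds(3)[OF t] in \<open>auto simp: at_pair_def z_def\<close>)
      finally show ?thesis .
    qed
    moreover have "(norm (mix_x z))\<^sup>2 * (norm w)\<^sup>2 \<le> maj p \<omega> * (norm w)\<^sup>2"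
      by (rule mult_right_mono) (use typical_bounds(4)[OF t] in \<open>auto simp: at_pair_def z_def\<close>)
    ultimately show "norm (at_pair (pair_loss w) p \<omega>) \<le> (norm w + (norm w)\<^sup>2) * maj p \<omega> + ln 2"
      unfolding at_pair_def z_def[symmetric] by (simp add: algebra_simps)
  qed simp
qed

lemma sample_integrable:
  "integrable \<Omega> (\<lambda>\<omega>. L \<omega> w)" "integrable \<Omega> (Gr w)" "integrable \<Omega> (N m)" "integrable \<Omega> Q"
  unfolding L_eq Gr_def[abs_def] N_def[abs_def] Q_def[abs_def]
  by (auto intro!: Bochner_Integration.integrable_sum integrable_divide integrable_scaleR_right pair_integrable
      simp del: mem_Sigma_iff)

definition F where "F w = expectation (\<lambda>\<omega>. L \<omega> w)"
definition GF where "GF w = expectation (Gr w)"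

lemma expected_mask_loss_eq: "expected_mask_loss n D M = F"
  by (simp add: fun_eq_iff expected_mask_loss_def F_def L_def case_prod_unfold)

lemma expectation_Gr_inner: "expectation (\<lambda>\<omega>. Gr w \<omega> \<bullet> u) = GF w \<bullet> u"
  unfolding GF_def using sample_integrable(2) by simp

lemma sum_pairs_mono:
  assumes "\<And>p. p \<in> pairs \<Longrightarrow> f p \<le> (g p :: real)"
  shows "(\<Sum>p\<in>pairs. f p) / npairs \<le> (\<Sum>p\<in>pairs. g p) / npairs"
  by (intro divide_right_mono sum_mono assms) auto

lemma L_subgradient: "L \<omega> w + Gr w \<omega> \<bullet> u \<le> L \<omega> (w + u)"
proof -
  have "L \<omega> w + Gr w \<omega> \<bullet> u = (\<Sum>p\<in>pairs. at_pair (pair_loss w) p \<omega> + at_pair (pair_grad w) p \<omega> \<bullet> u) / npairs"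
    by (simp add: L_eq Gr_def sum.distrib inner_sum_left divide_inverse algebra_simps)
  also have "\<dots> \<le> L \<omega> (w + u)"
    unfolding L_eq by (rule sum_pairs_mono) (simp add: at_pair_def pair_loss_subgradient)
  finally show ?thesis .
qed

lemma L_quadratic_upper: "L \<omega> (w + u) \<le> L \<omega> w + Gr w \<omega> \<bullet> u + Q \<omega> * (norm u)\<^sup>2"
proof -
  have "L \<omega> (w + u) \<le> (\<Sum>p\<in>pairs. at_pair (pair_loss w) p \<omega> + at_pair (pair_grad w) p \<omega> \<bullet> u
      + at_pair (\<lambda>z. (norm (mix_x z))\<^sup>2) p \<omega> * (norm u)\<^sup>2) / npairs"
    unfolding L_eq by (rule sum_pairs_mono) (simp add: at_pair_def pair_loss_quadratic_upper)
  also have "\<dots> = L \<omega> w + Gr w \<omega> \<bullet> u + Q \<omega> * (norm u)\<^sup>2"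
    by (simp add: L_eq Gr_def Q_def sum.distrib inner_sum_left sum_distrib_right sum_distrib_left divide_inverse algebra_simps)
  finally show ?thesis .
qed

text \<open>The constant of \<open>pair_loss_strongly_convex\<close> for a good pair, whose mixed
  point has norm at most \<open>norm \<mu> + c\<close> and directional bound
  \<open>c / 2\<close>.\<close>

definition curv :: "real \<Rightarrow> real" where
  "curv R = exp (- (R * (norm \<mu> + c))) / 8 * (c / 2)\<^sup>2"

lemma curv_pos: "0 < curv R" using c by (simp add: curv_def)

text \<open>Good pairs contribute the quadratic term, all others just the subgradient inequality.
  The suitable mask depends on the direction \<open>u\<close>, so \<open>N m\<close> must later be
  bounded below for every \<open>m\<close> in \<open>V\<close>.\<close>

lemma L_strongly_convex:
  assumes m: "m \<in> V" and u: "c * norm u \<le> \<bar>(\<mu> * (2 *\<^sub>R m - 1)) \<bullet> u\<bar>"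
    and R: "norm w \<le> R" "norm (w + u) \<le> R"
  shows "L \<omega> w + Gr w \<omega> \<bullet> u + N m \<omega> * (curv R * (norm u)\<^sup>2) \<le> L \<omega> (w + u)"
proof -
  have "L \<omega> w + Gr w \<omega> \<bullet> u + N m \<omega> * (curv R * (norm u)\<^sup>2) =
    (\<Sum>p\<in>pairs. at_pair (pair_loss w) p \<omega> + at_pair (pair_grad w) p \<omega> \<bullet> u
      + at_pair (hit m) p \<omega> * (curv R * (norm u)\<^sup>2)) / npairs"
    by (simp add: L_eq Gr_def N_def sum.distrib inner_sum_left sum_distrib_right sum_distrib_left divide_inverse algebra_simps)
  also have "\<dots> \<le> L \<omega> (w + u)"
    unfolding L_eq
  proof (rule sum_pairs_mono)
    fix p
    define z where "z = (fst \<omega> (fst p), fst \<omega> (snd p), snd \<omega> p)"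
    have "pair_loss w z + pair_grad w z \<bullet> u + of_bool (good \<mu> c \<tau> m z) * (curv R * (norm u)\<^sup>2) \<le> pair_loss (w + u) z"
    proof (cases "good \<mu> c \<tau> m z")
      case True
      note g = good_mix[OF True V(3)[OF m] c u]
      show ?thesis
        using pair_loss_strongly_convex[OF R g(2,3)] c True by (simp add: curv_def mult.assoc)
    next
      case False
      then show ?thesis using pair_loss_subgradient[of w z u] by simp
    qed
    then show "at_pair (pair_loss w) p \<omega> + at_pair (pair_grad w) p \<omega> \<bullet> u
      + at_pair (hit m) p \<omega> * (curv R * (norm u)\<^sup>2) \<le> at_pair (pair_loss (w + u)) p \<omega>"
      by (simp add: at_pair_def z_def)
  qed
  finally show ?thesis .
qed

lemma L_coercive:
  assumes m: "m \<in> V" and w: "c * norm w \<le> \<bar>(\<mu> * (2 *\<^sub>R m - 1)) \<bullet> w\<bar>"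
    and t: "\<And>p. p \<in> pairs \<Longrightarrow> at_pair typical p \<omega>"
  shows "N m \<omega> * (\<tau> * (c / 2) * norm w) \<le> L \<omega> w"
proof -
  have "N m \<omega> * (\<tau> * (c / 2) * norm w) = (\<Sum>p\<in>pairs. at_pair (hit m) p \<omega> * (\<tau> * (c / 2) * norm w)) / npairs"
    unfolding N_def sum_distrib_right[symmetric] by simp
  also have "\<dots> \<le> L \<omega> w"
    unfolding L_eq
  proof (rule sum_pairs_mono)
    fix p assume p: "p \<in> pairs"
    define z where "z = (fst \<omega> (fst p), fst \<omega> (snd p), snd \<omega> p)"
    have "of_bool (good \<mu> c \<tau> m z) * (\<tau> * (c / 2) * norm w) \<le> pair_loss w z"
    proof (cases "good \<mu> c \<tau> m z")
      case True
      note g = good_mix[OF True V(3)[OF m] c w]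
      have "\<tau> * (c / 2 * norm w) \<le> \<tau> * \<bar>w \<bullet> mix_x z\<bar>"
        using g(3) \<tau> by (intro mult_left_mono) (auto simp: inner_commute)
      also have "\<dots> \<le> pair_loss w z" by (rule pair_loss_coercive[OF g(1)]) (use \<tau> in simp)
      finally show ?thesis using True by (simp add: mult.assoc)
    next
      case False
      moreover have "0 \<le> pair_loss w z"
        using pair_loss_nonneg typical_bounds(2)[OF t[OF p]] unfolding at_pair_def z_def by blast
      ultimately show ?thesis by simp
    qed
    then show "at_pair (hit m) p \<omega> * (\<tau> * (c / 2) * norm w) \<le> at_pair (pair_loss w) p \<omega>"
      by (simp add: at_pair_def z_def)
  qed
  finally show ?thesis .
qed

lemma L_convex: "convex_on UNIV (L \<omega>)"
  by (rule convex_on_subgradient[where G = "\<lambda>w. Gr w \<omega>"]) (rule L_subgradient)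

lemma F_subgradient: "F w + GF w \<bullet> u \<le> F (w + u)"
proof -
  have "F w + GF w \<bullet> u = expectation (\<lambda>\<omega>. L \<omega> w + Gr w \<omega> \<bullet> u)"
    using sample_integrable by (simp add: F_def expectation_Gr_inner)
  also have "\<dots> \<le> F (w + u)" unfolding F_def
    by (rule integral_mono) (use sample_integrable L_subgradient in auto)
  finally show ?thesis .
qed

lemma F_convex: "convex_on UNIV F"
  by (rule convex_on_subgradient[OF F_subgradient])

lemma expectation_pairs_le:
  assumes "\<And>p. p \<in> pairs \<Longrightarrow> f p \<le> (B :: real)"
  shows "(\<Sum>p\<in>pairs. f p) / npairs \<le> B"
proof -
  have "(\<Sum>p\<in>pairs. f p) / npairs \<le> (\<Sum>p\<in>pairs. B) / npairs" by (rule sum_pairs_mono[OF assms])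
  also have "\<dots> = B" unfolding sum_constant card_pairs using npairs_pos by simp
  finally show ?thesis .
qed

lemma Q_expectation: "expectation Q \<le> 2 * K"
proof -
  have "expectation Q = (\<Sum>p\<in>pairs. expectation (at_pair (\<lambda>z. (norm (mix_x z))\<^sup>2) p)) / npairs"
    unfolding Q_def[abs_def] by (simp add: pair_integrable Bochner_Integration.integral_sum del: mem_Sigma_iff)
  also have "\<dots> \<le> 2 * K"
  proof (rule expectation_pairs_le)
    fix p assume p: "p \<in> pairs"
    have "expectation (at_pair (\<lambda>z. (norm (mix_x z))\<^sup>2) p) \<le> expectation (maj p)"
    proof (rule integral_mono_AE[OF pair_integrable(3)[OF p] maj_integrable[OF p]])
      show "AE \<omega> in \<Omega>. at_pair (\<lambda>z. (norm (mix_x z))\<^sup>2) p \<omega> \<le> maj p \<omega>"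
        using AE_typical[OF p] by eventually_elim (use typical_bounds(4) in \<open>simp add: at_pair_def\<close>)
    qed
    then show "expectation (at_pair (\<lambda>z. (norm (mix_x z))\<^sup>2) p) \<le> 2 * K" using maj_expectation[OF p] by simp
  qed
  finally show ?thesis .
qed

lemma F_quadratic_upper: "F (w + u) \<le> F w + GF w \<bullet> u + 2 * K * (norm u)\<^sup>2"
proof -
  have "F (w + u) \<le> expectation (\<lambda>\<omega>. L \<omega> w + Gr w \<omega> \<bullet> u + Q \<omega> * (norm u)\<^sup>2)" unfolding F_def
    by (rule integral_mono) (use sample_integrable L_quadratic_upper in auto)
  also have "\<dots> = F w + GF w \<bullet> u + expectation Q * (norm u)\<^sup>2"
    using sample_integrable by (simp add: F_def expectation_Gr_inner)
  also have "expectation Q * (norm u)\<^sup>2 \<le> 2 * K * (norm u)\<^sup>2"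
    by (rule mult_right_mono[OF Q_expectation]) simp
  finally show ?thesis by simp
qed

lemma norm_GF_le: "norm (GF w) \<le> 2 * K"
proof -
  have "norm (GF w) \<le> expectation (\<lambda>\<omega>. norm (Gr w \<omega>))" unfolding GF_def by (rule integral_norm_bound)
  also have "\<dots> \<le> expectation (\<lambda>\<omega>. (\<Sum>p\<in>pairs. norm (at_pair (pair_grad w) p \<omega>)) / npairs)"
  proof (rule integral_mono)
    show "integrable \<Omega> (\<lambda>\<omega>. norm (Gr w \<omega>))" using sample_integrable(2) by (rule integrable_norm)
    show "integrable \<Omega> (\<lambda>\<omega>. (\<Sum>p\<in>pairs. norm (at_pair (pair_grad w) p \<omega>)) / npairs)"
      by (intro integrable_divide Bochner_Integration.integrable_sum integrable_norm pair_integrable)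
    show "norm (Gr w \<omega>) \<le> (\<Sum>p\<in>pairs. norm (at_pair (pair_grad w) p \<omega>)) / npairs" for \<omega>
      unfolding Gr_def norm_scaleR by (simp add: divide_inverse_commute norm_sum mult_left_mono)
  qed
  also have "\<dots> = (\<Sum>p\<in>pairs. expectation (\<lambda>\<omega>. norm (at_pair (pair_grad w) p \<omega>))) / npairs"
    by (simp add: pair_integrable Bochner_Integration.integral_sum del: mem_Sigma_iff)
  also have "\<dots> \<le> 2 * K"
  proof (rule expectation_pairs_le)
    fix p assume p: "p \<in> pairs"
    have "expectation (\<lambda>\<omega>. norm (at_pair (pair_grad w) p \<omega>)) \<le> expectation (maj p)"
    proof (rule integral_mono_AE[OF integrable_norm[OF pair_integrable(2)[OF p]] maj_integrable[OF p]])
      show "AE \<omega> in \<Omega>. norm (at_pair (pair_grad w) p \<omega>) \<le> maj p \<omega>"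
        using AE_typical[OF p] by eventually_elim (use typical_bounds(3) grad_bound order_trans in blast)
    qed
    then show "expectation (\<lambda>\<omega>. norm (at_pair (pair_grad w) p \<omega>)) \<le> 2 * K" using maj_expectation[OF p] by simp
  qed
  finally show ?thesis .
qed

lemma n0: "n \<noteq> 0" using n2 by simp

section \<open>Frequency of good pairs and drift along the class mean\<close>

lemma expectation_prod3:
  fixes f g k :: "'d labelled \<Rightarrow> real"
  assumes p: "p \<in> pairs" "fst p \<noteq> snd p"
    and m: "f \<in> borel_measurable borel" "g \<in> borel_measurable borel" "k \<in> borel_measurable borel"
    and I: "integrable D f" "integrable D g" "integrable M k"
  shows "expectation (\<lambda>\<omega>. f (XS (fst p) \<omega>) * g (XS (snd p) \<omega>) * k (XT p \<omega>))
    = (\<integral>x. f x \<partial>D) * (\<integral>x. g x \<partial>D) * (\<integral>x. k x \<partial>M)"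
proof -
  define h where "h a = (if a = Inl (fst p) then f else if a = Inl (snd p) then g else k)" for a :: "nat + nat \<times> nat"
  let ?J = "{Inl (fst p), Inl (snd p), Inr p}"
  have J: "?J \<subseteq> idx" using p(1) by (auto simp: idx_def)
  have pp: "fst p \<in> {1..n}" "snd p \<in> {1..n}" using p(1) by auto
  have ind: "indep_vars (\<lambda>_. borel) (\<lambda>a \<omega>. h a (X a \<omega>)) ?J"
    by (rule indep_vars_compose2[OF indep_vars_subset[OF indep_X J]]) (use m in \<open>auto simp: h_def\<close>)
  have X: "X (Inl i) = XS i" "X (Inr r) = XT r" for i r by (auto simp: X_def)
  have int: "integrable \<Omega> (\<lambda>\<omega>. h a (X a \<omega>))" if "a \<in> ?J" for a
    using that integral_XS(2)[OF m(1) pp(1)] integral_XS(2)[OF m(2) pp(2)] integral_XT(2)[OF m(3) p(1)] I p(2)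
    by (auto simp: h_def X)
  have "expectation (\<lambda>\<omega>. \<Prod>a\<in>?J. h a (X a \<omega>)) = (\<Prod>a\<in>?J. expectation (\<lambda>\<omega>. h a (X a \<omega>)))"
    by (rule indep_vars_lebesgue_integral[OF _ ind int]) auto
  then show ?thesis
    using p(2) integral_XS(1)[OF m(1) pp(1)] integral_XS(1)[OF m(2) pp(2)] integral_XT(1)[OF m(3) p(1)]
    by (simp add: h_def X mult.assoc)
qed

lemma noise_integrable: "integrable D (\<lambda>p. norm (fst p - (2 * snd p - 1) *\<^sub>R \<mu>))"
proof (rule Bochner_Integration.integrable_bound)
  show "integrable D (\<lambda>p. exp (4 * norm (fst p)) + norm \<mu>)" using exp_int by simp
  show "AE p in D. norm (norm (fst p - (2 * snd p - 1) *\<^sub>R \<mu>)) \<le> norm (exp (4 * norm (fst p)) + norm \<mu>)"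
    using y01
  proof eventually_elim
    case (elim p)
    then have "\<bar>2 * snd p - 1\<bar> = 1" by auto
    then show ?case
      using norm_triangle_ineq4[of "fst p" "(2 * snd p - 1) *\<^sub>R \<mu>"] square_le_exp4(2)[of "norm (fst p)"] by simp
  qed
qed measurable

lemma snd_integrable: "integrable D (\<lambda>p. snd p)" and snd_expectation: "(\<integral>p. snd p \<partial>D) = 1 / 2"
proof -
  have m: "{p. snd p = 1} \<in> sets D"
  proof -
    have "{p \<in> space D. snd p = 1} \<in> sets D" by measurable
    then show ?thesis by (simp add: space_D)
  qed
  have ae: "AE p in D. snd p = indicator {p. snd p = 1} p" using y01 by eventually_elim auto
  show "integrable D (\<lambda>p. snd p)"
    by (subst integrable_cong_AE[OF _ _ ae])
      (use m in \<open>auto simp: sets_D[THEN measurable_cong_sets] D.emeasure_finite less_top[symmetric] intro!: integrable_real_indicator\<close>)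
  have "(\<integral>p. snd p \<partial>D) = (\<integral>p. indicator {p. snd p = 1} p \<partial>D)"
    by (rule integral_cong_AE[OF _ _ ae]) (use m in \<open>auto simp: sets_D[THEN measurable_cong_sets]\<close>)
  then show "(\<integral>p. snd p \<partial>D) = 1 / 2" using m y_half by simp
qed

text \<open>Each class has probability \<open>1 / 2\<close>. By Markov, the mean noise
  \<open>c / 16\<close> lets at most a quarter of the mass reach distance \<open>c / 4\<close> from
  its center.\<close>

lemma class_prob:
  assumes s: "s = 0 \<or> s = 1"
  shows "1 / 4 \<le> measure D {p. snd p = s \<and> norm (fst p - (2 * s - 1) *\<^sub>R \<mu>) \<le> c / 4}"
proof -
  let ?e = "\<lambda>p :: 'd labelled. norm (fst p - (2 * snd p - 1) *\<^sub>R \<mu>)"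
  have [measurable]: "?e \<in> borel_measurable D" using borel_measurable_integrable[OF noise_integrable] .
  have S: "{p \<in> space D. P p} = {p. P p}" for P by (simp add: space_D)
  have ms: "{p \<in> space D. snd p = s} \<in> sets D" "{p \<in> space D. snd p = 0} \<in> sets D" "{p \<in> space D. snd p = 1} \<in> sets D"
    "{p \<in> space D. c / 4 \<le> ?e p} \<in> sets D"
    "{p \<in> space D. snd p = s \<and> norm (fst p - (2 * s - 1) *\<^sub>R \<mu>) \<le> c / 4} \<in> sets D"
    by measurable
  note ms = ms[unfolded S]
  have s2: "measure D {p. snd p = s} = 1 / 2"
  proof (cases "s = 1")
    case False
    have "measure D ({p. snd p = 0} \<union> {p. snd p = 1}) = measure D (space D)"
      by (rule D.finite_measure_eq_AE) (use y01 ms in \<open>auto simp: space_D\<close>)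
    then have "measure D {p. snd p = 0} + measure D {p. snd p = 1} = 1"
      using ms by (subst (asm) D.finite_measure_Union) (auto simp: D.prob_space)
    then show ?thesis using s False y_half by simp
  qed (use y_half in simp)
  have "measure D {p \<in> space D. c / 4 \<le> ?e p} \<le> (\<integral>p. ?e p \<partial>D) / (c / 4)"
    by (rule integral_Markov_inequality_measure[where A = "{}"]) (use noise_integrable c in auto)
  also have "\<dots> \<le> (c / 16) / (c / 4)" by (rule divide_right_mono) (use noise c in auto)
  finally have e4: "measure D {p. c / 4 \<le> ?e p} \<le> 1 / 4" unfolding S using c by simp
  have "measure D {p. snd p = s} \<le> measure D ({p. snd p = s \<and> norm (fst p - (2 * s - 1) *\<^sub>R \<mu>) \<le> c / 4} \<union> {p. c / 4 \<le> ?e p})"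
    by (rule D.finite_measure_mono) (use ms in auto)
  also have "\<dots> \<le> measure D {p. snd p = s \<and> norm (fst p - (2 * s - 1) *\<^sub>R \<mu>) \<le> c / 4} + measure D {p. c / 4 \<le> ?e p}"
    by (rule measure_Un_le) (use ms in auto)
  finally show ?thesis using s2 e4 by simp
qed

lemma good_prob:
  assumes p: "p \<in> pairs" "fst p \<noteq> snd p" and m: "m \<in> V"
  shows "q / 16 \<le> expectation (at_pair (hit m) p)"
proof -
  let ?A = "{p :: 'd labelled. snd p = 1 \<and> norm (fst p - \<mu>) \<le> c / 4}"
  let ?B = "{p :: 'd labelled. snd p = 0 \<and> norm (fst p + \<mu>) \<le> c / 4}"
  let ?C = "{t :: 'd labelled. fst t = m \<and> snd t \<in> {\<tau>..1 - \<tau>}}"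
  have "closed ?A" "closed ?B" "closed ?C"
    unfolding atLeastAtMost_iff by (intro closed_Collect_conj closed_Collect_eq closed_Collect_le continuous_intros)+
  then have cl: "?A \<in> sets borel" "?B \<in> sets borel" "?C \<in> sets borel" by (auto intro: borel_closed)
  have "expectation (at_pair (hit m) p)
    = expectation (\<lambda>\<omega>. indicator ?A (XS (fst p) \<omega>) * indicator ?B (XS (snd p) \<omega>) * indicator ?C (XT p \<omega>))"
    by (rule arg_cong[where f = expectation]) (auto simp: fun_eq_iff at_pair_def good_def indicator_def)
  also have "\<dots> = (\<integral>x. indicator ?A x \<partial>D) * (\<integral>x. indicator ?B x \<partial>D) * (\<integral>x. indicator ?C x \<partial>M)"
    by (rule expectation_prod3[OF p]) (use cl in \<open>auto intro!: integrable_real_indicator simp: sets_D sets_M D.emeasure_finite M.emeasure_finite less_top[symmetric]\<close>)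
  also have "\<dots> = measure D ?A * measure D ?B * measure M ?C"
    using cl by (simp add: sets_D sets_M)
  also have "\<dots> \<ge> (1 / 4) * (1 / 4) * q"
    using class_prob[of 1] class_prob[of 0] VM[OF m] q by (intro mult_mono) auto
  finally show ?thesis by simp
qed

text \<open>Off-diagonal pairs are good with probability at least \<open>q / 16\<close>, two class
  factors \<open>1 / 4\<close> times \<open>q\<close>. For \<open>n \<ge> 2\<close> they are at
  least half of all pairs; diagonal ones count as zero.\<close>

lemma N_expectation:
  assumes "m \<in> V"
  shows "q / 32 \<le> expectation (N m)"
proof -
  let ?e = "\<lambda>p. expectation (at_pair (hit m) p)"
  have "(\<Sum>p\<in>pairs. q / 16 * of_bool (fst p \<noteq> snd p)) = q / 16 * (npairs - real n)"
  proof -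
    have "(\<Sum>p\<in>pairs. of_bool (fst p \<noteq> snd p) :: real) = (\<Sum>p\<in>pairs. 1) - (\<Sum>p\<in>pairs. of_bool (fst p = snd p))"
      unfolding sum_subtractf[symmetric] by (rule sum.cong) auto
    also have "(\<Sum>p\<in>pairs. of_bool (fst p = snd p) :: real) = real n"
    proof -
      have "(\<Sum>p\<in>pairs. of_bool (fst p = snd p) :: real) = (\<Sum>i\<in>{1..n}. \<Sum>j\<in>{1..n}. of_bool (i = j))"
        unfolding sum.cartesian_product case_prod_unfold ..
      also have "\<dots> = (\<Sum>i\<in>{1..n}. 1)"
      proof (rule sum.cong)
        fix i assume "i \<in> {1..n}"
        then show "(\<Sum>j\<in>{1..n}. of_bool (i = j)) = (1 :: real)" unfolding of_bool_def by (subst sum.delta') auto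
      qed simp
      finally show ?thesis by simp
    qed
    finally have e: "(\<Sum>p\<in>pairs. of_bool (fst p \<noteq> snd p) :: real) = (\<Sum>p\<in>pairs. 1) - real n" .
    show ?thesis unfolding sum_distrib_left[symmetric] e by (simp only: sum_constant card_pairs mult_1_right)
  qed
  moreover have "q / 16 * (npairs / 2) \<le> q / 16 * (npairs - real n)"
  proof (rule mult_left_mono)
    have "2 * real n \<le> real n * real n" using n2 by (intro mult_right_mono) auto
    then show "npairs / 2 \<le> npairs - real n" by (simp add: power2_eq_square)
  qed (use q in simp)
  moreover have "(\<Sum>p\<in>pairs. q / 16 * of_bool (fst p \<noteq> snd p)) \<le> (\<Sum>p\<in>pairs. ?e p)"
  proof (rule sum_mono)
    fix p assume "p \<in> pairs"
    then show "q / 16 * of_bool (fst p \<noteq> snd p) \<le> ?e p"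
      using good_prob[OF _ _ assms, of p] by (cases "fst p = snd p") (auto intro!: Bochner_Integration.integral_nonneg simp: at_pair_def simp del: mem_Sigma_iff)
  qed
  ultimately have "q / 32 * npairs \<le> (\<Sum>p\<in>pairs. ?e p)" by simp
  also have "\<dots> = expectation (N m) * npairs"
    unfolding N_def[abs_def] using npairs_pos n0
    by (simp add: pair_integrable Bochner_Integration.integral_sum del: mem_Sigma_iff)
  finally show ?thesis using npairs_pos by simp
qed

lemma F_strongly_convex:
  assumes R: "norm w \<le> R" "norm (w + u) \<le> R"
  shows "F w + GF w \<bullet> u + q / 32 * curv R * (norm u)\<^sup>2 \<le> F (w + u)"
proof (cases "u = 0")
  case False
  then obtain m where m: "m \<in> V" "c * norm u \<le> \<bar>(\<mu> * (2 *\<^sub>R m - 1)) \<bullet> u\<bar>" using Vc by blast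
  have "q / 32 * (curv R * (norm u)\<^sup>2) \<le> expectation (N m) * (curv R * (norm u)\<^sup>2)"
    by (rule mult_right_mono[OF N_expectation[OF m(1)]]) (use curv_pos[of R] in simp)
  moreover have "F w + GF w \<bullet> u + expectation (N m) * (curv R * (norm u)\<^sup>2)
    = expectation (\<lambda>\<omega>. L \<omega> w + Gr w \<omega> \<bullet> u + N m \<omega> * (curv R * (norm u)\<^sup>2))"
    using sample_integrable by (simp add: F_def expectation_Gr_inner)
  moreover have "\<dots> \<le> F (w + u)" unfolding F_def
    by (rule integral_mono) (use sample_integrable L_strongly_convex[OF m R] in auto)
  ultimately show ?thesis by (simp add: mult.assoc)
qed simp

lemma F_0: "F 0 = ln 2"
proof -
  have "L \<omega> 0 = ln 2" for \<omega>
    using npairs_pos n0 by (simp add: L_eq at_pair_def pair_loss_def logistic_0 card_pairs power2_eq_square)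
  then show ?thesis by (simp add: F_def prob_space)
qed

lemma F_coercive: "q / 32 * (\<tau> * (c / 2)) * norm w \<le> F w"
proof (cases "w = 0")
  case False
  then obtain m where m: "m \<in> V" "c * norm w \<le> \<bar>(\<mu> * (2 *\<^sub>R m - 1)) \<bullet> w\<bar>" using Vc by blast
  have "q / 32 * (\<tau> * (c / 2) * norm w) \<le> expectation (N m) * (\<tau> * (c / 2) * norm w)"
    by (rule mult_right_mono[OF N_expectation[OF m(1)]]) (use \<tau> c in simp)
  also have "\<dots> = expectation (\<lambda>\<omega>. N m \<omega> * (\<tau> * (c / 2) * norm w))" using sample_integrable by simp
  also have "\<dots> \<le> F w" unfolding F_def
  proof (rule integral_mono_AE)
    have "AE \<omega> in \<Omega>. \<forall>p\<in>pairs. at_pair typical p \<omega>"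
      by (rule AE_finite_allI) (use AE_typical in auto)
    then show "AE \<omega> in \<Omega>. N m \<omega> * (\<tau> * (c / 2) * norm w) \<le> L \<omega> w"
      by eventually_elim (use L_coercive[OF m] in blast)
  qed (use sample_integrable in auto)
  finally show ?thesis by (simp add: mult.assoc)
next
  case True
  then show ?thesis by (simp add: F_0)
qed

text \<open>The sign product weighted by \<open>1 + a\<close> has mean zero off the diagonal, as the
  classes are balanced, and is nonnegative on it, being a square there. The term
  \<open>(1 - a) / 2\<close> has mean at least \<open>\<tau> * q\<close>, because weights in
  \<open>[\<tau>, 1 - \<tau>]\<close> have probability at least \<open>q\<close>. The two noise
  terms consume at most half of this gain.\<close>

lemma pair_alignment:
  assumes p: "p \<in> pairs"
  shows "(norm \<mu>)\<^sup>2 * \<tau> * q / 2 \<le> expectation (\<lambda>\<omega>. (2 * at_pair mix_y p \<omega> - 1) * (at_pair mix_x p \<omega> \<bullet> \<mu>))"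
proof -
  let ?a = "\<lambda>t :: 'd labelled. \<bar>2 * snd t - 1\<bar>"
  let ?s = "\<lambda>p :: 'd labelled. 2 * snd p - 1"
  let ?e = "\<lambda>p :: 'd labelled. norm (fst p - (2 * snd p - 1) *\<^sub>R \<mu>)"
  have pp: "fst p \<in> {1..n}" "snd p \<in> {1..n}" using p by auto
  have [measurable]: "?a \<in> borel_measurable borel" "?s \<in> borel_measurable borel" "?e \<in> borel_measurable borel" by measurable
  have aint: "integrable M ?a"
  proof (rule M.integrable_const_bound[where B = 1])
    show "AE t in M. norm (?a t) \<le> 1" using mask01 by eventually_elim auto
  qed measurable
  have sint: "integrable D ?s" "(\<integral>x. ?s x \<partial>D) = 0"
    using snd_integrable snd_expectation by (auto simp: D.prob_space)
  have aI: "integrable \<Omega> (\<lambda>\<omega>. ?a (XT p \<omega>))" "expectation (\<lambda>\<omega>. ?a (XT p \<omega>)) = (\<integral>t. ?a t \<partial>M)"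
    using integral_XT[OF _ p, of ?a] aint by auto
  have ssI: "integrable \<Omega> (\<lambda>\<omega>. ?s (XS (fst p) \<omega>) * ?s (XS (snd p) \<omega>) * (1 + ?a (XT p \<omega>)))"
  proof (rule integrable_const_bound[where B = 2])
    show "AE \<omega> in \<Omega>. norm (?s (XS (fst p) \<omega>) * ?s (XS (snd p) \<omega>) * (1 + ?a (XT p \<omega>))) \<le> 2"
      using AE_typical[OF p] by eventually_elim (auto simp: at_pair_def typical_def abs_mult)
    have [measurable]: "XS (fst p) \<in> borel_measurable \<Omega>" "XS (snd p) \<in> borel_measurable \<Omega>" "XT p \<in> borel_measurable \<Omega>"
      using X_Inl(1)[OF pp(1)] X_Inl(1)[OF pp(2)] X_Inr(1)[OF p] by auto
    show "(\<lambda>\<omega>. ?s (XS (fst p) \<omega>) * ?s (XS (snd p) \<omega>) * (1 + ?a (XT p \<omega>))) \<in> borel_measurable \<Omega>" by measurable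
  qed
  have ss0: "0 \<le> expectation (\<lambda>\<omega>. ?s (XS (fst p) \<omega>) * ?s (XS (snd p) \<omega>) * (1 + ?a (XT p \<omega>)))"
  proof (cases "fst p = snd p")
    case True
    then show ?thesis by (intro Bochner_Integration.integral_nonneg) simp
  next
    case False
    have "expectation (\<lambda>\<omega>. ?s (XS (fst p) \<omega>) * ?s (XS (snd p) \<omega>) * (1 + ?a (XT p \<omega>)))
      = (\<integral>x. ?s x \<partial>D) * (\<integral>x. ?s x \<partial>D) * (\<integral>t. 1 + ?a t \<partial>M)"
      by (rule expectation_prod3[OF p False]) (use sint(1) aint in auto)
    then show ?thesis using sint(2) by simp
  qed
  have aq: "(\<integral>t. ?a t \<partial>M) \<le> 1 - 2 * \<tau> * q"
  proof -
    obtain m where m: "m \<in> V" using V(2) by blast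
    let ?C = "{t :: 'd labelled. fst t = m \<and> snd t \<in> {\<tau>..1 - \<tau>}}"
    have "closed ?C"
      unfolding atLeastAtMost_iff by (intro closed_Collect_conj closed_Collect_eq closed_Collect_le continuous_intros)
    then have C: "?C \<in> sets M" by (simp add: sets_M)
    have "(\<integral>t. ?a t \<partial>M) \<le> (\<integral>t. 1 - 2 * \<tau> * indicator ?C t \<partial>M)"
    proof (rule integral_mono_AE[OF aint])
      show "integrable M (\<lambda>t. 1 - 2 * \<tau> * indicator ?C t)"
        using C by (auto simp: M.emeasure_finite less_top[symmetric])
      show "AE t in M. ?a t \<le> 1 - 2 * \<tau> * indicator ?C t"
        using mask01 by eventually_elim (auto simp: indicator_def)
    qed
    also have "\<dots> = 1 - 2 * \<tau> * measure M ?C"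
      using C by (simp add: M.prob_space M.emeasure_finite less_top[symmetric])
    also have "\<dots> \<le> 1 - 2 * \<tau> * q" using VM[OF m] \<tau> by simp
    finally show ?thesis .
  qed
  have eI: "integrable \<Omega> (\<lambda>\<omega>. ?e (XS i \<omega>))" "expectation (\<lambda>\<omega>. ?e (XS i \<omega>)) \<le> norm \<mu> * \<tau> * q / 4" if "i \<in> {1..n}" for i
    using integral_XS[OF _ that, of ?e] noise_integrable noise by auto
  let ?l = "\<lambda>\<omega>. (norm \<mu>)\<^sup>2 * ((1 - ?a (XT p \<omega>)) / 2 + ?s (XS (fst p) \<omega>) * ?s (XS (snd p) \<omega>) * (1 + ?a (XT p \<omega>)) / 2)
    - norm \<mu> * (?e (XS (fst p) \<omega>) + ?e (XS (snd p) \<omega>))"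
  have lI: "integrable \<Omega> ?l" using aI(1) ssI eI(1)[OF pp(1)] eI(1)[OF pp(2)] by auto
  have rI: "integrable \<Omega> (\<lambda>\<omega>. (2 * at_pair mix_y p \<omega> - 1) * (at_pair mix_x p \<omega> \<bullet> \<mu>))"
  proof -
    have "integrable \<Omega> (at_pair (\<lambda>z. (2 * mix_y z - 1) * (mix_x z \<bullet> \<mu>)) p)"
    proof (rule integrable_at_pair[OF _ p, of _ "norm \<mu>" 0])
      fix \<omega> assume t: "at_pair typical p \<omega>"
      have "\<bar>2 * at_pair mix_y p \<omega> - 1\<bar> \<le> 1" using typical_bounds(2)[OF t] by auto
      moreover have "\<bar>at_pair mix_x p \<omega> \<bullet> \<mu>\<bar> \<le> maj p \<omega> * norm \<mu>"
        using Cauchy_Schwarz_ineq2[of "at_pair mix_x p \<omega>" \<mu>] mult_right_mono[OF typical_bounds(3)[OF t] norm_ge_zero[of \<mu>]] by linarith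
      ultimately have "\<bar>2 * at_pair mix_y p \<omega> - 1\<bar> * \<bar>at_pair mix_x p \<omega> \<bullet> \<mu>\<bar> \<le> 1 * (maj p \<omega> * norm \<mu>)"
        by (intro mult_mono) auto
      then show "norm (at_pair (\<lambda>z. (2 * mix_y z - 1) * (mix_x z \<bullet> \<mu>)) p \<omega>) \<le> norm \<mu> * maj p \<omega> + 0"
        by (simp add: at_pair_def abs_mult mult.commute)
    qed measurable
    then show ?thesis by (simp add: at_pair_def[abs_def])
  qed
  have "(norm \<mu>)\<^sup>2 * (\<tau> * q) - norm \<mu> * (norm \<mu> * \<tau> * q / 2) \<le> expectation ?l"
  proof -
    have "expectation ?l = (norm \<mu>)\<^sup>2 * ((1 - (\<integral>t. ?a t \<partial>M)) / 2
        + expectation (\<lambda>\<omega>. ?s (XS (fst p) \<omega>) * ?s (XS (snd p) \<omega>) * (1 + ?a (XT p \<omega>))) / 2)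
      - norm \<mu> * (expectation (\<lambda>\<omega>. ?e (XS (fst p) \<omega>)) + expectation (\<lambda>\<omega>. ?e (XS (snd p) \<omega>)))"
      using aI ssI eI(1)[OF pp(1)] eI(1)[OF pp(2)] by (simp add: prob_space)
    moreover have "(norm \<mu>)\<^sup>2 * (\<tau> * q) \<le> (norm \<mu>)\<^sup>2 * ((1 - (\<integral>t. ?a t \<partial>M)) / 2
        + expectation (\<lambda>\<omega>. ?s (XS (fst p) \<omega>) * ?s (XS (snd p) \<omega>) * (1 + ?a (XT p \<omega>))) / 2)"
    proof -
      have "\<tau> * q \<le> (1 - A) / 2 + B / 2" if "A \<le> 1 - 2 * \<tau> * q" "0 \<le> B" for A B :: real
        using that by (simp add: field_simps)
      from this[OF aq ss0] show ?thesis by (rule mult_left_mono) simp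
    qed
    moreover have "norm \<mu> * (expectation (\<lambda>\<omega>. ?e (XS (fst p) \<omega>)) + expectation (\<lambda>\<omega>. ?e (XS (snd p) \<omega>)))
      \<le> norm \<mu> * (norm \<mu> * \<tau> * q / 2)"
      using eI(2)[OF pp(1)] eI(2)[OF pp(2)] by (intro mult_left_mono) auto
    moreover have "a - b' \<le> x" if "x = a' - b" "a \<le> a'" "b \<le> b'" for a a' b b' x :: real
      using that by simp
    ultimately show ?thesis by blast
  qed
  also have "expectation ?l \<le> expectation (\<lambda>\<omega>. (2 * at_pair mix_y p \<omega> - 1) * (at_pair mix_x p \<omega> \<bullet> \<mu>))"
  proof (rule integral_mono_AE[OF lI rI])
    show "AE \<omega> in \<Omega>. ?l \<omega> \<le> (2 * at_pair mix_y p \<omega> - 1) * (at_pair mix_x p \<omega> \<bullet> \<mu>)"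
      using AE_typical[OF p]
    proof eventually_elim
      case (elim \<omega>)
      then show ?case unfolding at_pair_def by (intro mean_alignment) (auto simp: typical_def)
    qed
  qed
  finally show ?thesis by (simp add: power2_eq_square mult_ac)
qed

text \<open>At the origin the sigmoid is \<open>1 / 2\<close>, so the gradient of a pair is minus
  half of the quantity in \<open>pair_alignment\<close>.\<close>

lemma GF_0_inner: "GF 0 \<bullet> \<mu> \<le> - ((norm \<mu>)\<^sup>2 * \<tau> * q / 4)"
proof -
  have eq: "at_pair (pair_grad 0) p \<omega> \<bullet> \<mu> = - ((2 * at_pair mix_y p \<omega> - 1) * (at_pair mix_x p \<omega> \<bullet> \<mu>)) / 2" for p \<omega>
    by (simp add: at_pair_def pair_grad_def sigmoid_def field_simps)
  have "GF 0 \<bullet> \<mu> = expectation (\<lambda>\<omega>. (\<Sum>p\<in>pairs. at_pair (pair_grad 0) p \<omega> \<bullet> \<mu>) / npairs)"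
    unfolding expectation_Gr_inner[symmetric] Gr_def by (simp add: inner_sum_left divide_inverse_commute)
  also have "\<dots> = (\<Sum>p\<in>pairs. expectation (\<lambda>\<omega>. at_pair (pair_grad 0) p \<omega> \<bullet> \<mu>)) / npairs"
    by (simp add: pair_integrable Bochner_Integration.integral_sum del: mem_Sigma_iff)
  also have "\<dots> \<le> - ((norm \<mu>)\<^sup>2 * \<tau> * q / 4)"
  proof (rule expectation_pairs_le)
    fix p assume "p \<in> pairs"
    then show "expectation (\<lambda>\<omega>. at_pair (pair_grad 0) p \<omega> \<bullet> \<mu>) \<le> - ((norm \<mu>)\<^sup>2 * \<tau> * q / 4)"
      using pair_alignment[of p]
      unfolding eq integral_divide_zero Bochner_Integration.integral_minus by linarith
  qed
  finally show ?thesis .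
qed

end

section \<open>Concentration of the empirical minimizer\<close>

context mixup
begin

text \<open>Beyond this radius \<open>F_coercive\<close> gives \<open>F \<ge> 1\<close>, above the
  value \<open>ln 2\<close> at the origin.\<close>

definition radius :: real where "radius = 64 / (q * (\<tau> * c))"

text \<open>Half of the expected curvature, since the empirical \<open>N m\<close> is guaranteed
  only half of its expected lower bound. The argument \<open>radius + 3\<close> covers points of
  norm up to \<open>radius + 2\<close> and unit steps from them.\<close>

definition sc :: real where "sc = q / 64 * curv (radius + 3)"

text \<open>The decrease of \<open>F\<close> attainable along \<open>\<mu>\<close>, divided by the
  bound \<open>2 * K\<close> on the gradient at the origin: a minimizer closer to the origin could
  not reach that decrease.\<close>

definition wmin :: real where "wmin = ((norm \<mu>)\<^sup>2 * \<tau> * q / 4)\<^sup>2 / (16 * K\<^sup>2 * (norm \<mu>)\<^sup>2)"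

definition Kdev :: real where "Kdev = exp (2 * K + 2) * K"

text \<open>The deviation level is \<open>dev * \<epsilon>\<close>. The three terms of the minimum
  ensure a small empirical gradient, at most a halving of the good-pair bound, and the admissible
  range of the Chernoff bound.\<close>

definition dev :: real where
  "dev = min (sc * min wmin 1 / (8 * real CARD('d))) (min (q / 256) (8 * Kdev))"

definition rate :: real where "rate = dev\<^sup>2 / (32 * Kdev)"

definition mult_const :: real where "mult_const = 8 * (real CARD('d) + real (card V))"

lemma constants_pos: "0 < radius" "0 < sc" "0 < wmin" "0 < Kdev" "0 < dev" "0 < rate" "0 < mult_const"
proof -
  show "0 < radius" using q \<tau> c by (simp add: radius_def)
  show s: "0 < sc" using q curv_pos by (simp add: sc_def)
  show w: "0 < wmin" using q \<tau> mu K_pos by (simp add: wmin_def)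
  show k: "0 < Kdev" using K_pos by (simp add: Kdev_def)
  show d: "0 < dev" using s w k q by (simp add: dev_def)
  show "0 < rate" using d k by (simp add: rate_def)
  show "0 < mult_const" by (simp add: mult_const_def add_pos_nonneg)
qed

lemma F_minimizer:
  obtains w where "unique_minimizer F w" "norm w \<le> radius" "GF w = 0" "wmin \<le> norm w"
proof -
  have cont: "continuous_on UNIV F" using convex_on_continuous[OF open_UNIV F_convex] .
  have "\<exists>w\<in>cball 0 radius. \<forall>v\<in>cball 0 radius. F w \<le> F v"
    by (rule continuous_attains_inf) (use constants_pos(1) cont continuous_on_subset in auto)
  then obtain w where w: "norm w \<le> radius" "\<And>v. norm v \<le> radius \<Longrightarrow> F w \<le> F v" by auto
  have glob: "F w \<le> F v" for v
  proof (cases "norm v \<le> radius")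
    case False
    have "F w \<le> F 0" using w(2)[of 0] constants_pos(1) by simp
    also have "\<dots> \<le> 1" using F_0 ln_2_less_1 by simp
    also have "1 \<le> q / 32 * (\<tau> * (c / 2)) * norm v"
      using False q \<tau> c by (simp add: radius_def field_simps)
    also have "\<dots> \<le> F v" by (rule F_coercive)
    finally show ?thesis .
  qed (use w in simp)
  have G0: "GF w = 0"
  proof -
    \<comment> \<open>A gradient step of length \<open>1 / (4 * K)\<close>, optimal for the
      quadratic upper bound, would lower \<open>F\<close> by
      \<open>(norm (GF w))\<^sup>2 / (8 * K)\<close>.\<close>
    have "F w \<le> F (w + (- (1 / (4 * K))) *\<^sub>R GF w)" by (rule glob)
    also have "\<dots> \<le> F w + GF w \<bullet> ((- (1 / (4 * K))) *\<^sub>R GF w) + 2 * K * (norm ((- (1 / (4 * K))) *\<^sub>R GF w))\<^sup>2"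
      by (rule F_quadratic_upper)
    also have "\<dots> = F w - (norm (GF w))\<^sup>2 / (8 * K)"
      using K_pos by (simp add: dot_square_norm power_mult_distrib field_simps power2_eq_square)
    finally have "(norm (GF w))\<^sup>2 / (8 * K) \<le> 0" by simp
    then have "(norm (GF w))\<^sup>2 \<le> 0" using K_pos by (simp add: divide_le_0_iff)
    then show ?thesis by simp
  qed
  have "wmin \<le> norm w"
  proof -
    define \<gamma> where "\<gamma> = (norm \<mu>)\<^sup>2 * \<tau> * q / 4"
    \<comment> \<open>The step along \<open>\<mu>\<close> minimizing the quadratic upper bound from
      the origin, where \<open>\<gamma>\<close> bounds the descent rate. The subgradient inequality
      at \<open>0\<close> limits the drop of \<open>F\<close> at \<open>w\<close> to
      \<open>2 * K * norm w\<close>, which yields the lower bound on \<open>norm w\<close>.\<close>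
    define h where "h = \<gamma> / (4 * K * (norm \<mu>)\<^sup>2)"
    have h: "0 \<le> h" using K_pos \<tau> q by (simp add: h_def \<gamma>_def)
    have "F 0 + GF 0 \<bullet> w \<le> F (0 + w)" by (rule F_subgradient)
    also have "\<dots> \<le> F (0 + h *\<^sub>R \<mu>)" using glob by simp
    also have "\<dots> \<le> F 0 + GF 0 \<bullet> (h *\<^sub>R \<mu>) + 2 * K * (norm (h *\<^sub>R \<mu>))\<^sup>2" by (rule F_quadratic_upper)
    also have "GF 0 \<bullet> (h *\<^sub>R \<mu>) \<le> h * (- \<gamma>)"
      using mult_left_mono[OF GF_0_inner h] by (simp add: \<gamma>_def)
    finally have "- (GF 0 \<bullet> w) \<ge> h * \<gamma> - 2 * K * (norm (h *\<^sub>R \<mu>))\<^sup>2" by linarith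
    moreover have "h * \<gamma> - 2 * K * (norm (h *\<^sub>R \<mu>))\<^sup>2 = \<gamma>\<^sup>2 / (8 * K * (norm \<mu>)\<^sup>2)"
      using K_pos mu by (simp add: h_def power_mult_distrib power_divide field_simps power2_eq_square)
    moreover have "- (GF 0 \<bullet> w) \<le> 2 * K * norm w"
      using Cauchy_Schwarz_ineq2[of "GF 0" w] mult_right_mono[OF norm_GF_le[of 0] norm_ge_zero[of w]] by linarith
    ultimately have X: "\<gamma>\<^sup>2 / (8 * K * (norm \<mu>)\<^sup>2) \<le> 2 * K * norm w" by linarith
    have wm: "wmin = \<gamma>\<^sup>2 / (8 * K * (norm \<mu>)\<^sup>2) / (2 * K)"
      using K_pos mu by (simp add: wmin_def \<gamma>_def power2_eq_square)
    have "a / (2 * K) \<le> b" if "a \<le> 2 * K * b" for a b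
      using that K_pos by (simp add: pos_divide_le_eq mult_ac)
    from this[OF X] show ?thesis unfolding wm .
  qed
  moreover have "unique_minimizer F w"
  proof -
    have "\<exists>v. unique_minimizer F v \<and> norm (v - w) \<le> 1"
    proof (rule locally_strongly_convex_unique_minimizer[OF F_convex, where G = GF and R = "radius + 2" and c = "2 * sc"])
      fix v u :: "real ^ 'd" assume "norm v \<le> radius + 2" "norm u \<le> 1"
      then have "norm v \<le> radius + 3" "norm (v + u) \<le> radius + 3"
        using norm_triangle_ineq[of v u] by linarith+
      from F_strongly_convex[OF this] show "F v + GF v \<bullet> u + 2 * sc * (norm u)\<^sup>2 \<le> F (v + u)"
        by (simp add: sc_def)
    qed (use constants_pos w(1) G0 in auto)
    then obtain v where "unique_minimizer F v" by blast
    then show ?thesis using glob unfolding unique_minimizer_iff by metis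
  qed
  ultimately show ?thesis using that w(1) G0 by blast
qed

lemma pairwise_deviation:
  assumes h: "h \<in> borel_measurable borel"
    and bd: "\<And>p \<omega>. at_pair typical p \<omega> \<Longrightarrow> \<bar>at_pair h p \<omega>\<bar> \<le> norm (at_pair mix_x p \<omega>) + 1"
    and t: "0 < t" "t \<le> 8 * Kdev"
  shows "prob {\<omega> \<in> space \<Omega>. 4 * npairs * t \<le> \<bar>fluct h \<omega>\<bar>}
    \<le> 8 * real n * exp (- (real n * t\<^sup>2 / (32 * Kdev)))"
  unfolding Kdev_def
proof (rule deviation_bound[OF h _ exp_int exp_le])
  fix p assume "p \<in> pairs"
  from AE_typical[OF this]
  show "AE \<omega> in \<Omega>. \<bar>at_pair h p \<omega>\<bar> \<le> norm (fst (XS (fst p) \<omega>)) + norm (fst (XS (snd p) \<omega>)) + 1"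
  proof eventually_elim
    case (elim \<omega>)
    then show ?case using bd[of p \<omega>] typical_bounds(1)[of p \<omega>] by linarith
  qed
qed (use t n0 in \<open>auto simp: Kdev_def\<close>)

text \<open>Finitely many deviations at one fixed \<open>w\<close> suffice: the components of the
  gradient there and one frequency per mask. Their number gives the factor
  \<open>CARD('d) + card V\<close> in \<open>mult_const\<close>.\<close>

definition concentrated :: "real ^ 'd \<Rightarrow> real \<Rightarrow> _ set" where
  "concentrated w t = {\<omega> \<in> space \<Omega>.
     (\<forall>k. \<bar>fluct (\<lambda>z. pair_grad w z $ k) \<omega>\<bar> < 4 * npairs * t) \<and>
     (\<forall>m\<in>V. \<bar>fluct (hit m) \<omega>\<bar> < 4 * npairs * t)}"

lemma grad_component_measurable: "(\<lambda>z. pair_grad w z $ k) \<in> borel_measurable borel"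
  using borel_measurable_inner[OF pair_grad_measurable[of w] borel_measurable_const[of "axis k 1"]]
  by (simp add: inner_axis)

lemma deviation_set_measurable:
  assumes "h \<in> borel_measurable borel"
  shows "{\<omega> \<in> space \<Omega>. 4 * npairs * t \<le> \<bar>fluct h \<omega>\<bar>} \<in> events"
proof -
  have "fluct h \<in> borel_measurable \<Omega>"
    by (intro borel_measurable_sum borel_measurable_diff at_pair_measurable[OF assms] borel_measurable_const)
  then show ?thesis by measurable
qed

lemma prob_concentrated:
  assumes t: "0 < t" "t \<le> 8 * Kdev"
  shows "concentrated w t \<in> events"
    "1 - mult_const * real n * exp (- (real n * t\<^sup>2 / (32 * Kdev))) \<le> prob (concentrated w t)"
proof -
  define Bad where "Bad h = {\<omega> \<in> space \<Omega>. 4 * npairs * t \<le> \<bar>fluct h \<omega>\<bar>}"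
    for h :: "'d triple \<Rightarrow> real"
  let ?g = "\<lambda>k z. pair_grad w z $ k" and ?i = "\<lambda>m z. of_bool (good \<mu> c \<tau> m z) :: real"
  let ?e = "8 * real n * exp (- (real n * t\<^sup>2 / (32 * Kdev)))"
  have g: "Bad (?g k) \<in> events" "prob (Bad (?g k)) \<le> ?e" for k
  proof -
    show "Bad (?g k) \<in> events" unfolding Bad_def by (rule deviation_set_measurable[OF grad_component_measurable])
    show "prob (Bad (?g k)) \<le> ?e" unfolding Bad_def
    proof (rule pairwise_deviation[OF grad_component_measurable _ t])
      fix p \<omega> assume "at_pair typical p \<omega>"
      then have "norm (at_pair (pair_grad w) p \<omega>) \<le> norm (at_pair mix_x p \<omega>)" by (rule grad_bound)
      moreover have "\<bar>at_pair (?g k) p \<omega>\<bar> \<le> norm (at_pair (pair_grad w) p \<omega>)"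
        unfolding at_pair_def by (rule component_le_norm_cart)
      ultimately show "\<bar>at_pair (?g k) p \<omega>\<bar> \<le> norm (at_pair mix_x p \<omega>) + 1" by linarith
    qed
  qed
  have i: "Bad (?i m) \<in> events" "prob (Bad (?i m)) \<le> ?e" for m
  proof -
    show "Bad (?i m) \<in> events" unfolding Bad_def by (rule deviation_set_measurable) simp
    show "prob (Bad (?i m)) \<le> ?e" unfolding Bad_def
      by (rule pairwise_deviation[OF _ _ t]) (auto simp: at_pair_def add_nonneg_nonneg)
  qed
  have eq: "concentrated w t = space \<Omega> - ((\<Union>k\<in>UNIV. Bad (?g k)) \<union> (\<Union>m\<in>V. Bad (?i m)))"
    by (auto simp: concentrated_def Bad_def not_le[symmetric] simp del: not_le)
  have u: "(\<Union>k\<in>UNIV. Bad (?g k)) \<in> events" "(\<Union>m\<in>V. Bad (?i m)) \<in> events"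
    using g(1) i(1) V(1) by auto
  show "concentrated w t \<in> events" unfolding eq using u by auto
  have "prob ((\<Union>k\<in>UNIV. Bad (?g k)) \<union> (\<Union>m\<in>V. Bad (?i m)))
    \<le> prob (\<Union>k\<in>UNIV. Bad (?g k)) + prob (\<Union>m\<in>V. Bad (?i m))"
    by (rule measure_Un_le[OF u])
  also have "\<dots> \<le> (\<Sum>k\<in>(UNIV :: 'd set). prob (Bad (?g k))) + (\<Sum>m\<in>V. prob (Bad (?i m)))"
    by (intro add_mono finite_measure_subadditive_finite) (use g(1) i(1) V(1) in auto)
  also have "\<dots> \<le> (\<Sum>k\<in>(UNIV :: 'd set). ?e) + (\<Sum>m\<in>V. ?e)"
    by (intro add_mono sum_mono g(2) i(2))
  also have "\<dots> = mult_const * real n * exp (- (real n * t\<^sup>2 / (32 * Kdev)))"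
    by (simp add: mult_const_def algebra_simps)
  finally show "1 - mult_const * real n * exp (- (real n * t\<^sup>2 / (32 * Kdev))) \<le> prob (concentrated w t)"
    unfolding eq using u by (subst prob_compl) auto
qed

text \<open>Since the expected gradient vanishes at \<open>w\<close>, the fluctuation there is the
  empirical gradient itself; passing from components to the norm costs the factor
  \<open>CARD('d)\<close>. The frequencies drop from \<open>q / 32\<close> to no less than
  \<open>q / 64\<close>, so the curvature \<open>sc\<close> survives.\<close>

lemma concentrated_minimizer:
  assumes w: "norm w \<le> radius" "GF w = 0" and r: "0 < r" "r \<le> 1"
    and t: "4 * real CARD('d) * t \<le> sc * r" "4 * t \<le> q / 64" and \<omega>: "\<omega> \<in> concentrated w t"
  shows "\<exists>v. unique_minimizer (L \<omega>) v \<and> norm (v - w) \<le> r"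
proof -
  have k: "\<bar>Gr w \<omega> $ k\<bar> < 4 * t" for k
  proof -
    let ?g = "\<lambda>z. pair_grad w z $ k"
    have c: "at_pair ?g p = (\<lambda>\<omega>. at_pair (pair_grad w) p \<omega> \<bullet> axis k 1)" for p
      by (simp add: at_pair_def fun_eq_iff inner_axis)
    have gr: "Gr w \<omega>' $ k = (\<Sum>p\<in>pairs. at_pair ?g p \<omega>') / npairs" for \<omega>'
      by (simp add: Gr_def at_pair_def divide_inverse_commute)
    have "(\<Sum>p\<in>pairs. expectation (at_pair ?g p)) = npairs * expectation (\<lambda>\<omega>. Gr w \<omega> \<bullet> axis k 1)"
      using npairs_pos n0 unfolding inner_axis gr
      by (simp add: c pair_integrable Bochner_Integration.integral_sum del: mem_Sigma_iff)
    also have "\<dots> = 0" by (simp add: expectation_Gr_inner w(2))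
    finally have e0: "(\<Sum>p\<in>pairs. expectation (at_pair ?g p)) = 0" .
    have "\<bar>fluct ?g \<omega>\<bar> < 4 * npairs * t"
      using \<omega> unfolding concentrated_def by blast
    moreover have "(\<Sum>p\<in>pairs. at_pair ?g p \<omega>) = npairs * (Gr w \<omega> $ k)"
      using npairs_pos n0 unfolding gr by simp
    ultimately have "\<bar>npairs * (Gr w \<omega> $ k)\<bar> < 4 * npairs * t"
      unfolding sum_subtractf e0 by simp
    then show ?thesis using npairs_pos n0 by (simp add: abs_mult)
  qed
  have "norm (Gr w \<omega>) \<le> (\<Sum>k\<in>UNIV. \<bar>Gr w \<omega> $ k\<bar>)" by (rule norm_le_l1_cart)
  also have "\<dots> < (\<Sum>k\<in>(UNIV :: 'd set). 4 * t)" by (rule sum_strict_mono) (use k in auto)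
  also have "\<dots> = 4 * real CARD('d) * t" by simp
  also have "\<dots> \<le> sc * r" by (rule t(1))
  finally have G: "norm (Gr w \<omega>) < sc * r" .
  have Nm: "q / 64 \<le> N m \<omega>" if m: "m \<in> V" for m
  proof -
    let ?i = "hit m"
    have e: "(\<Sum>p\<in>pairs. expectation (at_pair ?i p)) = npairs * expectation (N m)"
      using npairs_pos n0 unfolding N_def[abs_def]
      by (simp add: pair_integrable Bochner_Integration.integral_sum del: mem_Sigma_iff)
    have "(\<Sum>p\<in>pairs. at_pair ?i p \<omega>) = npairs * N m \<omega>" using npairs_pos n0 by (simp add: N_def)
    moreover have "\<bar>fluct ?i \<omega>\<bar> < 4 * npairs * t"
      using \<omega> m unfolding concentrated_def by blast
    ultimately have "\<bar>npairs * N m \<omega> - npairs * expectation (N m)\<bar> < 4 * npairs * t"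
      unfolding sum_subtractf e by simp
    then have "npairs * expectation (N m) - npairs * (4 * t) < npairs * N m \<omega>" by (simp add: abs_less_iff algebra_simps)
    then have "npairs * (expectation (N m) - 4 * t) < npairs * N m \<omega>" by (simp add: algebra_simps)
    then have "expectation (N m) - 4 * t < N m \<omega>" using npairs_pos by (simp only: mult_less_cancel_left_pos)
    then show ?thesis using N_expectation[OF m] t(2) by linarith
  qed
  show ?thesis
  proof (rule locally_strongly_convex_unique_minimizer[OF L_convex, where G = "\<lambda>w. Gr w \<omega>" and R = "radius + 2" and c = sc])
    fix v u :: "real ^ 'd" assume "norm v \<le> radius + 2" "norm u \<le> 1"
    then have R: "norm v \<le> radius + 3" "norm (v + u) \<le> radius + 3"
      using norm_triangle_ineq[of v u] by linarith+
    show "L \<omega> v + Gr v \<omega> \<bullet> u + sc * (norm u)\<^sup>2 \<le> L \<omega> (v + u)"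
    proof (cases "u = 0")
      case False
      then obtain m where m: "m \<in> V" "c * norm u \<le> \<bar>(\<mu> * (2 *\<^sub>R m - 1)) \<bullet> u\<bar>" using Vc by blast
      have "q / 64 * (curv (radius + 3) * (norm u)\<^sup>2) \<le> N m \<omega> * (curv (radius + 3) * (norm u)\<^sup>2)"
        by (rule mult_right_mono[OF Nm[OF m(1)]]) (use curv_pos[of "radius + 3"] in simp)
      then show ?thesis using L_strongly_convex[OF m R, of \<omega>] unfolding sc_def mult.assoc by linarith
    qed simp
  qed (use constants_pos r w(1) G in auto)
qed

theorem minimizer_alignment:
  "\<exists>w_star. unique_minimizer (expected_mask_loss n D M) w_star \<and> w_star \<noteq> 0 \<and>
    (\<forall>\<epsilon>\<in>{0<..<1}. 1 - mult_const * real n * exp (- (rate * real n * \<epsilon>\<^sup>2)) \<le>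
      \<P>((S, T) in \<Omega>. \<exists>w_hat. unique_minimizer (mask_loss n S T) w_hat \<and> w_hat \<noteq> 0 \<and> sim w_hat w_star \<ge> 1 - \<epsilon>))"
proof -
  obtain w where w: "unique_minimizer F w" "norm w \<le> radius" "GF w = 0" "wmin \<le> norm w"
    by (rule F_minimizer)
  have w0: "w \<noteq> 0" using w(4) constants_pos(3) by auto
  show ?thesis unfolding expected_mask_loss_eq
  proof (intro exI[of _ w] conjI ballI w(1) w0)
    fix \<epsilon> :: real assume \<epsilon>: "\<epsilon> \<in> {0<..<1}"
    \<comment> \<open>Makes the distance at most \<open>\<epsilon> / 2\<close> relative to
      \<open>norm w \<ge> wmin\<close>; the minimum with \<open>1\<close> respects the unit bound on
      the radius.\<close>
    define r where "r = min wmin 1 * \<epsilon> / 2"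
    define t where "t = dev * \<epsilon>"
    have mp: "0 < min wmin 1" using constants_pos by simp
    have r: "0 < r" "r \<le> 1" "r \<le> wmin * \<epsilon> / 2"
    proof -
      show "0 < r" using mp \<epsilon> by (simp add: r_def)
      have "min wmin 1 * \<epsilon> \<le> 1 * 1" using \<epsilon> mp by (intro mult_mono) auto
      then show "r \<le> 1" by (simp add: r_def)
      have "min wmin 1 * \<epsilon> \<le> wmin * \<epsilon>" using \<epsilon> by (intro mult_right_mono) auto
      then show "r \<le> wmin * \<epsilon> / 2" by (simp add: r_def)
    qed
    have tp: "0 < t" using constants_pos \<epsilon> by (simp add: t_def)
    have te: "t \<le> dev" using constants_pos(5) \<epsilon> by (simp add: t_def mult_left_le)
    have t8: "t \<le> 8 * Kdev" "4 * t \<le> q / 64" using te by (auto simp: dev_def)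
    have "dev \<le> sc * min wmin 1 / (8 * real CARD('d))" by (simp add: dev_def)
    then have "4 * real CARD('d) * dev \<le> sc * min wmin 1 / 2" by (simp add: field_simps)
    then have "4 * real CARD('d) * dev * \<epsilon> \<le> sc * min wmin 1 / 2 * \<epsilon>" using \<epsilon> by (intro mult_right_mono) auto
    then have td: "4 * real CARD('d) * t \<le> sc * r" by (simp add: t_def r_def mult_ac)
    let ?E = "{\<omega> \<in> space \<Omega>. \<exists>v. unique_minimizer (L \<omega>) v \<and> v \<noteq> 0 \<and> 1 - \<epsilon> \<le> sim v w}"
    \<comment> \<open>Required for monotonicity of the probability in the inclusion of
      \<open>concentrated w t\<close>.\<close>
    have E: "?E \<in> events"
    proof (rule measurable_unique_minimizer_sim)
      show "(\<lambda>\<omega>. L \<omega> v) \<in> borel_measurable \<Omega>" for v using sample_integrable(1) by auto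
      show "continuous_on UNIV (L \<omega>)" for \<omega> using convex_on_continuous[OF open_UNIV L_convex] .
    qed
    have sub: "concentrated w t \<subseteq> ?E"
    proof
      fix \<omega> assume \<omega>: "\<omega> \<in> concentrated w t"
      obtain v where v: "unique_minimizer (L \<omega>) v" "norm (v - w) \<le> r"
        using concentrated_minimizer[OF w(2,3) r(1,2) td t8(2) \<omega>] by blast
      have rel: "norm (v - w) / norm w \<le> \<epsilon> / 2"
      proof -
        have "norm (v - w) \<le> norm w * \<epsilon> / 2"
        proof -
          have "wmin * \<epsilon> \<le> norm w * \<epsilon>" by (rule mult_right_mono[OF w(4)]) (use \<epsilon> in auto)
          then show ?thesis using v(2) r(3) by linarith
        qed
        then show ?thesis using w0 by (simp add: field_simps)
      qed
      have "v \<noteq> 0" using rel \<epsilon> w0 by auto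
      moreover have "1 - \<epsilon> \<le> sim v w"
      proof -
        have "(norm (v - w) / norm w)\<^sup>2 \<le> (\<epsilon> / 2)\<^sup>2" by (rule power_mono[OF rel]) simp
        also have "\<dots> \<le> \<epsilon> / 4" using \<epsilon> by (simp add: power2_eq_square mult_left_le)
        finally show ?thesis using sim_ge[OF \<open>v \<noteq> 0\<close> w0] \<epsilon> by auto
      qed
      moreover have "\<omega> \<in> space \<Omega>" using \<omega> by (simp add: concentrated_def)
      ultimately show "\<omega> \<in> ?E" using v(1) by blast
    qed
    have "real n * t\<^sup>2 / (32 * Kdev) = rate * real n * \<epsilon>\<^sup>2"
      by (simp add: t_def rate_def power_mult_distrib)
    then have "1 - mult_const * real n * exp (- (rate * real n * \<epsilon>\<^sup>2)) \<le> prob (concentrated w t)"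
      using prob_concentrated(2)[OF tp t8(1), of w] by simp
    also have "\<dots> \<le> prob ?E" by (rule finite_measure_mono[OF sub E])
    also have "?E = {\<omega> \<in> space \<Omega>. case \<omega> of (S, T) \<Rightarrow>
        \<exists>w_hat. unique_minimizer (mask_loss n S T) w_hat \<and> w_hat \<noteq> 0 \<and> sim w_hat w \<ge> 1 - \<epsilon>}"
      by (auto simp: L_def[abs_def])
    finally show "1 - mult_const * real n * exp (- (rate * real n * \<epsilon>\<^sup>2)) \<le>
      \<P>((S, T) in \<Omega>. \<exists>w_hat. unique_minimizer (mask_loss n S T) w_hat \<and> w_hat \<noteq> 0 \<and> sim w_hat w \<ge> 1 - \<epsilon>)"
      by (simp add: case_prod_unfold)
  qed
qed

end

section \<open>The mask distribution\<close>

text \<open>Each point outside the support has a basic open null neighborhood, and a countable basis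
  leaves only countably many of these.\<close>

lemma AE_measure_support:
  fixes N :: "'a::second_countable_topology measure"
  assumes sets: "sets N = sets borel"
  shows "AE x in N. x \<in> measure_support N"
proof -
  obtain B :: "'a set set" where B: "countable B" "topological_basis B" using ex_countable_basis by blast
  let ?Z = "{U \<in> B. emeasure N U = 0}"
  have null: "U \<in> null_sets N" if "U \<in> ?Z" for U
    using that topological_basis_open[OF B(2)] sets by (auto simp: null_sets_def)
  have nul: "(\<Union>U\<in>?Z. U) \<in> null_sets N"
    by (rule null_sets_UN') (use B(1) null in auto)
  have *: "x \<in> (\<Union>U\<in>?Z. U)" if x: "x \<notin> measure_support N" for x
  proof -
    obtain W where W: "open W" "x \<in> W" "emeasure N W = 0"
      using x by (auto simp: measure_support_def)
    obtain U where U: "U \<in> B" "x \<in> U" "U \<subseteq> W" using topological_basisE[OF B(2) W(1,2)] by blast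
    have "emeasure N U \<le> emeasure N W" using U(3) W(1) sets by (intro emeasure_mono) auto
    then show ?thesis using U W(3) by auto
  qed
  show ?thesis by (rule AE_I'[OF nul]) (use * in blast)
qed

lemma finite_cube: "finite {m :: real ^ 'd. \<forall>k. m $ k \<in> {0, 1}}"
proof (rule finite_subset)
  show "{m :: real ^ 'd. \<forall>k. m $ k \<in> {0, 1}} \<subseteq> range (\<lambda>A. \<chi> k. if k \<in> A then 1 else 0)"
  proof
    fix m :: "real ^ 'd" assume "m \<in> {m. \<forall>k. m $ k \<in> {0, 1}}"
    then have "m = (\<chi> k. if k \<in> {k. m $ k = 1} then 1 else 0)" by (auto simp: vec_eq_iff)
    then show "m \<in> range (\<lambda>A. \<chi> k. if k \<in> A then 1 else 0)" by blast
  qed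
qed simp

text \<open>The mask support lies in the finite cube, so positive quantities attached to single
  masks have a positive minimum.\<close>

lemma mask_assumption_quantitative:
  fixes \<mu> :: "real ^ 'd"
  assumes dist: "mask_dist M" and ass: "mask_assumption \<mu> M"
  obtains V :: "(real ^ 'd) set" and \<tau> q c :: real where
    "AE t in M. (\<forall>k. fst t $ k \<in> {0, 1}) \<and> snd t \<in> {0..1}"
    "finite V" "V \<noteq> {}" "\<And>m k. m \<in> V \<Longrightarrow> m $ k \<in> {0, 1}" "0 < \<tau>" "0 < q" "0 < c"
    "\<And>m. m \<in> V \<Longrightarrow> q \<le> measure M {t. fst t = m \<and> snd t \<in> {\<tau>..1 - \<tau>}}"
    "\<And>u. u \<noteq> 0 \<Longrightarrow> \<exists>m\<in>V. c * norm u \<le> \<bar>(\<mu> * (2 *\<^sub>R m - 1)) \<bullet> u\<bar>"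
proof -
  have M: "prob_space M" "sets M = sets borel" "measure_support M \<subseteq> {m. \<forall>k. m $ k \<in> {0, 1}} \<times> {0..1}"
    using dist by (auto simp: mask_dist_def)
  interpret prob_space M by (rule M(1))
  note M(2) [measurable_cong]
  have spM: "space M = UNIV" using sets_eq_imp_space_eq[OF M(2)] by simp
  define V where "V = measure_support (distr M borel fst)"
  have sp: "span {\<mu> * (2 *\<^sub>R m0 - 1) | m0. m0 \<in> V} = UNIV"
    and pos: "\<And>m. m \<in> V \<Longrightarrow> 0 < prob {t \<in> space M. snd t * indicator {m} (fst t) \<notin> {0, 1}}"
    using ass unfolding mask_assumption_def V_def[symmetric] Let_def by (simp_all add: case_prod_unfold)
  have mask: "AE t in M. (\<forall>k. fst t $ k \<in> {0, 1}) \<and> snd t \<in> {0..1}"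
    using AE_measure_support[OF M(2)]
  proof eventually_elim
    case (elim t)
    then have "t \<in> {m. \<forall>k. m $ k \<in> {0, 1}} \<times> {0..1}" using M(3) by blast
    then show ?case by (simp add: mem_Times_iff)
  qed
  have Vsub: "V \<subseteq> {m. \<forall>k. m $ k \<in> {0, 1}}"
  proof
    fix m assume m: "m \<in> V"
    let ?U = "- {m :: real ^ 'd. \<forall>k. m $ k \<in> {0, 1}}"
    have U: "open ?U" using finite_imp_closed[OF finite_cube] by (rule open_Compl)
    show "m \<in> {m. \<forall>k. m $ k \<in> {0, 1}}"
    proof (rule ccontr)
      assume "m \<notin> {m. \<forall>k. m $ k \<in> {0, 1}}"
      then have "0 < emeasure (distr M borel fst) ?U" using m U unfolding V_def measure_support_def by blast
      also have "emeasure (distr M borel fst) ?U = emeasure M (fst -` ?U \<inter> space M)"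
        using U by (intro emeasure_distr) auto
      also have "\<dots> = 0"
      proof -
        have "AE t in M. t \<notin> fst -` ?U \<inter> space M" using mask by eventually_elim auto
        moreover have "fst -` ?U \<inter> space M \<in> sets M" using U by (intro measurable_sets[of fst M borel]) auto
        ultimately show ?thesis
          using AE_iff_measurable[of "fst -` ?U \<inter> space M" M "\<lambda>t. t \<notin> fst -` ?U \<inter> space M"] by auto
      qed
      finally show False by simp
    qed
  qed
  have Vfin: "finite V" using finite_subset[OF Vsub finite_cube] .
  have img: "{\<mu> * (2 *\<^sub>R m0 - 1) | m0. m0 \<in> V} = (\<lambda>m. \<mu> * (2 *\<^sub>R m - 1)) ` V" by auto
  have Vne: "V \<noteq> {}"
  proof
    assume "V = {}"
    then have "(UNIV :: (real ^ 'd) set) = {0}" using sp by simp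
    then show False by (metis (full_types) UNIV_I singletonD zero_neq_one)
  qed
  obtain c where c: "0 < c" "\<And>u. u \<noteq> 0 \<Longrightarrow> \<exists>v\<in>(\<lambda>m. \<mu> * (2 *\<^sub>R m - 1)) ` V. c * norm u \<le> \<bar>v \<bullet> u\<bar>"
    using span_UNIV_uniform_direction[of "(\<lambda>m. \<mu> * (2 *\<^sub>R m - 1)) ` V"] sp Vfin unfolding img by auto
  \<comment> \<open>These sets increase with \<open>k\<close>; their union is the event that the
    mask is \<open>m\<close> and the weight lies strictly between \<open>0\<close> and
    \<open>1\<close>. For weights in \<open>[0, 1]\<close> this is exactly the event of the
    assumption.\<close>
  define C where "C m k = {t :: (real ^ 'd) \<times> real. fst t = m \<and> snd t \<in> {1 / real (Suc k)..1 - 1 / real (Suc k)}}" for m k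
  have Cs: "C m k \<in> sets M" for m k
  proof -
    have "closed (C m k)" unfolding C_def atLeastAtMost_iff
      by (intro closed_Collect_conj closed_Collect_eq closed_Collect_le continuous_intros)
    then show ?thesis using M(2) by simp
  qed
  have ex: "\<exists>k. 0 < prob (C m k)" if m: "m \<in> V" for m
  proof (rule ccontr)
    assume "\<not> ?thesis"
    then have z: "prob (C m k) = 0" for k using measure_nonneg[of M "C m k"] by (metis less_le)
    then have "C m k \<in> null_sets M" for k using Cs by (auto simp: null_sets_def emeasure_eq_measure)
    then have n: "(\<Union>k. C m k) \<in> null_sets M" by (intro null_sets_UN) auto
    have "AE t in M. t \<notin> (\<Union>k. C m k)" by (rule AE_not_in[OF n])
    then have "AE t in M. \<not> snd t * indicator {m} (fst t) \<notin> {0, 1}"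
      using mask
    proof eventually_elim
      case (elim t)
      obtain x l where t: "t = (x, l)" by (cases t)
      show ?case
      proof (rule ccontr)
        assume "\<not> ?thesis"
        then have xl: "x = m" "l \<noteq> 0" "l \<noteq> 1" by (auto simp: t indicator_def split: if_splits)
        then have l: "0 < l" "l < 1" using elim(2) by (auto simp: t)
        obtain k where k: "1 / real (Suc k) < min l (1 - l)" using l nat_approx_posE[of "min l (1 - l)"] by auto
        then have "t \<in> C m k" using xl(1) by (auto simp: C_def t)
        then show False using elim(1) by blast
      qed
    qed
    moreover have ms: "{t \<in> space M. snd t * indicator {m} (fst t) \<notin> {0, 1}} \<in> sets M"
    proof -
      have [measurable]: "{m} \<in> sets (borel :: (real ^ 'd) measure)" by simp
      have "{t \<in> space M. snd t * indicator {m} (fst t) \<noteq> 0 \<and> snd t * indicator {m} (fst t) \<noteq> 1} \<in> sets M"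
        by measurable
      then show ?thesis by simp
    qed
    ultimately have "prob {t \<in> space M. snd t * indicator {m} (fst t) \<notin> {0, 1}} = 0"
      using prob_eq_0[OF ms] by auto
    then show False using pos[OF m] by simp
  qed
  then obtain k where k: "\<And>m. m \<in> V \<Longrightarrow> 0 < prob (C m (k m))" by metis
  \<comment> \<open>One margin for all masks; enlarging \<open>k\<close> only enlarges the sets
    \<open>C m k\<close>.\<close>
  define k' where "k' = Max (k ` V)"
  have k': "k m \<le> k'" if "m \<in> V" for m using that Vfin by (simp add: k'_def)
  define \<tau> where "\<tau> = 1 / real (Suc k')"
  define q where "q = Min ((\<lambda>m. prob (C m (k m))) ` V)"
  have q: "0 < q" unfolding q_def by (subst Min_gr_iff) (use Vfin Vne k in auto)
  have "q \<le> prob {t. fst t = m \<and> snd t \<in> {\<tau>..1 - \<tau>}}" if m: "m \<in> V" for m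
  proof -
    have "q \<le> prob (C m (k m))" unfolding q_def using Vfin m by simp
    also have "\<dots> \<le> prob (C m k')"
    proof (rule finite_measure_mono[OF _ Cs])
      have "1 / real (Suc k') \<le> 1 / real (Suc (k m))" using k'[OF m] by (intro divide_left_mono) auto
      then show "C m (k m) \<subseteq> C m k'" unfolding C_def by auto
    qed
    finally show ?thesis by (simp add: C_def \<tau>_def)
  qed
  moreover have "0 < \<tau>" by (simp add: \<tau>_def)
  moreover have "\<exists>m\<in>V. c * norm u \<le> \<bar>(\<mu> * (2 *\<^sub>R m - 1)) \<bullet> u\<bar>" if "u \<noteq> 0" for u
    using c(2)[OF that] by auto
  ultimately show ?thesis using that[of V \<tau> q c] mask Vfin Vne Vsub q c(1) by blast
qed

text \<open>The factor \<open>n\<close> is expressed through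
  \<open>y = \<kappa> * n * \<epsilon>\<^sup>2\<close> and absorbed by half of the exponent. The
  other half is at least \<open>Q * S\<close> and pays for \<open>2 * A / \<kappa>\<close>, for
  \<open>1 / \<epsilon>\<^sup>2\<close> and for \<open>1 / \<delta>\<close>; the coefficient of
  \<open>ln (1 / \<epsilon>)\<close> explains the \<open>2\<close> in the maximum.\<close>

lemma exponential_bound_absorbed:
  fixes A \<kappa> :: real
  assumes A: "0 < A" and k: "0 < \<kappa>" and C: "2 * max 2 (ln (2 * A / \<kappa>)) / \<kappa> \<le> C"
    and \<epsilon>: "0 < \<epsilon>" "\<epsilon> < 1" and \<delta>: "0 < \<delta>" "\<delta> < 1"
    and n: "C / \<epsilon> ^ 4 * (1 + ln (1 / \<epsilon>) + ln (1 / \<delta>)) \<le> n"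
  shows "A * n * exp (- (\<kappa> * n * \<epsilon>\<^sup>2)) \<le> \<delta>"
proof -
  define Q where "Q = max 2 (ln (2 * A / \<kappa>))"
  define S where "S = 1 + ln (1 / \<epsilon>) + ln (1 / \<delta>)"
  define y where "y = \<kappa> * n * \<epsilon>\<^sup>2"
  have l: "0 \<le> ln (1 / \<epsilon>)" "0 \<le> ln (1 / \<delta>)" using \<epsilon> \<delta> by auto
  then have S: "1 \<le> S" by (simp add: S_def)
  have QC: "2 * Q \<le> \<kappa> * C" using C k by (simp add: Q_def field_simps)
  have Q2: "2 \<le> Q" "ln (2 * A / \<kappa>) \<le> Q" by (auto simp: Q_def)
  have "2 * Q * S \<le> \<kappa> * C * S" using QC S by (intro mult_right_mono) auto
  also have "\<dots> \<le> \<kappa> * C * S / \<epsilon>\<^sup>2"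
  proof -
    have "0 \<le> \<kappa> * C * S" using QC Q2 S by (intro mult_nonneg_nonneg[of "\<kappa> * C"]) linarith+
    moreover have "\<epsilon>\<^sup>2 \<le> 1" using \<epsilon> by (simp add: power_le_one)
    ultimately show ?thesis using \<epsilon> by (simp add: pos_le_divide_eq mult_left_le)
  qed
  also have "\<dots> = \<kappa> * (C / \<epsilon> ^ 4 * S) * \<epsilon>\<^sup>2" using \<epsilon> by (simp add: field_simps power2_eq_square power4_eq_xxxx)
  also have "\<dots> \<le> y" unfolding y_def S_def using n k by (intro mult_right_mono mult_left_mono) auto
  finally have y: "2 * Q * S \<le> y" .
  have e1: "y * exp (- y) \<le> 2 * exp (- (y / 2))"
  proof -
    have "y \<le> 2 * exp (y / 2)" using exp_ge_add_one_self[of "y / 2"] by linarith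
    then have "y * exp (- y) \<le> 2 * exp (y / 2) * exp (- y)" by (rule mult_right_mono) simp
    then show ?thesis by (simp add: mult.assoc exp_add[symmetric])
  qed
  have e2: "exp (- (y / 2)) \<le> \<kappa> / (2 * A) * (\<epsilon>\<^sup>2 * \<delta>)"
  proof -
    have "ln (2 * A / \<kappa>) + (2 * ln (1 / \<epsilon>) + 1 * ln (1 / \<delta>)) \<le> Q * 1 + (Q * ln (1 / \<epsilon>) + Q * ln (1 / \<delta>))"
      using Q2 l by (intro add_mono mult_right_mono) auto
    also have "\<dots> = Q * S" by (simp add: S_def algebra_simps)
    also have "\<dots> \<le> y / 2" using y by simp
    finally have "exp (- (y / 2)) \<le> exp (- ln (2 * A / \<kappa>)) * (exp (- (2 * ln (1 / \<epsilon>))) * exp (- ln (1 / \<delta>)))"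
      by (simp add: exp_add[symmetric])
    moreover have "exp (- ln (2 * A / \<kappa>)) = \<kappa> / (2 * A)" using A k by (simp add: exp_minus)
    moreover have "exp (- (2 * ln (1 / \<epsilon>))) = \<epsilon>\<^sup>2" using \<epsilon> by (simp add: ln_div exp_double)
    moreover have "exp (- ln (1 / \<delta>)) = \<delta>" using \<delta> by (simp add: ln_div)
    ultimately show ?thesis by simp
  qed
  have "A * n * exp (- y) = (A / (\<kappa> * \<epsilon>\<^sup>2)) * (y * exp (- y))"
    using k \<epsilon> by (simp add: y_def)
  also have "\<dots> \<le> (A / (\<kappa> * \<epsilon>\<^sup>2)) * (2 * (\<kappa> / (2 * A) * (\<epsilon>\<^sup>2 * \<delta>)))"
  proof (rule mult_left_mono)
    show "y * exp (- y) \<le> 2 * (\<kappa> / (2 * A) * (\<epsilon>\<^sup>2 * \<delta>))" using e1 e2 by linarith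
  qed (use A k in simp)
  also have "\<dots> = \<delta>" using A k \<epsilon> by simp
  finally show ?thesis by (simp add: y_def)
qed

theorem theorem5p4:
  fixes \<mu> :: "real ^ 'd" and \<Sigma> :: "real ^ 'd ^ 'd" and \<M> :: "((real ^ 'd) \<times> real) measure"
  assumes "\<mu> \<noteq> 0"
    and "pos_definite \<Sigma>"
    and "(norm \<mu>)\<^sup>2 = spectral_norm \<Sigma>"
    and "mask_dist \<M>"
    and "mask_assumption \<mu> \<M>"
  shows "\<exists>C > 0. \<exists>\<kappa>\<^sub>0 > 0. \<forall>\<kappa> \<ge> \<kappa>\<^sub>0. \<forall>\<epsilon> \<in> {0<..<1}. \<forall>\<delta> \<in> {0<..<1}. \<forall>n \<ge> 2.
    real n \<ge> C / \<epsilon> ^ 4 * (1 + ln (1 / \<epsilon>) + ln (1 / \<delta>)) \<longrightarrow>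
    (\<exists>w_star. unique_minimizer (expected_mask_loss n (data_dist \<mu> \<Sigma> \<kappa>) \<M>) w_star \<and> w_star \<noteq> 0 \<and>
      \<P>((S, T) in sample_dist n (data_dist \<mu> \<Sigma> \<kappa>) \<M>.
        \<exists>w_hat. unique_minimizer (mask_loss n S T) w_hat \<and> w_hat \<noteq> 0 \<and>
          sim w_hat w_star \<ge> 1 - \<epsilon>) \<ge> 1 - \<delta>)"
proof -
  obtain V :: "(real ^ 'd) set" and \<tau> q c :: real where mask:
    "AE t in \<M>. (\<forall>k. fst t $ k \<in> {0, 1}) \<and> snd t \<in> {0..1}"
    "finite V" "V \<noteq> {}" "\<And>m k. m \<in> V \<Longrightarrow> m $ k \<in> {0, 1}" "0 < \<tau>" "0 < q" "0 < c"
    "\<And>m. m \<in> V \<Longrightarrow> q \<le> measure \<M> {t. fst t = m \<and> snd t \<in> {\<tau>..1 - \<tau>}}"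
    "\<And>u. u \<noteq> 0 \<Longrightarrow> \<exists>m\<in>V. c * norm u \<le> \<bar>(\<mu> * (2 *\<^sub>R m - 1)) \<bullet> u\<bar>"
    using mask_assumption_quantitative[OF assms(4,5)] by blast
  \<comment> \<open>The noise level is dictated by the mask constants alone, before
    \<open>\<kappa>\<^sub>0\<close> is chosen.\<close>
  define \<rho> where "\<rho> = min (c / 16) (norm \<mu> * \<tau> * q / 4)"
  have \<rho>: "0 < \<rho>" using mask(5-7) assms(1) by (simp add: \<rho>_def)
  obtain K where K: "0 < K" "\<And>\<rho>. 0 < \<rho> \<Longrightarrow> \<exists>\<kappa>\<^sub>0 > 0. \<forall>\<kappa> \<ge> \<kappa>\<^sub>0. regular_data \<mu> K \<rho> (data_dist \<mu> \<Sigma> \<kappa>)"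
    using data_dist_regular[OF assms(2)] by blast
  obtain \<kappa>\<^sub>0 where \<kappa>\<^sub>0: "0 < \<kappa>\<^sub>0" "\<And>\<kappa>. \<kappa> \<ge> \<kappa>\<^sub>0 \<Longrightarrow> regular_data \<mu> K \<rho> (data_dist \<mu> \<Sigma> \<kappa>)"
    using K(2)[OF \<rho>] by blast
  have mixup: "mixup (data_dist \<mu> \<Sigma> \<kappa>) \<M> n \<mu> V \<tau> q c K" if \<kappa>: "\<kappa>\<^sub>0 \<le> \<kappa>" and n: "2 \<le> n" for \<kappa> n
  proof -
    let ?D = "data_dist \<mu> \<Sigma> \<kappa>"
    note D = \<kappa>\<^sub>0(2)[OF \<kappa>, unfolded regular_data_def]
    have [measurable_cong]: "sets ?D = sets borel" using D by blast
    have e: "(\<integral>\<^sup>+p. ennreal (exp (4 * norm (fst p))) \<partial>?D) \<le> ennreal K"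
      and r: "(\<integral>\<^sup>+p. ennreal (norm (fst p - (2 * snd p - 1) *\<^sub>R \<mu>)) \<partial>?D) \<le> ennreal \<rho>" using D by blast+
    show ?thesis
    proof (intro mixup.intro iid_sample.intro mixup_axioms.intro)
      show "prob_space ?D" "sets ?D = sets borel" "AE p in ?D. snd p \<in> {0, 1}" using D by blast+
      have "(1 / 2 :: ennreal) = ennreal (1 / 2)"
        using ennreal_divide_numeral[of 1 "Num.Bit0 Num.One"] by simp
      then have "emeasure ?D {p. snd p = 1} = ennreal (1 / 2)" using D by metis
      then show "measure ?D {p. snd p = 1} = 1 / 2" by (rule measure_eq_emeasure_eq_ennreal[rotated]) simp
      show "prob_space \<M>" "sets \<M> = sets borel" using assms(4) by (auto simp: mask_dist_def)
      show "integrable ?D (\<lambda>p. exp (4 * norm (fst p)))"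
        by (rule integrableI_nonneg) (use e ennreal_less_top[of K] in \<open>auto intro: le_less_trans\<close>)
      show "(\<integral>p. exp (4 * norm (fst p)) \<partial>?D) \<le> K"
        by (rule integral_real_bounded) (use K(1) e in auto)
      show "(\<integral>p. norm (fst p - (2 * snd p - 1) *\<^sub>R \<mu>) \<partial>?D) \<le> min (c / 16) (norm \<mu> * \<tau> * q / 4)"
        unfolding \<rho>_def[symmetric] by (rule integral_real_bounded) (use \<rho> r in auto)
    qed (use n assms(1) mask in auto)
  qed
  \<comment> \<open>Neither constant involves \<open>\<kappa>\<close> or \<open>n\<close>; their
    positivity is read off from the single instance with \<open>\<kappa>\<^sub>0\<close> and
    \<open>n = 2\<close>.\<close>
  define A where "A = mixup.mult_const V"
  define k where "k = mixup.rate \<mu> \<tau> q c K"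
  have pos: "0 < A" "0 < k"
    using mixup.constants_pos[OF mixup[OF order_refl order_refl]] by (simp_all add: A_def k_def)
  define C where "C = 2 * max 2 (ln (2 * A / k)) / k"
  have C: "0 < C" using pos by (simp add: C_def)
  show ?thesis
  proof (rule exI[of _ C], rule conjI[OF C], rule exI[of _ \<kappa>\<^sub>0], intro conjI \<kappa>\<^sub>0(1) allI impI ballI)
    fix \<kappa> \<epsilon> \<delta> :: real and n :: nat
    assume \<kappa>: "\<kappa>\<^sub>0 \<le> \<kappa>" and \<epsilon>: "\<epsilon> \<in> {0<..<1}" and \<delta>: "\<delta> \<in> {0<..<1}" and n: "2 \<le> n"
      and large: "C / \<epsilon> ^ 4 * (1 + ln (1 / \<epsilon>) + ln (1 / \<delta>)) \<le> real n"
    have le: "A * real n * exp (- (k * real n * \<epsilon>\<^sup>2)) \<le> \<delta>"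
      by (rule exponential_bound_absorbed[OF pos _ _ _ _ _ large]) (use \<epsilon> \<delta> in \<open>auto simp: C_def\<close>)
    obtain w where w: "unique_minimizer (expected_mask_loss n (data_dist \<mu> \<Sigma> \<kappa>) \<M>) w" "w \<noteq> 0"
      "1 - A * real n * exp (- (k * real n * \<epsilon>\<^sup>2)) \<le>
        \<P>((S, T) in sample_dist n (data_dist \<mu> \<Sigma> \<kappa>) \<M>.
          \<exists>w_hat. unique_minimizer (mask_loss n S T) w_hat \<and> w_hat \<noteq> 0 \<and> sim w_hat w \<ge> 1 - \<epsilon>)"
      using mixup.minimizer_alignment[OF mixup[OF \<kappa> n]] \<epsilon> unfolding A_def k_def by blast
    show "\<exists>w_star. unique_minimizer (expected_mask_loss n (data_dist \<mu> \<Sigma> \<kappa>) \<M>) w_star \<and> w_star \<noteq> 0 \<and>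
      \<P>((S, T) in sample_dist n (data_dist \<mu> \<Sigma> \<kappa>) \<M>.
        \<exists>w_hat. unique_minimizer (mask_loss n S T) w_hat \<and> w_hat \<noteq> 0 \<and>
          sim w_hat w_star \<ge> 1 - \<epsilon>) \<ge> 1 - \<delta>"
      by (intro exI[of _ w] conjI w(1,2) order_trans[OF _ w(3)]) (use le in simp)
  qed
qed

end
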